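(* Let $R=\bigoplus_{n\ge0}R^{(n)}$ be a commutative graded $\mathbb{Z}$-algebra with each homogeneous piece $R^{(n)}$ a free $\mathbb{Z}$-module. Suppose that, for each $\ell\in\mathrm{Spec}(\mathbb{Z})$, there exists a graded subset $Y_\ell=\coprod_{n\ge1}Y_\ell^{(n)}$ of $R\otimes\mathbb{Z}_\ell$ with the following properties. (a) For each fixed $n\ge 0$, $|Y_\ell^{(n)}|$ is finite with the same cardinality when $\ell\in\mathrm{Spec}(\mathbb{Z})$ varies. (b) For every $\ell\in\mathrm{Spec}(\mathbb{Z})$, $R\otimes\mathbb{Z}_\ell=\mathbb{Z}_\ell[Y_\ell]$ as a graded $\mathbb{Z}_\ell$-algebra. Then there is a graded subset $Y=\coprod_{n\ge0}Y^{(n)}$ of $R$ such that (i) $|Y^{(n)}|=|Y_0^{(n)}|$ for all $n\ge0$; (ii) $R\cong\mathbb{Z}[Y]$ as a graded algebra.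
   Context: $\mathrm{Spec}(\mathbb{Z})=\{0\}\cup\{p\mid p\text{ a prime number}\}$. For a prime $\ell$, $\mathbb{Z}_\ell$ is the ring of $\ell$-adic integers, and $\mathbb{Z}_0:=\mathbb{Q}$. Algebras are unital, $\otimes$ is over $\mathbb{Z}$. A graded subset means $Y_\ell^{(n)}\subset(R\otimes\mathbb{Z}_\ell)^{(n)}=R^{(n)}\otimes\mathbb{Z}_\ell$ (and likewise $Y^{(n)}\subset R^{(n)}$); by convention $Y_\ell^{(0)}=\emptyset$. For a commutative ring $\mathbf{k}$ and a graded set $Y$, the polynomial algebra $\mathbf{k}[Y]$ is graded by giving each $y\in Y^{(n)}$ degree $n$ and extending multiplicatively. "$R\otimes\mathbb{Z}_\ell=\mathbb{Z}_\ell[Y_\ell]$" means that $R\otimes\mathbb{Z}_\ell$ is the polynomial algebra freely generated by its subset $Y_\ell$. *)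

theory Defs
  imports
    "HOL-Algebra.Algebra"
    "HOL-Algebra.Algebraic_Closure_Type"
    "HOL-Algebra.Free_Abelian_Groups"
    "HOL-Library.Disjoint_Sets"
    "HOL-Library.Multiset"
begin

section \<open>Graded rings\<close>

locale graded_cring = cring R for R (structure) +
  fixes Rg :: "nat \<Rightarrow> 'a set"
  assumes piece_subgroup: "additive_subgroup (Rg n) R"
    and one_in_piece: "\<one> \<in> Rg 0"
    and mult_in_piece: "\<lbrakk>x \<in> Rg m; y \<in> Rg n\<rbrakk> \<Longrightarrow> x \<otimes> y \<in> Rg (m + n)"
    and direct_sum: "x \<in> carrier R \<Longrightarrow>
      \<exists>!c. (\<forall>n. c n \<in> Rg n) \<and> finite {n. c n \<noteq> \<zero>} \<and> x = (\<Oplus>n\<in>{n. c n \<noteq> \<zero>}. c n)"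

text \<open>A graded subset is given by the family of its homogeneous pieces; the set itself is
  the disjoint union of the family.\<close>

definition graded_subset :: "(nat \<Rightarrow> 'a set) \<Rightarrow> (nat \<Rightarrow> 'a set) \<Rightarrow> bool" where
  "graded_subset Sg Y \<longleftrightarrow> (\<forall>n. Y n \<subseteq> Sg n) \<and> disjoint_family Y"


section \<open>Monoid rings\<close>

text \<open>The ring of formal finite sums of elements of \<open>M\<close> with coefficients in \<open>k\<close>, a sum
  being its coefficient function, extended by zero outside the carrier of \<open>M\<close>.\<close>

definition monoid_ring :: "('k, 'b) ring_scheme \<Rightarrow> ('m, 'c) monoid_scheme \<Rightarrow> ('m \<Rightarrow> 'k) ring" where
  "monoid_ring k M =
    \<lparr>carrier = {f. (\<forall>m\<in>carrier M. f m \<in> carrier k) \<and> (\<forall>m. m \<notin> carrier M \<longrightarrow> f m = \<zero>\<^bsub>k\<^esub>)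
                  \<and> finite {m. f m \<noteq> \<zero>\<^bsub>k\<^esub>}},
     monoid.mult = (\<lambda>f g m.
       finsum k (\<lambda>(a, b). f a \<otimes>\<^bsub>k\<^esub> g b)
         {(a, b). f a \<noteq> \<zero>\<^bsub>k\<^esub> \<and> g b \<noteq> \<zero>\<^bsub>k\<^esub> \<and> a \<otimes>\<^bsub>M\<^esub> b = m}),
     one = (\<lambda>m. if m = \<one>\<^bsub>M\<^esub> then \<one>\<^bsub>k\<^esub> else \<zero>\<^bsub>k\<^esub>),
     ring.zero = (\<lambda>m. \<zero>\<^bsub>k\<^esub>),
     add = (\<lambda>f g m. f m \<oplus>\<^bsub>k\<^esub> g m)\<rparr>"

definition mr_single :: "('k, 'b) ring_scheme \<Rightarrow> 'm \<Rightarrow> 'k \<Rightarrow> 'm \<Rightarrow> 'k" where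
  "mr_single k m c = (\<lambda>x. if x = m then c else \<zero>\<^bsub>k\<^esub>)"


section \<open>Polynomial algebras\<close>

text \<open>Monomials in the elements of \<open>Y\<close> are finite multisets, i.e. elements of the free
  commutative monoid on \<open>Y\<close>.\<close>

definition monomials :: "'y set \<Rightarrow> 'y multiset monoid" where
  "monomials Y = \<lparr>carrier = {m. set_mset m \<subseteq> Y}, monoid.mult = (+), one = {#}\<rparr>"

definition poly_alg :: "('k, 'b) ring_scheme \<Rightarrow> 'y set \<Rightarrow> ('y multiset \<Rightarrow> 'k) ring" where
  "poly_alg k Y = monoid_ring k (monomials Y)"

text \<open>The index is well defined on the union of \<open>Y\<close> only when the family is disjoint.\<close>

definition gen_degree :: "(nat \<Rightarrow> 'y set) \<Rightarrow> 'y \<Rightarrow> nat" where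
  "gen_degree Y y = (THE n. y \<in> Y n)"

definition poly_alg_piece ::
    "('k, 'b) ring_scheme \<Rightarrow> (nat \<Rightarrow> 'y set) \<Rightarrow> nat \<Rightarrow> ('y multiset \<Rightarrow> 'k) set" where
  "poly_alg_piece k Y n =
    {f \<in> carrier (poly_alg k (\<Union>i. Y i)).
      \<forall>m. f m \<noteq> \<zero>\<^bsub>k\<^esub> \<longrightarrow> (\<Sum>y\<in>#m. gen_degree Y y) = n}"

text \<open>\<open>S\<close> is a \<open>k\<close>-algebra through the structure map \<open>\<phi>\<close>, with homogeneous pieces \<open>Sg\<close>.
  The predicate says that \<open>S\<close> is the polynomial algebra freely generated by its graded subset
  \<open>Y\<close>: the inclusion of \<open>Y\<close> into \<open>S\<close> extends to an isomorphism of graded \<open>k\<close>-algebras from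
  the polynomial algebra on \<open>Y\<close> to \<open>S\<close>.\<close>

definition graded_poly_alg_on ::
    "('k, 'b) ring_scheme \<Rightarrow> ('s, 'c) ring_scheme \<Rightarrow> (nat \<Rightarrow> 's set) \<Rightarrow> ('k \<Rightarrow> 's) \<Rightarrow>
     (nat \<Rightarrow> 's set) \<Rightarrow> bool" where
  "graded_poly_alg_on k S Sg \<phi> Y \<longleftrightarrow>
    (\<exists>h \<in> ring_iso (poly_alg k (\<Union>i. Y i)) S.
       (\<forall>c\<in>carrier k. h (mr_single k {#} c) = \<phi> c) \<and>
       (\<forall>n. h ` poly_alg_piece k Y n = Sg n) \<and>
       (\<forall>y\<in>(\<Union>i. Y i). h (mr_single k {#y#} \<one>\<^bsub>k\<^esub>) = y))"


section \<open>Tensor products over the integers\<close>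

text \<open>The tensor product of two commutative rings is the quotient of the integral monoid ring on
  pairs, multiplied componentwise, by the biadditivity relations. These relations are stable under
  multiplication by pairs, so the ideal they generate is the additive subgroup they generate, and
  the additive group of the quotient is the usual tensor product of abelian groups.\<close>

definition pair_ring ::
    "('r, 'b) ring_scheme \<Rightarrow> ('a, 'c) ring_scheme \<Rightarrow> ('r \<times> 'a \<Rightarrow> int) ring" where
  "pair_ring R A = monoid_ring \<Z> (R \<times>\<times> A)"

definition tensor_rels ::
    "('r, 'b) ring_scheme \<Rightarrow> ('a, 'c) ring_scheme \<Rightarrow> ('r \<times> 'a \<Rightarrow> int) set" where
  "tensor_rels R A =
    {mr_single \<Z> (r \<oplus>\<^bsub>R\<^esub> s, a) 1 \<ominus>\<^bsub>pair_ring R A\<^esub>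
       (mr_single \<Z> (r, a) 1 \<oplus>\<^bsub>pair_ring R A\<^esub> mr_single \<Z> (s, a) 1) | r s a.
       r \<in> carrier R \<and> s \<in> carrier R \<and> a \<in> carrier A} \<union>
    {mr_single \<Z> (r, a \<oplus>\<^bsub>A\<^esub> b) 1 \<ominus>\<^bsub>pair_ring R A\<^esub>
       (mr_single \<Z> (r, a) 1 \<oplus>\<^bsub>pair_ring R A\<^esub> mr_single \<Z> (r, b) 1) | r a b.
       r \<in> carrier R \<and> a \<in> carrier A \<and> b \<in> carrier A}"

definition tensor_ideal ::
    "('r, 'b) ring_scheme \<Rightarrow> ('a, 'c) ring_scheme \<Rightarrow> ('r \<times> 'a \<Rightarrow> int) set" where
  "tensor_ideal R A = genideal (pair_ring R A) (tensor_rels R A)"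

definition tensor_ring ::
    "('r, 'b) ring_scheme \<Rightarrow> ('a, 'c) ring_scheme \<Rightarrow> ('r \<times> 'a \<Rightarrow> int) set ring" where
  "tensor_ring R A = pair_ring R A Quot tensor_ideal R A"

definition pure_tensor ::
    "('r, 'b) ring_scheme \<Rightarrow> ('a, 'c) ring_scheme \<Rightarrow> 'r \<Rightarrow> 'a \<Rightarrow> ('r \<times> 'a \<Rightarrow> int) set" where
  "pure_tensor R A r a = tensor_ideal R A +>\<^bsub>pair_ring R A\<^esub> mr_single \<Z> (r, a) 1"

text \<open>The piece of degree \<open>n\<close> is the image of the tensor product of \<open>Rg n\<close> with \<open>A\<close>; the map is
  injective because \<open>Rg n\<close> is a direct summand of \<open>R\<close>.\<close>

definition tensor_piece ::
    "('r, 'b) ring_scheme \<Rightarrow> (nat \<Rightarrow> 'r set) \<Rightarrow> ('a, 'c) ring_scheme \<Rightarrow> nat \<Rightarrow>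
     ('r \<times> 'a \<Rightarrow> int) set set" where
  "tensor_piece R Rg A n =
    generate (add_monoid (tensor_ring R A))
      {pure_tensor R A r a | r a. r \<in> Rg n \<and> a \<in> carrier A}"


section \<open>The coefficient rings\<close>

text \<open>The \<open>p\<close>-adic integers as the inverse limit of the rings of integers modulo \<open>p ^ n\<close>, with
  residues represented in the interval from \<open>0\<close> to \<open>p ^ n - 1\<close>. At \<open>n = 0\<close> the only residue
  is \<open>0\<close>, hence the reduction in the definition of the unit.\<close>

definition padic_int_ring :: "nat \<Rightarrow> (nat \<Rightarrow> int) ring" where
  "padic_int_ring p =
    \<lparr>carrier = {f. \<forall>n. f n \<in> {0..<int p ^ n} \<and> f (Suc n) mod int p ^ n = f n},
     monoid.mult = (\<lambda>f g n. (f n * g n) mod int p ^ n),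
     one = (\<lambda>n. 1 mod int p ^ n),
     ring.zero = (\<lambda>n. 0),
     add = (\<lambda>f g n. (f n + g n) mod int p ^ n)\<rparr>"

abbreviation rat_ring :: "rat ring" where
  "rat_ring \<equiv> ring_of_type_algebra"

end

theory Submission
  imports Defs
begin

text \<open>
  Let \<open>D\<^sub>n\<close> be the group of decomposable elements of \<open>Rg n\<close>, spanned by products of homogeneous
  elements of smaller positive degree (and by the unit if \<open>n = 0\<close>), and let \<open>N\<^sub>n = card (Y0 n)\<close>.
  Polynomial generators of \<open>R\<close> have to be sought among elements that generate \<open>Rg n\<close> modulo
  \<open>D\<^sub>n\<close>, and the point is that \<open>N\<^sub>n\<close> elements suffice.

  The ring \<open>R / p\<close> is a quotient of the tensor product with the \<open>p\<close>-adic integers, so the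
  generators \<open>Yp p\<close> have images in \<open>R / p\<close> that come from homogeneous elements of \<open>R\<close>, and the
  monomials in these elements span \<open>Rg n\<close> modulo \<open>p\<close> (\<open>monomials_span_mod_prime\<close>). A monomial that
  is not a single generator is decomposable. Hence \<open>Rg n / D\<^sub>n\<close> has at most \<open>p\<close> to the power \<open>N\<^sub>n\<close>
  classes modulo \<open>p\<close>, for every prime \<open>p\<close>. As \<open>Rg n\<close> is free and finite modulo \<open>2\<close>, it is finitely
  generated; and a finitely generated abelian group with so few classes modulo each prime has \<open>N\<^sub>n\<close>
  generators (\<open>generators_from_prime_counts\<close>). Lifting them gives sets \<open>Y n\<close> with at most \<open>N\<^sub>n\<close>
  elements whose monomials span \<open>R\<close>, by induction on the degree (\<open>monomials_span\<close>).

  It remains to compare ranks. After clearing denominators in \<open>Y0\<close>, the injectivity of the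
  rational polynomial presentation yields, in each degree, as many independent elements of \<open>R\<close> as
  there are monomials in \<open>Y0\<close> (\<open>monomials_independent_rational\<close>). The monomials in \<open>Y\<close> span and
  are not more numerous, so they are equally many and independent (\<open>zindep_of_span\<close>). Equality of
  the numbers of monomials forces \<open>card (Y n) = N\<^sub>n\<close> (\<open>card_degree_monomials_mono\<close>).
\<close>

section \<open>Integral combinations in abelian groups\<close>

abbreviation (input) int_mult :: "('a, 'b) ring_scheme \<Rightarrow> int \<Rightarrow> 'a \<Rightarrow> 'a" (infixr "\<star>\<index>" 80)
  where "int_mult G k x \<equiv> add_pow G k x"

definition zcoeffs :: "'i set \<Rightarrow> ('i \<Rightarrow> int) set" where
  "zcoeffs I = {c. finite {i. c i \<noteq> 0} \<and> {i. c i \<noteq> 0} \<subseteq> I}"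

text \<open>The sum runs over the support of \<open>c\<close> only, so that infinite index sets, such as the set of all
  monomials, are admitted.\<close>

definition zlin :: "('a, 'b) ring_scheme \<Rightarrow> ('i \<Rightarrow> 'a) \<Rightarrow> ('i \<Rightarrow> int) \<Rightarrow> 'a" where
  "zlin G w c = (\<Oplus>\<^bsub>G\<^esub>i\<in>{i. c i \<noteq> 0}. c i \<star>\<^bsub>G\<^esub> w i)"

lemma zcoeffs_add:
  assumes "c \<in> zcoeffs I" "d \<in> zcoeffs I"
  shows "(\<lambda>i. c i + d i) \<in> zcoeffs I"
proof -
  have "finite {i. c i + d i \<noteq> 0}"
    by (rule finite_subset[of _ "{i. c i \<noteq> 0} \<union> {i. d i \<noteq> 0}"])
      (use assms in \<open>auto simp: zcoeffs_def\<close>)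
  then show ?thesis
    using assms by (auto simp: zcoeffs_def subset_iff) (metis add_0)
qed

lemma zcoeffs_scale:
  assumes "c \<in> zcoeffs I"
  shows "(\<lambda>i. k i * c i) \<in> zcoeffs I"
proof -
  have "finite {i. k i * c i \<noteq> 0}"
    by (rule finite_subset[of _ "{i. c i \<noteq> 0}"]) (use assms in \<open>auto simp: zcoeffs_def\<close>)
  then show ?thesis
    using assms by (auto simp: zcoeffs_def)
qed

lemma zcoeffs_zero: "(\<lambda>i. 0) \<in> zcoeffs I"
  by (simp add: zcoeffs_def)

lemma zcoeffs_sum:
  assumes "\<And>i. i \<in> A \<Longrightarrow> a i \<in> zcoeffs J"
  shows "(\<lambda>j. \<Sum>i\<in>A. k i * a i j) \<in> zcoeffs J"
  using assms
proof (induction A rule: infinite_finite_induct)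
  case (insert x F)
  have "(\<lambda>j. \<Sum>i\<in>F. k i * a i j) \<in> zcoeffs J"
    by (rule insert.IH) (simp add: insert.prems)
  then have "(\<lambda>j. k x * a x j + (\<Sum>i\<in>F. k i * a i j)) \<in> zcoeffs J"
    by (intro zcoeffs_add[OF zcoeffs_scale]) (simp_all add: insert.prems)
  then show ?case
    using insert.hyps by simp
qed (auto simp: zcoeffs_zero)

lemma zcoeffs_single: "i \<in> I \<Longrightarrow> mr_single \<Z> i k \<in> zcoeffs I"
  by (auto simp: zcoeffs_def mr_single_def)

context abelian_group
begin

lemma int_mult_0 [simp]: "0 \<star> x = \<zero>"
  by (simp add: add_pow_def)

lemma zlin_superset:
  assumes "finite A" "{i. c i \<noteq> 0} \<subseteq> A" "w \<in> A \<rightarrow> carrier G"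
  shows "zlin G w c = (\<Oplus>i\<in>A. c i \<star> w i)"
  unfolding zlin_def
  by (rule add.finprod_mono_neutral_cong_left)
    (use assms in \<open>auto simp: Pi_iff\<close>)

lemma zlin_closed: "c \<in> zcoeffs I \<Longrightarrow> w \<in> I \<rightarrow> carrier G \<Longrightarrow> zlin G w c \<in> carrier G"
  unfolding zlin_def zcoeffs_def by (auto intro!: finsum_closed)

lemma zlin_zero: "zlin G w (\<lambda>i. 0) = \<zero>"
  by (simp add: zlin_def)

lemma zlin_add:
  assumes "c \<in> zcoeffs I" "d \<in> zcoeffs I" "w \<in> I \<rightarrow> carrier G"
  shows "zlin G w (\<lambda>i. c i + d i) = zlin G w c \<oplus> zlin G w d"
proof -
  let ?A = "{i. c i \<noteq> 0} \<union> {i. d i \<noteq> 0}"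
  have A: "finite ?A" "w \<in> ?A \<rightarrow> carrier G"
    using assms by (auto simp: zcoeffs_def)
  have "zlin G w (\<lambda>i. c i + d i) = (\<Oplus>i\<in>?A. (c i + d i) \<star> w i)"
    using A by (intro zlin_superset) auto
  also have "\<dots> = (\<Oplus>i\<in>?A. c i \<star> w i \<oplus> d i \<star> w i)"
    using A(2) by (intro finsum_cong') (auto simp: add.int_pow_mult Pi_iff)
  also have "\<dots> = (\<Oplus>i\<in>?A. c i \<star> w i) \<oplus> (\<Oplus>i\<in>?A. d i \<star> w i)"
    using A(2) by (intro finsum_addf) (auto simp: Pi_iff)
  also have "\<dots> = zlin G w c \<oplus> zlin G w d"
    using A by (simp add: zlin_superset[of ?A c] zlin_superset[of ?A d])
  finally show ?thesis .
qed

lemma zlin_single: "w i \<in> carrier G \<Longrightarrow> zlin G w (mr_single \<Z> i k) = k \<star> w i"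
  by (subst zlin_superset[of "{i}"]) (auto simp: mr_single_def)

lemma zlin_scale:
  assumes "c \<in> zcoeffs I" "w \<in> I \<rightarrow> carrier G"
  shows "zlin G w (\<lambda>i. k * c i) = k \<star> zlin G w c"
proof -
  let ?A = "{i. c i \<noteq> 0}"
  have A: "finite ?A" "w \<in> ?A \<rightarrow> carrier G"
    using assms by (auto simp: zcoeffs_def)
  have distr: "k \<star> (\<Oplus>i\<in>B. c i \<star> w i) = (\<Oplus>i\<in>B. (k * c i) \<star> w i)"
    if "finite B" "w \<in> B \<rightarrow> carrier G" for B
    using that
  proof (induction B rule: finite_induct)
    case (insert x F)
    then show ?case
      by (simp add: Pi_iff add.int_pow_distrib add.int_pow_pow mult.commute)
  qed simp
  have "zlin G w (\<lambda>i. k * c i) = (\<Oplus>i\<in>?A. (k * c i) \<star> w i)"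
    using A by (intro zlin_superset) auto
  also have "\<dots> = k \<star> zlin G w c"
    using distr[OF A] by (simp add: zlin_def)
  finally show ?thesis .
qed

lemma zlin_sum:
  assumes "finite A" "\<And>i. i \<in> A \<Longrightarrow> a i \<in> zcoeffs J" "w \<in> J \<rightarrow> carrier G"
  shows "zlin G w (\<lambda>j. \<Sum>i\<in>A. k i * a i j) = (\<Oplus>i\<in>A. k i \<star> zlin G w (a i))"
  using assms(1,2)
proof (induction A rule: finite_induct)
  case empty
  then show ?case by (simp add: zlin_zero)
next
  case (insert x F)
  have "zlin G w (\<lambda>j. \<Sum>i\<in>insert x F. k i * a i j)
      = zlin G w (\<lambda>j. k x * a x j + (\<Sum>i\<in>F. k i * a i j))"
    using insert by simp
  also have "\<dots> = zlin G w (\<lambda>j. k x * a x j) \<oplus> zlin G w (\<lambda>j. \<Sum>i\<in>F. k i * a i j)"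
    by (intro zlin_add[where I = J] zcoeffs_scale zcoeffs_sum assms(3)) (use insert in auto)
  also have "\<dots> = k x \<star> zlin G w (a x) \<oplus> (\<Oplus>i\<in>F. k i \<star> zlin G w (a i))"
    using insert by (simp add: zlin_scale[OF _ assms(3)])
  also have "\<dots> = (\<Oplus>i\<in>insert x F. k i \<star> zlin G w (a i))"
    using insert.hyps insert.prems zlin_closed[OF _ assms(3)]
    by (subst finsum_insert) (auto simp: Pi_iff)
  finally show ?case .
qed

lemma additive_subgroup_criterion:
  assumes "H \<subseteq> carrier G" "\<zero> \<in> H" "\<And>x y. x \<in> H \<Longrightarrow> y \<in> H \<Longrightarrow> x \<oplus> y \<in> H"
    and neg: "\<And>x. x \<in> H \<Longrightarrow> (-1) \<star> x \<in> H"
  shows "additive_subgroup H G"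
proof (rule additive_subgroupI, unfold_locales)
  fix x assume "x \<in> H"
  then show "inv\<^bsub>add_monoid G\<^esub> x \<in> H"
    using neg[of x] assms(1) add.int_pow_neg[of x 1] by (auto simp: a_inv_def)
qed (use assms in auto)

lemma zlin_subgroup:
  assumes "w \<in> I \<rightarrow> carrier G"
  shows "additive_subgroup (zlin G w ` zcoeffs I) G"
proof (rule additive_subgroup_criterion)
  show "zlin G w ` zcoeffs I \<subseteq> carrier G"
    using zlin_closed[OF _ assms] by auto
  show "\<zero> \<in> zlin G w ` zcoeffs I"
    by (rule image_eqI[OF _ zcoeffs_zero]) (simp add: zlin_zero)
next
  fix x y assume "x \<in> zlin G w ` zcoeffs I" "y \<in> zlin G w ` zcoeffs I"
  then obtain c d where c: "c \<in> zcoeffs I" "x = zlin G w c" and d: "d \<in> zcoeffs I" "y = zlin G w d"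
    by blast
  show "x \<oplus> y \<in> zlin G w ` zcoeffs I"
    by (rule image_eqI[OF _ zcoeffs_add[OF c(1) d(1)]]) (simp add: zlin_add[OF c(1) d(1) assms] c d)
next
  fix x assume "x \<in> zlin G w ` zcoeffs I"
  then obtain c where c: "c \<in> zcoeffs I" "x = zlin G w c" by blast
  show "(-1) \<star> x \<in> zlin G w ` zcoeffs I"
    by (rule image_eqI[OF _ zcoeffs_scale[OF c(1), of "\<lambda>_. -1"]])
      (simp only: c(2) zlin_scale[OF c(1) assms])
qed

end

lemma (in abelian_group) additive_subgroup_int_mult:
  assumes "additive_subgroup H G" "x \<in> H"
  shows "k \<star> x \<in> H"
  using add.subgroup_int_pow_closed[OF additive_subgroup.a_subgroup[OF assms(1)] assms(2)]
  by (simp add: add_pow_def)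

lemma (in abelian_group) zlin_in_subgroup:
  assumes "additive_subgroup H G" "c \<in> zcoeffs I" "w \<in> I \<rightarrow> H"
  shows "zlin G w c \<in> H"
proof -
  have "(\<Oplus>i\<in>B. c i \<star> w i) \<in> H" if "finite B" "w \<in> B \<rightarrow> H" for B
    using that
  proof (induction B rule: finite_induct)
    case (insert x F)
    have H: "H \<subseteq> carrier G"
      using assms(1) by (simp add: additive_subgroup.a_subset)
    have "(\<Oplus>i\<in>insert x F. c i \<star> w i) = c x \<star> w x \<oplus> (\<Oplus>i\<in>F. c i \<star> w i)"
      using insert H by (subst finsum_insert) (auto simp: Pi_iff subset_iff)
    then show ?case
      using insert assms(1) additive_subgroup_int_mult[OF assms(1)]
      by (simp add: additive_subgroup.a_closed Pi_iff)
  qed (simp add: assms(1) additive_subgroup.zero_closed)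
  then show ?thesis
    using assms(2,3) unfolding zlin_def zcoeffs_def by auto
qed

section \<open>Rank over the integers\<close>

text \<open>Fraction-free Gaussian elimination: a homogeneous integral system with more unknowns than
  equations has a nontrivial solution. One equation is used to eliminate one unknown, after
  multiplying the other columns by the pivot.\<close>

lemma homogeneous_system_nontrivial:
  fixes a :: "'i \<Rightarrow> 'j \<Rightarrow> int"
  assumes "finite J" "finite I" "card J < card I"
  shows "\<exists>c. (\<exists>i\<in>I. c i \<noteq> 0) \<and> (\<forall>j\<in>J. (\<Sum>i\<in>I. c i * a i j) = 0)"
  using assms
proof (induction J arbitrary: I a rule: finite_induct)
  case empty
  then obtain i where "i \<in> I" by fastforce
  then show ?case by (intro exI[of _ "\<lambda>_. 1"]) auto
next
  case (insert j J)
  show ?case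
  proof (cases "\<exists>i0\<in>I. a i0 j \<noteq> 0")
    case False
    have "card J < card I" using insert by simp
    from insert.IH[OF insert.prems(1) this, of a] False show ?thesis
      by auto
  next
    case True
    then obtain i0 where i0: "i0 \<in> I" "a i0 j \<noteq> 0" by blast
    let ?I = "I - {i0}"
    have "card J < card ?I" using insert i0 by simp
    from insert.IH[OF _ this, of "\<lambda>i k. a i0 j * a i k - a i j * a i0 k"] insert.prems(1)
    obtain c where c: "\<exists>i\<in>?I. c i \<noteq> 0"
      "\<forall>k\<in>J. (\<Sum>i\<in>?I. c i * (a i0 j * a i k - a i j * a i0 k)) = 0"
      by auto
    \<comment> \<open>A solution of the reduced system is scaled by the pivot; the coefficient of the pivot
      column is then the one that equation \<open>j\<close> forces.\<close>
    define d where "d i = (if i = i0 then - (\<Sum>i\<in>?I. c i * a i j) else c i * a i0 j)" for i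
    have sum_d: "(\<Sum>i\<in>I. d i * a i k) =
        a i0 j * (\<Sum>i\<in>?I. c i * a i k) - (\<Sum>i\<in>?I. c i * a i j) * a i0 k" for k
    proof -
      have "(\<Sum>i\<in>I. d i * a i k) = d i0 * a i0 k + (\<Sum>i\<in>?I. d i * a i k)"
        using i0 insert.prems(1) by (simp add: sum.remove)
      also have "(\<Sum>i\<in>?I. d i * a i k) = (\<Sum>i\<in>?I. a i0 j * (c i * a i k))"
        by (intro sum.cong) (auto simp: d_def)
      finally show ?thesis
        by (simp add: d_def sum_distrib_left)
    qed
    have "(\<Sum>i\<in>I. d i * a i k) = 0" if "k \<in> insert j J" for k
    proof (cases "k = j")
      case True
      then show ?thesis by (simp add: sum_d)
    next
      case False
      then have "(\<Sum>i\<in>?I. c i * (a i0 j * a i k - a i j * a i0 k)) = 0"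
        using c(2) that by blast
      then show ?thesis
        by (simp add: sum_d sum_distrib_left sum_distrib_right algebra_simps sum_subtractf)
    qed
    moreover have "\<exists>i\<in>I. d i \<noteq> 0"
      using c(1) i0 by (auto simp: d_def)
    ultimately show ?thesis by blast
  qed
qed

definition zindep :: "('a, 'b) ring_scheme \<Rightarrow> ('i \<Rightarrow> 'a) \<Rightarrow> 'i set \<Rightarrow> bool" where
  "zindep G w I \<longleftrightarrow> (\<forall>c\<in>zcoeffs I. zlin G w c = \<zero>\<^bsub>G\<^esub> \<longrightarrow> (\<forall>i\<in>I. c i = 0))"

context abelian_group
begin

lemma zlin_compose:
  assumes "finite I" "c \<in> zcoeffs I" "w \<in> J \<rightarrow> carrier G"
    and a: "\<And>i. i \<in> I \<Longrightarrow> a i \<in> zcoeffs J" "\<And>i. i \<in> I \<Longrightarrow> v i = zlin G w (a i)"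
  shows "zlin G v c = zlin G w (\<lambda>j. \<Sum>i\<in>I. c i * a i j)"
proof -
  have v: "v \<in> I \<rightarrow> carrier G"
    using a zlin_closed[OF _ assms(3)] by auto
  have "zlin G v c = (\<Oplus>i\<in>I. c i \<star> v i)"
    using assms(1,2) v by (intro zlin_superset) (auto simp: zcoeffs_def)
  also have "\<dots> = (\<Oplus>i\<in>I. c i \<star> zlin G w (a i))"
    using a zlin_closed[OF _ assms(3)] by (intro finsum_cong') auto
  also have "\<dots> = zlin G w (\<lambda>j. \<Sum>i\<in>I. c i * a i j)"
    using assms a by (intro zlin_sum[symmetric]) auto
  finally show ?thesis .
qed

lemma zindep_card_le:
  assumes "finite I" "finite J" "w \<in> J \<rightarrow> carrier G"
    and span: "v ` I \<subseteq> zlin G w ` zcoeffs J" and indep: "zindep G v I"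
  shows "card I \<le> card J"
proof (rule ccontr)
  assume "\<not> card I \<le> card J"
  from span have "\<forall>i\<in>I. \<exists>c. c \<in> zcoeffs J \<and> v i = zlin G w c" by blast
  then obtain a where a: "\<And>i. i \<in> I \<Longrightarrow> a i \<in> zcoeffs J" "\<And>i. i \<in> I \<Longrightarrow> v i = zlin G w (a i)"
    by metis
  obtain c where c: "\<exists>i\<in>I. c i \<noteq> 0" "\<forall>j\<in>J. (\<Sum>i\<in>I. c i * a i j) = 0"
    using homogeneous_system_nontrivial[of J I a] assms(1,2) \<open>\<not> card I \<le> card J\<close> by auto
  define d where "d i = (if i \<in> I then c i else 0)" for i
  have d: "d \<in> zcoeffs I"
    using assms(1) by (auto simp: zcoeffs_def d_def)
  have "(\<Sum>i\<in>I. d i * a i j) = 0" for j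
  proof (cases "j \<in> J")
    case True
    then show ?thesis using c(2) by (simp add: d_def cong: sum.cong)
  next
    case False
    then have "a i j = 0" if "i \<in> I" for i using a(1)[OF that] by (auto simp: zcoeffs_def)
    then show ?thesis by simp
  qed
  then have "zlin G v d = \<zero>"
    using zlin_compose[OF assms(1) d assms(3) a] zlin_zero by simp
  then show False
    using indep d c(1) by (auto simp: zindep_def d_def)
qed

text \<open>A spanning family no larger than an independent one is itself independent: a relation among
  the spanning vectors, added to the independent vectors as one more (zero) vector, would make the
  coefficient system underdetermined.\<close>

lemma zindep_of_span:
  assumes "finite I" "finite J" "w \<in> J \<rightarrow> carrier G"
    and span: "v ` I \<subseteq> zlin G w ` zcoeffs J" and indep: "zindep G v I"
    and card: "card J \<le> card I"
  shows "zindep G w J"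
  unfolding zindep_def
proof (intro ballI impI, rule ccontr)
  fix k j0 assume k: "k \<in> zcoeffs J" "zlin G w k = \<zero>" and j0: "j0 \<in> J" "k j0 \<noteq> 0"
  from span have "\<forall>i\<in>I. \<exists>c. c \<in> zcoeffs J \<and> v i = zlin G w c" by blast
  then obtain a where a: "\<And>i. i \<in> I \<Longrightarrow> a i \<in> zcoeffs J" "\<And>i. i \<in> I \<Longrightarrow> v i = zlin G w (a i)"
    by metis
  have v: "v \<in> I \<rightarrow> carrier G"
    using a zlin_closed[OF _ assms(3)] by auto
  \<comment> \<open>The index \<open>None\<close> carries the zero vector, written by means of the relation \<open>k\<close>.\<close>
  define I' where "I' = insert None (Some ` I)"
  define a' where "a' i = (case i of None \<Rightarrow> k | Some x \<Rightarrow> a x)" for i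
  have I': "finite I'" "card I' = Suc (card I)"
    using assms(1) by (auto simp: I'_def card_image)
  obtain c where c: "\<exists>i\<in>I'. c i \<noteq> 0" "\<forall>j\<in>J. (\<Sum>i\<in>I'. c i * a' i j) = 0"
    using homogeneous_system_nontrivial[of J I' a'] assms(2) I' card by auto
  define d where "d i = (if i \<in> I then c (Some i) else 0)" for i
  have d: "d \<in> zcoeffs I"
    using assms(1) by (auto simp: zcoeffs_def d_def)
  have outside: "a' i j = 0" if "i \<in> I'" "j \<notin> J" for i j
    using that k(1) a(1)[unfolded zcoeffs_def] by (auto simp: I'_def a'_def zcoeffs_def subset_iff)
  have eq: "(\<Sum>i\<in>I'. c i * a' i j) = c None * k j + (\<Sum>i\<in>I. d i * a i j)" for j
    unfolding I'_def using assms(1)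
    by (subst sum.insert) (auto simp: sum.reindex a'_def d_def intro!: sum.cong)
  have zero: "c None * k j + (\<Sum>i\<in>I. d i * a i j) = 0" for j
    using c(2) outside by (cases "j \<in> J") (auto simp: eq[symmetric] intro!: sum.neutral)
  have "\<zero> = zlin G w (\<lambda>j. c None * k j + (\<Sum>i\<in>I. d i * a i j))"
    by (simp add: zero zlin_zero)
  also have "\<dots> = zlin G w (\<lambda>j. c None * k j) \<oplus> zlin G w (\<lambda>j. \<Sum>i\<in>I. d i * a i j)"
    by (intro zlin_add[where I = J] zcoeffs_scale zcoeffs_sum k a assms(3))
  also have "\<dots> = zlin G v d"
    using zlin_compose[OF assms(1) d assms(3) a] zlin_scale[OF k(1) assms(3)] k(2)
      zlin_closed[OF d v] by simp
  finally have "\<forall>i\<in>I. d i = 0"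
    using indep d by (auto simp: zindep_def)
  with zero[of j0] j0 have "c None = 0"
    by simp
  with \<open>\<forall>i\<in>I. d i = 0\<close> c(1) show False
    by (auto simp: I'_def d_def)
qed

end

section \<open>Generators from counts modulo primes\<close>

text \<open>The number of generators of a finitely generated abelian group \<open>V / D\<close> is detected modulo
  some prime. Among all relations between the members of a generating set of minimal size take a
  positive coefficient \<open>a\<close> that is minimal. Division with remainder, carried out by changing one
  generator, shows that \<open>a\<close> divides every coefficient of that relation, and after one more change
  of generators the relation reads \<open>a x \<in> D\<close>. Then \<open>a\<close> divides every coefficient of every
  relation. Minimality of the generating set excludes \<open>a = 1\<close>, so some prime \<open>p\<close> divides all
  relations, the generators are independent modulo \<open>p\<close>, and there are at least \<open>p\<close> to the number
  of generators classes modulo \<open>p\<close>.\<close>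

lemma generators_from_prime_counts:
  fixes s :: "int \<Rightarrow> 'b::ab_group_add \<Rightarrow> 'b"
  assumes "Modules.module s" and D: "Modules.module.subspace s D" and "finite B0"
    and primes: "\<And>p::nat. Factorial_Ring.prime p \<Longrightarrow> \<exists>T. finite T \<and> card T \<le> p ^ N \<and>
      (\<forall>x\<in>Modules.module.span s (B0 \<union> D). \<exists>t\<in>T. \<exists>d\<in>D. \<exists>z\<in>Modules.module.span s (B0 \<union> D). x = t + d + s (int p) z)"
  shows "\<exists>B. finite B \<and> card B \<le> N \<and> Modules.module.span s (B \<union> D) = Modules.module.span s (B0 \<union> D)"
proof -
  interpret Modules.module s by fact
  define V where "V = span (B0 \<union> D)"
  define k where "k = (LEAST k. \<exists>B. finite B \<and> card B = k \<and> span (B \<union> D) = V)"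
  define gen where "gen B \<longleftrightarrow> finite B \<and> card B = k \<and> span (B \<union> D) = V" for B
  define rel where "rel B c \<longleftrightarrow> (\<Sum>x\<in>B. s (c x) x) \<in> D" for B and c :: "'b \<Rightarrow> int"
  have gen_ex: "\<exists>B. gen B"
    unfolding gen_def k_def by (rule LeastI_ex) (use \<open>finite B0\<close> V_def in blast)
  have k_le: "k \<le> card B" if "finite B" "span (B \<union> D) = V" for B
    unfolding k_def by (rule Least_le) (use that in blast)
  have span_V: "(\<Sum>x\<in>B. s (e x) x) \<in> V" if "gen B" for B e
  proof -
    have "V = span (B \<union> D)" using that by (simp add: gen_def)
    then show ?thesis by (auto intro!: span_sum span_scale intro: span_base)
  qed
  have V_repr: "\<exists>e. \<exists>d\<in>D. z = (\<Sum>x\<in>B. s (e x) x) + d" if "gen B" "z \<in> V" for B z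
  proof -
    have "z \<in> span (B \<union> D)"
      using that by (simp add: gen_def)
    then obtain u d where ud: "z = u + d" "u \<in> span B" "d \<in> span D"
      unfolding span_Un by blast
    have "span D = D" "span B = range (\<lambda>u. \<Sum>v\<in>B. s (u v) v)"
      using that(1) D span_finite[of B] by (auto simp: gen_def)
    with ud obtain e where "u = (\<Sum>v\<in>B. s (e v) v)" "d \<in> D" by auto
    with ud(1) show ?thesis by blast
  qed
  \<comment> \<open>By minimality of \<open>k\<close>, the changed generator is never one of the others.\<close>
  have move: "gen (insert (x + w) (B - {x})) \<and> x + w \<notin> B - {x}"
    if B: "gen B" "x \<in> B" and w: "w \<in> span ((B - {x}) \<union> D)" for B x w
  proof -
    let ?Z = "B - {x}"
    let ?B' = "insert (x + w) ?Z"
    have w': "w \<in> span (B \<union> D)" "w \<in> span (?B' \<union> D)"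
      using w span_mono[of "?Z \<union> D" "B \<union> D"] span_mono[of "?Z \<union> D" "?B' \<union> D"] by blast+
    have "x = (x + w) - w" by simp
    also have "\<dots> \<in> span (?B' \<union> D)"
      by (intro span_diff w'(2) span_base) simp
    finally have "B \<union> D \<subseteq> span (?B' \<union> D)"
      by (auto intro: span_base)
    moreover have "x + w \<in> span (B \<union> D)"
      by (intro span_add w'(1) span_base) (simp add: B(2))
    then have "?B' \<union> D \<subseteq> span (B \<union> D)"
      by (auto intro: span_base)
    ultimately have sp: "span (?B' \<union> D) = V"
      using B(1) by (metis gen_def span_eq)
    have fin: "finite B" "card B = k" using B(1) by (auto simp: gen_def)
    have k_le': "k \<le> card ?B'"
      by (rule k_le[OF _ sp]) (simp add: fin(1))
    have "x + w \<notin> ?Z"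
    proof
      assume "x + w \<in> ?Z"
      then have "?B' = ?Z" by (rule insert_absorb)
      with k_le' have "k \<le> card ?Z" by (simp only:)
      moreover have "card ?Z < k"
        using card_Diff1_less[OF fin(1) B(2)] by (simp only: fin(2))
      ultimately show False by (meson leD)
    qed
    moreover from this have "card ?B' = Suc (card ?Z)"
      by (intro card_insert_disjoint) (simp_all add: fin(1))
    ultimately show ?thesis
      using sp fin card_Suc_Diff1[OF fin(1) B(2)] unfolding gen_def
      by (metis finite_Diff finite_insert)
  qed
  define S where "S = {n::nat. n > 0 \<and> (\<exists>B x c. gen B \<and> x \<in> B \<and> rel B c \<and> c x = int n)}"
  have "\<exists>B p. gen B \<and> Factorial_Ring.prime (p::nat) \<and> (\<forall>c. rel B c \<longrightarrow> (\<forall>y\<in>B. int p dvd c y))"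
  proof (cases "S = {}")
    case True
    \<comment> \<open>There are no nontrivial relations at all, so any prime will do.\<close>
    obtain B where B: "gen B" using gen_ex by blast
    have "c y = 0" if "rel B c" "y \<in> B" for c y
    proof (rule ccontr)
      assume "c y \<noteq> 0"
      have "rel B (\<lambda>x. - c x)"
        using that(1) subspace_neg[OF D] by (simp add: rel_def sum_negf)
      moreover have "nat \<bar>c y\<bar> > 0" "c y = int (nat \<bar>c y\<bar>) \<or> - c y = int (nat \<bar>c y\<bar>)"
        using \<open>c y \<noteq> 0\<close> by auto
      ultimately have "nat \<bar>c y\<bar> \<in> S"
        unfolding S_def using B that by blast
      then show False using True by simp
    qed
    then show ?thesis
      using B two_is_prime_nat by (metis dvd_0_right)
  next
    case False
    define a where "a = (LEAST n. n \<in> S)"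
    have "a \<in> S"
      unfolding a_def using False by (meson LeastI ex_in_conv)
    have a_min: "n \<notin> S" if "n < a" for n
      using that not_less_Least unfolding a_def by blast
    have a_pos: "a > 0" using \<open>a \<in> S\<close> by (simp add: S_def)
    have small: "r = 0" if "gen B" "x \<in> B" "rel B c" "c x = r" "0 \<le> r" "r < int a" for B x c r
    proof (rule ccontr)
      assume "r \<noteq> 0"
      then have "nat r \<in> S"
        unfolding S_def using that by (intro CollectI conjI exI[of _ B] exI[of _ x] exI[of _ c]) auto
      then show False
        using a_min[of "nat r"] that by simp
    qed
    \<comment> \<open>Replacing \<open>x\<close> by \<open>x + q y\<close> turns the coefficient of \<open>y\<close> into its remainder modulo \<open>a\<close>,
      which vanishes by minimality of \<open>a\<close>.\<close>
    have dvd: "int a dvd c y" if B: "gen B" "x \<in> B" "y \<in> B" "rel B c" "c x = int a" for B x y c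
    proof (cases "y = x")
      case False
      define q r where "q = c y div int a" and "r = c y mod int a"
      have qr: "c y = int a * q + r" by (simp add: q_def r_def)
      define x' where "x' = x + s q y"
      define B' where "B' = insert x' (B - {x})"
      have y: "y \<in> B - {x}" using False B by simp
      have mv: "gen B'" "x' \<notin> B - {x}"
        using move[OF B(1,2), of "s q y"] y by (auto simp: B'_def x'_def intro: span_scale span_base)
      define c' where "c' = c(x' := int a, y := r)"
      have fin: "finite B" using B by (simp add: gen_def)
      let ?W = "B - {x} - {y}"
      have x'y: "x' \<noteq> y" "x' \<notin> ?W" using mv(2) y by auto
      have "(\<Sum>z\<in>B'. s (c' z) z) = s (c' x') x' + (s (c' y) y + (\<Sum>z\<in>?W. s (c' z) z))"
        using fin mv(2) y by (simp add: B'_def sum.remove[of "B - {x}" y])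
      also have "(\<Sum>z\<in>?W. s (c' z) z) = (\<Sum>z\<in>?W. s (c z) z)"
        using x'y by (intro sum.cong) (auto simp: c'_def)
      also have "s (c' x') x' + (s (c' y) y + (\<Sum>z\<in>?W. s (c z) z))
          = s (c x) x + (s (c y) y + (\<Sum>z\<in>?W. s (c z) z))"
        using x'y B(5) by (simp add: c'_def qr x'_def scale_right_distrib scale_left_distrib add_ac)
      also have "\<dots> = (\<Sum>z\<in>B. s (c z) z)"
        using fin B(2) y by (simp add: sum.remove[of B x] sum.remove[of "B - {x}" y])
      finally have "rel B' c'"
        using B(4) by (simp add: rel_def)
      moreover have "y \<in> B'" using y by (simp add: B'_def)
      ultimately have "r = 0"
        using small[OF mv(1), of y c' r] a_pos by (simp add: c'_def r_def)
      then show ?thesis by (simp add: qr)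
    qed (simp add: B)
    obtain B0 x0 c0 where B0: "gen B0" "x0 \<in> B0" "rel B0 c0" "c0 x0 = int a"
      using \<open>a \<in> S\<close> by (auto simp: S_def)
    have fin0: "finite B0" using B0 by (simp add: gen_def)
    \<comment> \<open>As \<open>a\<close> divides the relation \<open>c0\<close>, its sum is \<open>a\<close> times a single new generator \<open>x\<close>.\<close>
    define w where "w = (\<Sum>y\<in>B0 - {x0}. s (c0 y div int a) y)"
    define x where "x = x0 + w"
    define B where "B = insert x (B0 - {x0})"
    have "gen B \<and> x \<notin> B0 - {x0}"
      unfolding B_def x_def by (intro move B0) (auto simp: w_def intro!: span_sum span_scale intro: span_base)
    then have B: "gen B" "x \<in> B" by (auto simp: B_def)
    have finB: "finite B" using B by (simp add: gen_def)
    have "s (int a) x = s (c0 x0) x0 + (\<Sum>y\<in>B0 - {x0}. s (c0 y) y)"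
      using B0 dvd[OF B0(1,2) _ B0(3,4)]
      by (auto simp: x_def w_def scale_right_distrib scale_sum_right intro!: sum.cong)
    also have "\<dots> = (\<Sum>y\<in>B0. s (c0 y) y)"
      using fin0 B0(2) by (simp add: sum.remove[of B0 x0])
    finally have ax: "s (int a) x \<in> D"
      using B0(3) by (simp add: rel_def)
    \<comment> \<open>Because \<open>a x \<in> D\<close>, the coefficient of \<open>x\<close> in any relation may be changed by multiples
      of \<open>a\<close>: first to its remainder, which must be \<open>0\<close>, and then to \<open>a\<close>.\<close>
    have change: "rel B (c(x := c x + int a * j))" if "rel B c" for c j
    proof -
      have "(\<Sum>z\<in>B. s ((c(x := c x + int a * j)) z) z)
          = s (c x + int a * j) x + (\<Sum>z\<in>B - {x}. s ((c(x := c x + int a * j)) z) z)"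
        using finB B(2) by (simp add: sum.remove[of B x])
      also have "(\<Sum>z\<in>B - {x}. s ((c(x := c x + int a * j)) z) z) = (\<Sum>z\<in>B - {x}. s (c z) z)"
        by (intro sum.cong) auto
      also have "s (c x + int a * j) x + (\<Sum>z\<in>B - {x}. s (c z) z)
          = s j (s (int a) x) + (\<Sum>z\<in>B. s (c z) z)"
        using finB B(2) by (simp add: sum.remove[of B x] scale_left_distrib mult.commute add_ac)
      finally have eq: "(\<Sum>z\<in>B. s ((c(x := c x + int a * j)) z) z)
          = s j (s (int a) x) + (\<Sum>z\<in>B. s (c z) z)" .
      show ?thesis
        unfolding rel_def eq
        by (intro subspace_add[OF D] subspace_scale[OF D] ax that[unfolded rel_def])
    qed
    have all: "int a dvd c y" if "rel B c" "y \<in> B" for c y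
    proof -
      have "c x + int a * (- (c x div int a)) = c x mod int a"
        by (simp add: minus_div_mult_eq_mod[symmetric])
      then have "c x mod int a = 0"
        using small[OF B change[OF that(1), of "- (c x div int a)"], of "c x mod int a"] a_pos
        by simp
      then have dx: "int a dvd c x" by auto
      show ?thesis
      proof (cases "y = x")
        case False
        have "c x + int a * (1 - c x div int a) = int a"
          using dx by (simp add: algebra_simps)
        then show ?thesis
          using dvd[OF B that(2) change[OF that(1), of "1 - c x div int a"]] False by simp
      qed (use dx in simp)
    qed
    have "a \<noteq> 1"
    proof
      assume "a = 1"
      then have "x \<in> D" using ax by simp
      have "x \<in> span (B - {x} \<union> D)" using \<open>x \<in> D\<close> by (intro span_base) simp
      then have "B \<union> D \<subseteq> span (B - {x} \<union> D)"
        by (auto intro: span_base)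
      then have "span (B - {x} \<union> D) = span (B \<union> D)"
        by (intro equalityI span_mono span_minimal) auto
      then have "k \<le> card (B - {x})"
        using finB B(1) by (intro k_le) (auto simp: gen_def)
      then show False
        using finB B card_Diff1_less[of B x] by (simp add: gen_def)
    qed
    then obtain p where "Factorial_Ring.prime p" "p dvd a"
      using prime_factor_nat by blast
    then show ?thesis
      using B(1) all by (meson dvd_trans of_nat_dvd_iff)
  qed
  then obtain B p where B: "gen B" "Factorial_Ring.prime (p::nat)"
    and p: "\<And>c y. rel B c \<Longrightarrow> y \<in> B \<Longrightarrow> int p dvd c y"
    by blast
  have finB: "finite B" using B by (simp add: gen_def)
  obtain T where T: "finite T" "card T \<le> p ^ N"
    "\<forall>x\<in>V. \<exists>t\<in>T. \<exists>d\<in>D. \<exists>z\<in>V. x = t + d + s (int p) z"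
    using primes[OF B(2)] unfolding V_def by blast
  then obtain t where t: "\<And>x. x \<in> V \<Longrightarrow> t x \<in> T \<and> (\<exists>d\<in>D. \<exists>z\<in>V. x = t x + d + s (int p) z)"
    by metis
  \<comment> \<open>Combinations with coefficients below \<open>p\<close> fall into different classes modulo \<open>p\<close> and \<open>D\<close>.\<close>
  define \<sigma> where "\<sigma> c = (\<Sum>x\<in>B. s (c x) x)" for c
  let ?F = "PiE B (\<lambda>_. {0..<int p})"
  have "inj_on (\<lambda>c. t (\<sigma> c)) ?F"
  proof (rule inj_onI)
    fix c c' assume c: "c \<in> ?F" "c' \<in> ?F" "t (\<sigma> c) = t (\<sigma> c')"
    have V: "\<sigma> c \<in> V" "\<sigma> c' \<in> V" using span_V[OF B(1)] by (simp_all add: \<sigma>_def)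
    obtain d z d' z' where dz: "d \<in> D" "z \<in> V" "\<sigma> c = t (\<sigma> c) + d + s (int p) z"
      "d' \<in> D" "z' \<in> V" "\<sigma> c' = t (\<sigma> c') + d' + s (int p) z'"
      using t[OF V(1)] t[OF V(2)] by metis
    obtain e b e' b' where eb: "b \<in> D" "z = (\<Sum>x\<in>B. s (e x) x) + b"
      "b' \<in> D" "z' = (\<Sum>x\<in>B. s (e' x) x) + b'"
      using V_repr[OF B(1) dz(2)] V_repr[OF B(1) dz(5)] by metis
    obtain u where u: "t (\<sigma> c) = u" by simp
    have e1: "\<sigma> c = u + d + s (int p) z" and e2: "\<sigma> c' = u + d' + s (int p) z'"
      using dz(3,6) unfolding c(3)[symmetric] u by blast+
    have "(\<Sum>x\<in>B. s (c x - c' x - int p * (e x - e' x)) x)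
        = \<sigma> c - \<sigma> c' - s (int p) ((\<Sum>x\<in>B. s (e x) x) - (\<Sum>x\<in>B. s (e' x) x))"
      by (simp add: \<sigma>_def scale_left_diff_distrib right_diff_distrib scale_right_diff_distrib
          scale_sum_right sum_subtractf)
    also have "\<dots> = (d - d') + s (int p) (b - b')"
      by (simp add: e1 e2 eb(2,4) scale_right_diff_distrib scale_right_distrib algebra_simps)
    also have "\<dots> \<in> D"
      using D dz eb by (intro subspace_add subspace_diff subspace_scale)
    finally have "rel B (\<lambda>x. c x - c' x - int p * (e x - e' x))"
      by (simp add: rel_def)
    then have "int p dvd (c x - c' x - int p * (e x - e' x)) + int p * (e x - e' x)" if "x \<in> B" for x
      using that by (intro dvd_add p dvd_triv_left)
    then have dvd: "int p dvd c x - c' x" if "x \<in> B" for x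
      using that by simp
    show "c = c'"
    proof (rule PiE_ext[OF c(1,2)])
      fix x assume "x \<in> B"
      then show "c x = c' x"
        using dvd[of x] c(1,2) mod_eq_dvd_iff[of "c x" "int p" "c' x"] by (auto simp: PiE_iff)
    qed
  qed
  moreover have "(\<lambda>c. t (\<sigma> c)) ` ?F \<subseteq> T"
    using t span_V[OF B(1)] by (auto simp: \<sigma>_def)
  ultimately have "card ?F \<le> card T"
    using T(1) by (metis card_image card_mono)
  then have "p ^ card B \<le> p ^ N"
    using T(2) finB by (simp add: card_PiE)
  then have "card B \<le> N"
    using prime_gt_1_nat[OF B(2)] by simp
  then show ?thesis
    using B(1) V_def by (auto simp: gen_def)
qed

section \<open>Integral monoid rings\<close>

lemma monoid_ring_simps:
  "f \<in> carrier (monoid_ring k M) \<longleftrightarrow> (\<forall>m\<in>carrier M. f m \<in> carrier k) \<and>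
     (\<forall>m. m \<notin> carrier M \<longrightarrow> f m = \<zero>\<^bsub>k\<^esub>) \<and> finite {m. f m \<noteq> \<zero>\<^bsub>k\<^esub>}"
  "f \<otimes>\<^bsub>monoid_ring k M\<^esub> g = (\<lambda>m. finsum k (\<lambda>(a, b). f a \<otimes>\<^bsub>k\<^esub> g b)
     {(a, b). f a \<noteq> \<zero>\<^bsub>k\<^esub> \<and> g b \<noteq> \<zero>\<^bsub>k\<^esub> \<and> a \<otimes>\<^bsub>M\<^esub> b = m})"
  "\<one>\<^bsub>monoid_ring k M\<^esub> = mr_single k \<one>\<^bsub>M\<^esub> \<one>\<^bsub>k\<^esub>"
  "\<zero>\<^bsub>monoid_ring k M\<^esub> = (\<lambda>m. \<zero>\<^bsub>k\<^esub>)"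
  "f \<oplus>\<^bsub>monoid_ring k M\<^esub> g = (\<lambda>m. f m \<oplus>\<^bsub>k\<^esub> g m)"
  by (auto simp: monoid_ring_def mr_single_def)

lemma carrier_monoid_ring_Z: "carrier (monoid_ring \<Z> M) = zcoeffs (carrier M)"
  by (auto simp: monoid_ring_simps zcoeffs_def)

lemma (in abelian_monoid) mr_single_closed:
  "m \<in> carrier M \<Longrightarrow> c \<in> carrier G \<Longrightarrow> mr_single G m c \<in> carrier (monoid_ring G M)"
  by (auto simp: monoid_ring_simps mr_single_def)

lemma (in abelian_monoid) monoid_ring_add_closed:
  assumes "f \<in> carrier (monoid_ring G M)" "g \<in> carrier (monoid_ring G M)"
  shows "f \<oplus>\<^bsub>monoid_ring G M\<^esub> g \<in> carrier (monoid_ring G M)"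
proof -
  have "finite {m. f m \<oplus> g m \<noteq> \<zero>}"
    by (rule finite_subset[of _ "{m. f m \<noteq> \<zero>} \<union> {m. g m \<noteq> \<zero>}"])
      (use assms in \<open>auto simp: monoid_ring_simps\<close>)
  then show ?thesis
    using assms by (auto simp: monoid_ring_simps)
qed

lemma (in abelian_monoid) monoid_ring_induct [consumes 2, case_names zero add]:
  assumes "f \<in> carrier (monoid_ring G M)" "{m. f m \<noteq> \<zero>} \<subseteq> S"
    and "P (\<lambda>m. \<zero>)"
    and step: "\<And>m c g. \<lbrakk>m \<in> S; m \<in> carrier M; c \<in> carrier G; g \<in> carrier (monoid_ring G M);
      {m. g m \<noteq> \<zero>} \<subseteq> S; P g\<rbrakk> \<Longrightarrow> P (mr_single G m c \<oplus>\<^bsub>monoid_ring G M\<^esub> g)"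
  shows "P f"
proof -
  have "finite {m. f m \<noteq> \<zero>}"
    using assms(1) by (simp add: monoid_ring_simps)
  then show ?thesis
    using assms(1,2)
  proof (induction "{m. f m \<noteq> \<zero>}" arbitrary: f rule: finite_induct)
    case empty
    then have "f = (\<lambda>m. \<zero>)" by auto
    then show ?case using assms(3) by simp
  next
    case (insert m F)
    let ?g = "f(m := \<zero>)"
    have F: "{n. ?g n \<noteq> \<zero>} = F"
      using insert.hyps by auto
    have m: "f m \<noteq> \<zero>" "m \<in> S"
      using insert.hyps insert.prems by auto
    have mM: "m \<in> carrier M" "f m \<in> carrier G"
      using m insert.prems by (auto simp: monoid_ring_simps)
    have g: "?g \<in> carrier (monoid_ring G M)"
      using insert.prems(1) F insert.hyps(1) by (auto simp: monoid_ring_simps)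
    have gS: "{n. ?g n \<noteq> \<zero>} \<subseteq> S"
      using insert.prems by auto
    have fin: "f n \<in> carrier G" for n
      using insert.prems(1) by (cases "n \<in> carrier M") (auto simp: monoid_ring_simps)
    have "P (mr_single G m (f m) \<oplus>\<^bsub>monoid_ring G M\<^esub> ?g)"
      using insert.hyps(3)[OF F[symmetric] g gS] by (intro step m mM g gS)
    also have "mr_single G m (f m) \<oplus>\<^bsub>monoid_ring G M\<^esub> ?g = f"
      using fin by (auto simp: monoid_ring_simps mr_single_def)
    finally show ?case .
  qed
qed

lemma (in cring) mr_single_mult:
  assumes "c \<in> carrier R" "d \<in> carrier R"
  shows "mr_single R a c \<otimes>\<^bsub>monoid_ring R M\<^esub> mr_single R b d
    = mr_single R (a \<otimes>\<^bsub>M\<^esub> b) (c \<otimes> d)"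
proof
  fix m
  let ?S = "{(x, y). mr_single R a c x \<noteq> \<zero> \<and> mr_single R b d y \<noteq> \<zero> \<and> x \<otimes>\<^bsub>M\<^esub> y = m}"
  show "(mr_single R a c \<otimes>\<^bsub>monoid_ring R M\<^esub> mr_single R b d) m
    = mr_single R (a \<otimes>\<^bsub>M\<^esub> b) (c \<otimes> d) m"
  proof (cases "c \<noteq> \<zero> \<and> d \<noteq> \<zero> \<and> a \<otimes>\<^bsub>M\<^esub> b = m")
    case True
    then have "?S = {(a, b)}" by (auto simp: mr_single_def split: if_splits)
    then show ?thesis
      using True assms by (auto simp: monoid_ring_simps mr_single_def)
  next
    case False
    then have "?S = {}" by (auto simp: mr_single_def split: if_splits)
    then show ?thesis
      using False assms by (auto simp: monoid_ring_simps mr_single_def)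
  qed
qed

text \<open>The supports may be enlarged to arbitrary finite sets; this lets functions with different
  supports be added inside the double sum.\<close>

lemma monoid_ring_Z_mult:
  assumes "finite A" "{a. f a \<noteq> 0} \<subseteq> A" "finite B" "{b. g b \<noteq> 0} \<subseteq> B"
  shows "(f \<otimes>\<^bsub>monoid_ring \<Z> M\<^esub> g) m = (\<Sum>a\<in>A. \<Sum>b\<in>B. if a \<otimes>\<^bsub>M\<^esub> b = m then f a * g b else 0)"
proof -
  have "(f \<otimes>\<^bsub>monoid_ring \<Z> M\<^esub> g) m
      = (\<Sum>(a, b)\<in>{(a, b). f a \<noteq> 0 \<and> g b \<noteq> 0 \<and> a \<otimes>\<^bsub>M\<^esub> b = m}. f a * g b)"
    by (simp add: monoid_ring_simps int_finsum_eq)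
  also have "\<dots> = (\<Sum>(a, b)\<in>A \<times> B. if a \<otimes>\<^bsub>M\<^esub> b = m then f a * g b else 0)"
    using assms by (intro sum.mono_neutral_cong_left) auto
  finally show ?thesis
    by (simp add: sum.cartesian_product)
qed

lemma monoid_ring_Z_mult_support:
  assumes "finite {a. f a \<noteq> 0}" "finite {b. g b \<noteq> 0}"
  shows "{m. (f \<otimes>\<^bsub>monoid_ring \<Z> M\<^esub> g) m \<noteq> 0}
    \<subseteq> (\<lambda>(a, b). a \<otimes>\<^bsub>M\<^esub> b) ` ({a. f a \<noteq> 0} \<times> {b. g b \<noteq> 0})"
proof
  let ?A = "{a. f a \<noteq> 0}" and ?B = "{b. g b \<noteq> 0}"
  fix m assume "m \<in> {m. (f \<otimes>\<^bsub>monoid_ring \<Z> M\<^esub> g) m \<noteq> 0}"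
  then have "(\<Sum>a\<in>?A. \<Sum>b\<in>?B. if a \<otimes>\<^bsub>M\<^esub> b = m then f a * g b else 0) \<noteq> 0"
    using monoid_ring_Z_mult[of ?A f ?B g M m] assms by simp
  then obtain a where a: "a \<in> ?A" "(\<Sum>b\<in>?B. if a \<otimes>\<^bsub>M\<^esub> b = m then f a * g b else 0) \<noteq> 0"
    by (rule sum.not_neutral_contains_not_neutral)
  from a(2) obtain b where "b \<in> ?B" "(if a \<otimes>\<^bsub>M\<^esub> b = m then f a * g b else 0) \<noteq> 0"
    by (rule sum.not_neutral_contains_not_neutral)
  with a(1) show "m \<in> (\<lambda>(a, b). a \<otimes>\<^bsub>M\<^esub> b) ` (?A \<times> ?B)"
    by (auto split: if_splits)
qed

text \<open>Multiplication is biadditive, so associativity and the unit law need only be checked on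
  single monomials, where they are those of \<open>M\<close>.\<close>

lemma cring_monoid_ring_Z:
  assumes "Group.comm_monoid M"
  shows "cring (monoid_ring \<Z> M)"
proof -
  interpret M: Group.comm_monoid M by fact
  let ?Q = "monoid_ring \<Z> M"
  let ?C = "carrier ?Q"
  note [simp] = monoid_ring_simps(4,5)
  have fin: "finite {a. f a \<noteq> 0}" if "f \<in> ?C" for f
    using that by (simp add: monoid_ring_simps)
  have add_closed: "(\<lambda>m. f m + g m) \<in> ?C" if "f \<in> ?C" "g \<in> ?C" for f g
    using int.monoid_ring_add_closed[OF that] by simp
  have zero_closed: "(\<lambda>m. 0) \<in> ?C"
    by (simp add: monoid_ring_simps)
  have single_closed: "mr_single \<Z> m c \<in> ?C" if "m \<in> carrier M" for m c
    using that by (intro int.mr_single_closed) auto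
  have single_mult: "mr_single \<Z> a c \<otimes>\<^bsub>?Q\<^esub> mr_single \<Z> b d = mr_single \<Z> (a \<otimes>\<^bsub>M\<^esub> b) (c * d)"
    for a b c d
    by (rule trans[OF cring.mr_single_mult[OF int_is_cring]]) simp_all
  have mult_closed: "f \<otimes>\<^bsub>?Q\<^esub> g \<in> ?C" if f: "f \<in> ?C" and g: "g \<in> ?C" for f g
  proof -
    let ?A = "{a. f a \<noteq> 0}" and ?B = "{b. g b \<noteq> 0}"
    have supp: "{m. (f \<otimes>\<^bsub>?Q\<^esub> g) m \<noteq> 0} \<subseteq> (\<lambda>(a, b). a \<otimes>\<^bsub>M\<^esub> b) ` (?A \<times> ?B)"
      using fin f g by (intro monoid_ring_Z_mult_support)
    have AB: "?A \<subseteq> carrier M" "?B \<subseteq> carrier M"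
      using f g by (auto simp: monoid_ring_simps)
    then have "(\<lambda>(a, b). a \<otimes>\<^bsub>M\<^esub> b) ` (?A \<times> ?B) \<subseteq> carrier M" by auto
    moreover have "finite {m. (f \<otimes>\<^bsub>?Q\<^esub> g) m \<noteq> 0}"
      by (rule finite_subset[OF supp]) (use fin f g in auto)
    ultimately show ?thesis
      using supp unfolding carrier_monoid_ring_Z zcoeffs_def by blast
  qed
  have comm: "f \<otimes>\<^bsub>?Q\<^esub> g = g \<otimes>\<^bsub>?Q\<^esub> f" if f: "f \<in> ?C" and g: "g \<in> ?C" for f g
  proof
    fix m
    let ?A = "{a. f a \<noteq> 0}" and ?B = "{b. g b \<noteq> 0}"
    have AB: "?A \<subseteq> carrier M" "?B \<subseteq> carrier M"
      using f g by (auto simp: monoid_ring_simps)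
    have "(f \<otimes>\<^bsub>?Q\<^esub> g) m = (\<Sum>b\<in>?B. \<Sum>a\<in>?A. if a \<otimes>\<^bsub>M\<^esub> b = m then f a * g b else 0)"
      using monoid_ring_Z_mult[of ?A f ?B g M m] fin f g sum.swap by simp
    also have "\<dots> = (\<Sum>b\<in>?B. \<Sum>a\<in>?A. if b \<otimes>\<^bsub>M\<^esub> a = m then g b * f a else 0)"
      using AB by (intro sum.cong) (auto simp: M.m_comm mult.commute subset_iff)
    also have "\<dots> = (g \<otimes>\<^bsub>?Q\<^esub> f) m"
      using monoid_ring_Z_mult[of ?B g ?A f M m] fin f g by simp
    finally show "(f \<otimes>\<^bsub>?Q\<^esub> g) m = (g \<otimes>\<^bsub>?Q\<^esub> f) m" .
  qed
  have distl: "(\<lambda>m. f m + f' m) \<otimes>\<^bsub>?Q\<^esub> g = (\<lambda>m. (f \<otimes>\<^bsub>?Q\<^esub> g) m + (f' \<otimes>\<^bsub>?Q\<^esub> g) m)"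
    if f: "f \<in> ?C" "f' \<in> ?C" and g: "g \<in> ?C" for f f' g
  proof
    fix m
    let ?A = "{a. f a \<noteq> 0} \<union> {a. f' a \<noteq> 0}" and ?B = "{b. g b \<noteq> 0}"
    have A: "finite ?A" "{a. f a \<noteq> 0} \<subseteq> ?A" "{a. f' a \<noteq> 0} \<subseteq> ?A" "{a. f a + f' a \<noteq> 0} \<subseteq> ?A"
      by (simp add: fin f) auto
    have B: "finite ?B" using fin g by simp
    have "((\<lambda>m. f m + f' m) \<otimes>\<^bsub>?Q\<^esub> g) m
        = (\<Sum>a\<in>?A. \<Sum>b\<in>?B. if a \<otimes>\<^bsub>M\<^esub> b = m then (f a + f' a) * g b else 0)"
      by (rule monoid_ring_Z_mult[OF A(1,4) B]) simp
    also have "\<dots> = (\<Sum>a\<in>?A. \<Sum>b\<in>?B. (if a \<otimes>\<^bsub>M\<^esub> b = m then f a * g b else 0)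
        + (if a \<otimes>\<^bsub>M\<^esub> b = m then f' a * g b else 0))"
      by (intro sum.cong) (auto simp: distrib_right)
    also have "\<dots> = (\<Sum>a\<in>?A. \<Sum>b\<in>?B. if a \<otimes>\<^bsub>M\<^esub> b = m then f a * g b else 0)
        + (\<Sum>a\<in>?A. \<Sum>b\<in>?B. if a \<otimes>\<^bsub>M\<^esub> b = m then f' a * g b else 0)"
      by (simp add: sum.distrib)
    also have "\<dots> = (f \<otimes>\<^bsub>?Q\<^esub> g) m + (f' \<otimes>\<^bsub>?Q\<^esub> g) m"
      by (simp only: monoid_ring_Z_mult[OF A(1,2) B subset_refl] monoid_ring_Z_mult[OF A(1,3) B subset_refl])
    finally show "((\<lambda>m. f m + f' m) \<otimes>\<^bsub>?Q\<^esub> g) m = (f \<otimes>\<^bsub>?Q\<^esub> g) m + (f' \<otimes>\<^bsub>?Q\<^esub> g) m" .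
  qed
  have distr: "g \<otimes>\<^bsub>?Q\<^esub> (\<lambda>m. f m + f' m) = (\<lambda>m. (g \<otimes>\<^bsub>?Q\<^esub> f) m + (g \<otimes>\<^bsub>?Q\<^esub> f') m)"
    if f: "f \<in> ?C" "f' \<in> ?C" and g: "g \<in> ?C" for f f' g
    using distl[OF that] comm[OF g add_closed[OF f]] comm[OF g f(1)] comm[OF g f(2)] by simp
  have zerol: "(\<lambda>m. 0) \<otimes>\<^bsub>?Q\<^esub> g = (\<lambda>m. 0)" for g
    by (simp add: monoid_ring_simps(2) int_finsum_eq)
  have zeror: "g \<otimes>\<^bsub>?Q\<^esub> (\<lambda>m. 0) = (\<lambda>m. 0)" for g
    by (simp add: monoid_ring_simps(2) int_finsum_eq)
  have assoc1: "(mr_single \<Z> a c \<otimes>\<^bsub>?Q\<^esub> mr_single \<Z> b d) \<otimes>\<^bsub>?Q\<^esub> h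
      = mr_single \<Z> a c \<otimes>\<^bsub>?Q\<^esub> (mr_single \<Z> b d \<otimes>\<^bsub>?Q\<^esub> h)"
    if ab: "a \<in> carrier M" "b \<in> carrier M" and h: "h \<in> ?C" for a b c d h
    using h subset_UNIV
  proof (induction h rule: int.monoid_ring_induct)
    case zero
    then show ?case by (simp add: zeror)
  next
    case (add m e g)
    then show ?case
      using ab by (simp add: distr mult_closed single_closed single_mult M.m_assoc mult.assoc)
  qed
  have assoc2: "(mr_single \<Z> a c \<otimes>\<^bsub>?Q\<^esub> g) \<otimes>\<^bsub>?Q\<^esub> h = mr_single \<Z> a c \<otimes>\<^bsub>?Q\<^esub> (g \<otimes>\<^bsub>?Q\<^esub> h)"
    if a: "a \<in> carrier M" and h: "h \<in> ?C" and g: "g \<in> ?C" for a c g h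
    using g subset_UNIV
  proof (induction g rule: int.monoid_ring_induct)
    case zero
    then show ?case by (simp add: zeror zerol)
  next
    case (add m e g)
    then show ?case
      using a h assoc1[OF a add.hyps(2) h]
      by (simp add: distr distl mult_closed single_closed)
  qed
  have assoc: "(f \<otimes>\<^bsub>?Q\<^esub> g) \<otimes>\<^bsub>?Q\<^esub> h = f \<otimes>\<^bsub>?Q\<^esub> (g \<otimes>\<^bsub>?Q\<^esub> h)"
    if g: "g \<in> ?C" and h: "h \<in> ?C" and f: "f \<in> ?C" for f g h
    using f subset_UNIV
  proof (induction f rule: int.monoid_ring_induct)
    case zero
    then show ?case by (simp add: zerol)
  next
    case (add m e f)
    then show ?case
      using g h assoc2[OF add.hyps(2) h g]
      by (simp add: distl mult_closed single_closed)
  qed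
  have one: "\<one>\<^bsub>?Q\<^esub> \<otimes>\<^bsub>?Q\<^esub> f = f" if f: "f \<in> ?C" for f
    using f subset_UNIV
  proof (induction f rule: int.monoid_ring_induct)
    case zero
    then show ?case by (simp add: zeror)
  next
    case (add m e f)
    then show ?case
      by (simp add: monoid_ring_simps(3) distr single_closed single_mult)
  qed
  show ?thesis
  proof (rule cringI)
    show "abelian_group ?Q"
    proof (rule abelian_groupI)
      fix f assume "f \<in> ?C"
      then have "(\<lambda>m. - f m) \<in> ?C" by (simp add: monoid_ring_simps)
      then show "\<exists>g\<in>?C. g \<oplus>\<^bsub>?Q\<^esub> f = \<zero>\<^bsub>?Q\<^esub>"
        by (intro bexI[of _ "\<lambda>m. - f m"]) auto
    qed (auto simp: add_closed zero_closed add_ac)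
    show "Group.comm_monoid ?Q"
      by (rule comm_monoidI)
        (simp_all add: mult_closed assoc one monoid_ring_simps(3)[of \<Z> M, symmetric],
         simp add: monoid_ring_simps(3) single_closed, rule comm)
  qed (auto simp: distl)
qed

text \<open>The universal property of a monoid ring: a multiplicative map extends additively to a ring
  homomorphism.\<close>

lemma zlin_ring_hom:
  assumes "Group.comm_monoid M" "cring S" and \<mu>: "\<mu> \<in> hom M S" "\<mu> \<one>\<^bsub>M\<^esub> = \<one>\<^bsub>S\<^esub>"
  shows "zlin S \<mu> \<in> ring_hom (monoid_ring \<Z> M) S"
proof -
  interpret M: Group.comm_monoid M by fact
  interpret S: cring S by fact
  interpret Q: cring "monoid_ring \<Z> M" by (rule cring_monoid_ring_Z) fact
  have \<mu>_closed: "\<mu> \<in> carrier M \<rightarrow> carrier S"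
    using \<mu>(1) by (auto simp: hom_def)
  have closed: "zlin S \<mu> f \<in> carrier S" if "f \<in> carrier (monoid_ring \<Z> M)" for f
    using that S.zlin_closed[OF _ \<mu>_closed] by (simp add: carrier_monoid_ring_Z)
  have zlin_plus: "zlin S \<mu> (f \<oplus>\<^bsub>monoid_ring \<Z> M\<^esub> g) = zlin S \<mu> f \<oplus>\<^bsub>S\<^esub> zlin S \<mu> g"
    if "f \<in> carrier (monoid_ring \<Z> M)" "g \<in> carrier (monoid_ring \<Z> M)" for f g
    using S.zlin_add[OF _ _ \<mu>_closed] that by (simp add: carrier_monoid_ring_Z monoid_ring_simps(5))
  have zlin_0: "zlin S \<mu> (\<lambda>m. 0) = \<zero>\<^bsub>S\<^esub>"
    by (rule S.zlin_zero)
  have single: "zlin S \<mu> (mr_single \<Z> m c) = c \<star>\<^bsub>S\<^esub> \<mu> m" if "m \<in> carrier M" for m c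
    using that \<mu>_closed by (intro S.zlin_single) auto
  have sc: "mr_single \<Z> m c \<in> carrier (monoid_ring \<Z> M)" if "m \<in> carrier M" for m c
    using that by (intro int.mr_single_closed) auto
  have Qzero: "\<zero>\<^bsub>monoid_ring \<Z> M\<^esub> = (\<lambda>m. 0)"
    by (simp add: monoid_ring_simps)
  note null = Q.l_null[unfolded Qzero] Q.r_null[unfolded Qzero]
  have mult_single: "zlin S \<mu> (mr_single \<Z> a c \<otimes>\<^bsub>monoid_ring \<Z> M\<^esub> g)
      = c \<star>\<^bsub>S\<^esub> \<mu> a \<otimes>\<^bsub>S\<^esub> zlin S \<mu> g"
    if a: "a \<in> carrier M" and g: "g \<in> carrier (monoid_ring \<Z> M)" for a c g
    using g subset_UNIV
  proof (induction g rule: int.monoid_ring_induct)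
    case zero
    show ?case
      using a \<mu>_closed by (simp add: null sc zlin_0 Pi_iff)
  next
    case (add m e g)
    have \<mu>m: "\<mu> a \<in> carrier S" "\<mu> m \<in> carrier S" "\<mu> (a \<otimes>\<^bsub>M\<^esub> m) = \<mu> a \<otimes>\<^bsub>S\<^esub> \<mu> m"
      using \<mu> a add by (auto simp: hom_def)
    have "zlin S \<mu> (mr_single \<Z> a c \<otimes>\<^bsub>monoid_ring \<Z> M\<^esub> (mr_single \<Z> m e \<oplus>\<^bsub>monoid_ring \<Z> M\<^esub> g))
        = zlin S \<mu> (mr_single \<Z> (a \<otimes>\<^bsub>M\<^esub> m) (c * e) \<oplus>\<^bsub>monoid_ring \<Z> M\<^esub>
            mr_single \<Z> a c \<otimes>\<^bsub>monoid_ring \<Z> M\<^esub> g)"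
      using a add cring.mr_single_mult[OF int_is_cring, where c = c and d = e and a = a and b = m and M = M] by (simp add: Q.r_distr sc)
    also have "\<dots> = (c * e) \<star>\<^bsub>S\<^esub> (\<mu> a \<otimes>\<^bsub>S\<^esub> \<mu> m) \<oplus>\<^bsub>S\<^esub> c \<star>\<^bsub>S\<^esub> \<mu> a \<otimes>\<^bsub>S\<^esub> zlin S \<mu> g"
      using a add \<mu>m by (simp add: zlin_plus sc single)
    also have "(c * e) \<star>\<^bsub>S\<^esub> (\<mu> a \<otimes>\<^bsub>S\<^esub> \<mu> m) = c \<star>\<^bsub>S\<^esub> \<mu> a \<otimes>\<^bsub>S\<^esub> e \<star>\<^bsub>S\<^esub> \<mu> m"
      using \<mu>m by (simp add: S.add_pow_ldistr_int S.add_pow_rdistr_int S.add.int_pow_pow mult.commute)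
    finally show ?case
      using a add \<mu>m closed
      by (simp add: zlin_plus sc single S.r_distr)
  qed
  have mult: "zlin S \<mu> (f \<otimes>\<^bsub>monoid_ring \<Z> M\<^esub> g) = zlin S \<mu> f \<otimes>\<^bsub>S\<^esub> zlin S \<mu> g"
    if g: "g \<in> carrier (monoid_ring \<Z> M)" and f: "f \<in> carrier (monoid_ring \<Z> M)" for f g
    using f subset_UNIV
  proof (induction f rule: int.monoid_ring_induct)
    case zero
    show ?case
      using g closed by (simp add: null zlin_0)
  next
    case (add m e f)
    have \<mu>m: "\<mu> m \<in> carrier S"
      using \<mu> add by (auto simp: hom_def)
    show ?case
      using add g \<mu>m closed
      by (simp add: zlin_plus sc single mult_single
          S.l_distr Q.l_distr)
  qed
  show ?thesis
    by (rule ring_hom_memI)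
      (simp_all add: closed zlin_plus mult monoid_ring_simps(3) single \<mu>(2))
qed

section \<open>Monomials\<close>

text \<open>The value of a monomial under an assignment \<open>v\<close> of ring elements to the variables.\<close>

definition mval :: "('s, 'c) ring_scheme \<Rightarrow> ('y \<Rightarrow> 's) \<Rightarrow> 'y multiset \<Rightarrow> 's" where
  "mval S v m = (\<Otimes>\<^bsub>S\<^esub>y\<in>set_mset m. v y [^]\<^bsub>S\<^esub> count m y)"

lemma monomials_simps [simp]:
  "m \<in> carrier (monomials Y) \<longleftrightarrow> set_mset m \<subseteq> Y"
  "m \<otimes>\<^bsub>monomials Y\<^esub> m' = m + m'"
  "\<one>\<^bsub>monomials Y\<^esub> = {#}"
  by (auto simp: monomials_def)

lemma comm_monoid_monomials: "Group.comm_monoid (monomials Y)"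
  by (rule comm_monoidI) (auto simp: add_ac)

context cring
begin

lemma mval_closed: "v \<in> set_mset m \<rightarrow> carrier R \<Longrightarrow> mval R v m \<in> carrier R"
  unfolding mval_def by (intro finprod_closed) auto

lemma mval_empty [simp]: "mval R v {#} = \<one>"
  by (simp add: mval_def)

lemma mval_cong:
  "(\<And>y. y \<in># m \<Longrightarrow> v y = u y) \<Longrightarrow> u \<in> set_mset m \<rightarrow> carrier R \<Longrightarrow> mval R v m = mval R u m"
  unfolding mval_def by (intro finprod_cong') auto

lemma mval_add_mset:
  assumes "v y \<in> carrier R" "v \<in> set_mset m \<rightarrow> carrier R"
  shows "mval R v (add_mset y m) = v y \<otimes> mval R v m"
proof -
  let ?A = "set_mset m - {y}"
  let ?P = "\<Otimes>x\<in>?A. v x [^] count m x"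
  have v: "v \<in> ?A \<rightarrow> carrier R" using assms by auto
  have P: "?P \<in> carrier R" using v by (intro finprod_closed) auto
  have m: "mval R v m = v y [^] count m y \<otimes> ?P"
  proof (cases "y \<in># m")
    case True
    then have "set_mset m = insert y ?A" by auto
    then have "mval R v m = (\<Otimes>x\<in>insert y ?A. v x [^] count m x)"
      by (simp only: mval_def)
    also have "\<dots> = v y [^] count m y \<otimes> ?P"
      using v assms(1) by (intro finprod_insert) auto
    finally show ?thesis .
  next
    case False
    then show ?thesis using P by (simp add: mval_def not_in_iff)
  qed
  have "set_mset (add_mset y m) = insert y ?A" by auto
  then have "mval R v (add_mset y m) = (\<Otimes>x\<in>insert y ?A. v x [^] count (add_mset y m) x)"
    by (simp only: mval_def)
  also have "\<dots> = v y [^] count (add_mset y m) y \<otimes> (\<Otimes>x\<in>?A. v x [^] count (add_mset y m) x)"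
    using v assms(1) by (intro finprod_insert) auto
  also have "(\<Otimes>x\<in>?A. v x [^] count (add_mset y m) x) = ?P"
    using v by (intro finprod_cong') auto
  also have "v y [^] count (add_mset y m) y \<otimes> ?P = v y \<otimes> (v y [^] count m y \<otimes> ?P)"
    using assms(1) P by (simp add: m_ac)
  finally show ?thesis by (simp only: m)
qed

lemma mval_single: "v y \<in> carrier R \<Longrightarrow> mval R v {#y#} = v y"
  by (simp add: mval_add_mset)

lemma mval_union:
  assumes "v \<in> set_mset m \<rightarrow> carrier R" "v \<in> set_mset m' \<rightarrow> carrier R"
  shows "mval R v (m + m') = mval R v m \<otimes> mval R v m'"
  using assms(1)
proof (induction m)
  case empty
  then show ?case using assms(2) by (simp add: mval_closed)
next
  case (add y m)
  then have "v y \<in> carrier R" "v \<in> set_mset m \<rightarrow> carrier R" "v \<in> set_mset (m + m') \<rightarrow> carrier R"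
    using assms(2) by auto
  then show ?case
    using add.IH assms(2) by (simp add: mval_add_mset mval_closed m_assoc)
qed

lemma mval_hom: "v \<in> Y \<rightarrow> carrier R \<Longrightarrow> mval R v \<in> hom (monomials Y) R"
  by (auto simp: hom_def mval_closed mval_union Pi_iff subset_iff)

lemma ring_hom_mval:
  assumes "cring S" "g \<in> ring_hom R S" "v \<in> set_mset m \<rightarrow> carrier R"
  shows "g (mval R v m) = mval S (\<lambda>y. g (v y)) m"
proof -
  interpret S: cring S by fact
  show ?thesis
    using assms(3)
  proof (induction m)
    case empty
    then show ?case using ring_hom_one[OF assms(2)] by simp
  next
    case (add y m)
    then have v: "v y \<in> carrier R" "v \<in> set_mset m \<rightarrow> carrier R" by auto
    then have gv: "g (v y) \<in> carrier S" "(\<lambda>y. g (v y)) \<in> set_mset m \<rightarrow> carrier S"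
      using ring_hom_closed[OF assms(2)] by auto
    have "g (mval R v (add_mset y m)) = g (v y) \<otimes>\<^bsub>S\<^esub> g (mval R v m)"
      using v by (simp add: mval_add_mset mval_closed ring_hom_mult[OF assms(2)])
    then show ?case
      using add.IH[OF v(2)] gv by (simp add: S.mval_add_mset)
  qed
qed

end

text \<open>A homomorphism out of a polynomial algebra is determined by its values on constants and
  variables.\<close>

lemma poly_alg_hom_single:
  assumes "cring k" "cring S" and h: "h \<in> ring_hom (poly_alg k Y) S"
    and m: "set_mset m \<subseteq> Y" and c: "c \<in> carrier k"
  shows "h (mr_single k m c) = h (mr_single k {#} c) \<otimes>\<^bsub>S\<^esub> mval S (\<lambda>y. h (mr_single k {#y#} \<one>\<^bsub>k\<^esub>)) m"
  using m
proof (induction m)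
  case empty
  interpret k: cring k by fact
  interpret S: cring S by fact
  have "h (mr_single k {#} c) \<in> carrier S"
    using ring_hom_closed[OF h] k.mr_single_closed[of "{#}" "monomials Y" c] c
    by (simp add: poly_alg_def)
  then show ?case by simp
next
  case (add y m)
  interpret k: cring k by fact
  interpret S: cring S by fact
  let ?v = "\<lambda>y. h (mr_single k {#y#} \<one>\<^bsub>k\<^esub>)"
  have single: "mr_single k m' d \<in> carrier (poly_alg k Y)" if "set_mset m' \<subseteq> Y" "d \<in> carrier k" for m' d
    using that k.mr_single_closed[of m' "monomials Y" d] by (simp add: poly_alg_def)
  have v: "?v z \<in> carrier S" if "z \<in> Y" for z
    using that single by (intro ring_hom_closed[OF h]) auto
  have mY: "set_mset m \<subseteq> Y" "y \<in> Y" using add.prems by auto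
  have "mr_single k (add_mset y m) c
      = mr_single k {#y#} \<one>\<^bsub>k\<^esub> \<otimes>\<^bsub>poly_alg k Y\<^esub> mr_single k m c"
    using c by (simp add: poly_alg_def k.mr_single_mult)
  then have "h (mr_single k (add_mset y m) c) = ?v y \<otimes>\<^bsub>S\<^esub> h (mr_single k m c)"
    using mY single c by (simp add: ring_hom_mult[OF h])
  also have "\<dots> = ?v y \<otimes>\<^bsub>S\<^esub> (h (mr_single k {#} c) \<otimes>\<^bsub>S\<^esub> mval S ?v m)"
    using add.IH[OF mY(1)] by simp
  also have "\<dots> = h (mr_single k {#} c) \<otimes>\<^bsub>S\<^esub> mval S ?v (add_mset y m)"
  proof -
    have vm: "?v \<in> set_mset m \<rightarrow> carrier S" using v mY by auto
    have "h (mr_single k {#} c) \<in> carrier S"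
      using single c by (intro ring_hom_closed[OF h]) auto
    then show ?thesis
      using v[OF mY(2)] vm by (simp add: S.mval_add_mset S.mval_closed S.m_ac)
  qed
  finally show ?case .
qed

section \<open>Counting monomials of a given degree\<close>

definition degree_monomials :: "(nat \<Rightarrow> 'y set) \<Rightarrow> nat \<Rightarrow> 'y multiset set" where
  "degree_monomials Y n = {m. set_mset m \<subseteq> (\<Union>i. Y i) \<and> (\<Sum>y\<in>#m. gen_degree Y y) = n}"

lemma gen_degree_eq: "disjoint_family Y \<Longrightarrow> y \<in> Y n \<Longrightarrow> gen_degree Y y = n"
  unfolding gen_degree_def
  by (rule the_equality) (auto simp: disjoint_family_on_def)

lemma poly_alg_piece_support:
  "f \<in> poly_alg_piece k Y n \<longleftrightarrow>
    f \<in> carrier (poly_alg k (\<Union>i. Y i)) \<and> {m. f m \<noteq> \<zero>\<^bsub>k\<^esub>} \<subseteq> degree_monomials Y n"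
  by (auto simp: poly_alg_piece_def degree_monomials_def poly_alg_def monoid_ring_simps(1))

lemma poly_alg_piece_Z: "poly_alg_piece \<Z> Y n = zcoeffs (degree_monomials Y n)"
proof -
  have "degree_monomials Y n \<subseteq> carrier (monomials (\<Union>i. Y i))"
    by (auto simp: degree_monomials_def)
  then show ?thesis
    unfolding set_eq_iff poly_alg_piece_support poly_alg_def carrier_monoid_ring_Z zcoeffs_def
    by (simp add: subset_iff) blast
qed

text \<open>Since every generator has positive degree, the degree of a monomial bounds both its size and
  the degrees of the generators in it.\<close>

lemma finite_degree_monomials:
  assumes "disjoint_family Y" "\<And>n. finite (Y n)" "Y 0 = {}"
  shows "finite (degree_monomials Y n)"
proof -
  have "m \<in> (\<Union>k\<le>n. multisets_of_size (\<Union>i\<le>n. Y i) k)" if m: "m \<in> degree_monomials Y n" for m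
  proof -
    have deg_pos: "1 \<le> gen_degree Y y" if y: "y \<in># m" for y
    proof -
      obtain i where "y \<in> Y i" using m y unfolding degree_monomials_def by blast
      then show ?thesis using gen_degree_eq[OF assms(1)] assms(3) by (cases i) auto
    qed
    have "size m = (\<Sum>y\<in>#m. 1)" by (rule size_eq_sum_mset)
    also have "\<dots> \<le> (\<Sum>y\<in>#m. gen_degree Y y)"
      using deg_pos by (intro sum_mset_mono) auto
    finally have "size m \<le> n" using m by (simp add: degree_monomials_def)
    moreover have "y \<in> (\<Union>i\<le>n. Y i)" if y: "y \<in># m" for y
    proof -
      obtain i where i: "y \<in> Y i" using m y unfolding degree_monomials_def by blast
      have "gen_degree Y y \<le> (\<Sum>y\<in>#m. gen_degree Y y)"
        using multi_member_split[OF y] by auto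
      then have "i \<le> n"
        using m gen_degree_eq[OF assms(1) i] by (simp add: degree_monomials_def)
      with i show ?thesis by blast
    qed
    ultimately show ?thesis by (auto simp: multisets_of_size_def)
  qed
  then have "degree_monomials Y n \<subseteq> (\<Union>k\<le>n. multisets_of_size (\<Union>i\<le>n. Y i) k)" by blast
  moreover have "finite (\<Union>k\<le>n. multisets_of_size (\<Union>i\<le>n. Y i) k)"
    using assms(2) by (intro finite_UN_I finite_multisets_of_size) auto
  ultimately show ?thesis by (rule finite_subset)
qed

text \<open>The number of monomials of each degree grows with the number of generators, and strictly so
  in the degree of an added generator, which is itself a monomial.\<close>

lemma card_degree_monomials_mono:
  assumes Y: "disjoint_family Y" "\<And>n. finite (Y n)"
    and Y': "disjoint_family Y'" "\<And>n. finite (Y' n)" "Y' 0 = {}"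
    and card: "\<And>n. card (Y n) \<le> card (Y' n)"
  shows "card (degree_monomials Y n) \<le> card (degree_monomials Y' n)"
    and "card (degree_monomials Y n) = card (degree_monomials Y' n) \<Longrightarrow> card (Y n) = card (Y' n)"
proof -
  have "\<exists>f. f ` Y n \<subseteq> Y' n \<and> inj_on f (Y n)" for n
    using card_le_inj[OF Y(2) Y'(2) card] by blast
  then obtain f where f: "\<And>n. f n ` Y n \<subseteq> Y' n" "\<And>n. inj_on (f n) (Y n)"
    by metis
  define \<iota> where "\<iota> y = f (gen_degree Y y) y" for y
  have \<iota>: "\<iota> y \<in> Y' i" "gen_degree Y' (\<iota> y) = gen_degree Y y" if "y \<in> Y i" for y i
    using that f(1)[of i] gen_degree_eq[OF Y(1) that] gen_degree_eq[OF Y'(1)]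
    by (auto simp: \<iota>_def)
  have inj: "inj_on \<iota> (\<Union>i. Y i)"
  proof (rule inj_onI)
    fix y z assume "y \<in> (\<Union>i. Y i)" "z \<in> (\<Union>i. Y i)" and eq: "\<iota> y = \<iota> z"
    then obtain i j where ij: "y \<in> Y i" "z \<in> Y j" by blast
    then have "i = j"
      using \<iota>(2)[OF ij(1)] \<iota>(2)[OF ij(2)] eq gen_degree_eq[OF Y(1)] by metis
    then show "y = z"
      using eq ij f(2)[of j] gen_degree_eq[OF Y(1)] by (simp add: \<iota>_def inj_on_eq_iff)
  qed
  let ?g = "image_mset \<iota>"
  have maps: "?g ` degree_monomials Y n \<subseteq> degree_monomials Y' n"
  proof safe
    fix m assume m: "m \<in> degree_monomials Y n"
    have "(\<Sum>y\<in>#m. gen_degree Y' (\<iota> y)) = (\<Sum>y\<in>#m. gen_degree Y y)"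
      using m \<iota>(2) by (intro arg_cong[where f = sum_mset] image_mset_cong)
        (auto simp: degree_monomials_def)
    then show "?g m \<in> degree_monomials Y' n"
      using m \<iota>(1) by (fastforce simp: degree_monomials_def image_mset.compositionality o_def)
  qed
  have inj_g: "inj_on ?g (degree_monomials Y n)"
  proof (rule inj_onI)
    fix m m' assume m: "m \<in> degree_monomials Y n" "m' \<in> degree_monomials Y n" "?g m = ?g m'"
    have "image_mset (inv_into (\<Union>i. Y i) \<iota>) (?g m0) = m0" if "m0 \<in> degree_monomials Y n" for m0
    proof -
      have "image_mset (inv_into (\<Union>i. Y i) \<iota>) (?g m0) = image_mset (\<lambda>y. y) m0"
        unfolding image_mset.compositionality
        using that inj by (intro image_mset_cong) (auto simp: degree_monomials_def intro!: inv_into_f_f)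
      then show ?thesis by simp
    qed
    then show "m = m'" using m by metis
  qed
  have fin: "finite (degree_monomials Y' n)"
    by (rule finite_degree_monomials[OF Y'])
  show "card (degree_monomials Y n) \<le> card (degree_monomials Y' n)"
    using card_inj_on_le[OF inj_g maps fin] .
  show "card (Y n) = card (Y' n)"
    if eq: "card (degree_monomials Y n) = card (degree_monomials Y' n)"
  proof -
    have surj: "?g ` degree_monomials Y n = degree_monomials Y' n"
      using card_subset_eq[OF fin maps] card_image[OF inj_g] eq by simp
    have "Y' n \<subseteq> f n ` Y n"
    proof
      fix y' assume y': "y' \<in> Y' n"
      then have "{#y'#} \<in> degree_monomials Y' n"
        using gen_degree_eq[OF Y'(1)] by (auto simp: degree_monomials_def)
      then obtain m where m: "m \<in> degree_monomials Y n" "?g m = {#y'#}"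
        using surj by (metis imageE)
      then obtain y where y: "m = {#y#}" "\<iota> y = y'"
        using msed_map_invR[of \<iota> m y' "{#}"] by auto
      then obtain i where i: "y \<in> Y i" using m by (auto simp: degree_monomials_def)
      moreover have "i = n"
        using m y gen_degree_eq[OF Y(1) i] by (simp add: degree_monomials_def)
      ultimately show "y' \<in> f n ` Y n"
        using y(2) gen_degree_eq[OF Y(1) i] by (auto simp: \<iota>_def)
    qed
    then have "card (Y' n) \<le> card (Y n)"
      using Y(2) by (metis card_image_le card_mono finite_imageI order_trans)
    then show ?thesis using card[of n] by simp
  qed
qed

section \<open>Tensor products of commutative rings\<close>

lemma ring_hom_int_mult:
  assumes "ring R" "ring S" "h \<in> ring_hom R S" "x \<in> carrier R"
  shows "h (k \<star>\<^bsub>R\<^esub> x) = k \<star>\<^bsub>S\<^esub> h x"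
proof -
  interpret ring_hom_ring R S h
    by (rule ring_hom_ringI2) fact+
  interpret g: group_hom "add_monoid R" "add_monoid S" h
    by (rule a_group_hom)
  show ?thesis
    using g.hom_int_pow[of x k] assms(4) by (simp add: add_pow_def)
qed

text \<open>Here \<open>I\<close> may be smaller than the kernel, as it is for the biadditivity ideal of a tensor
  product.\<close>

lemma quotient_ring_hom_factor:
  fixes R (structure) and S
  assumes "ideal I R" "ring S" and g: "g \<in> ring_hom R S" and ker: "I \<subseteq> a_kernel R S g"
  shows "\<exists>h \<in> ring_hom (R Quot I) S. \<forall>x\<in>carrier R. h (I +>\<^bsub>R\<^esub> x) = g x"
proof -
  interpret ideal I R by fact
  interpret S: ring S by fact
  define h where "h C = the_elem (g ` C)" for C
  have h: "h (I +> x) = g x" if x: "x \<in> carrier R" for x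
  proof -
    have "g y = g x" if y: "y \<in> I +> x" for y
    proof -
      obtain i where i: "i \<in> I" "y = i \<oplus> x"
        using y unfolding a_r_coset_def' by blast
      from i(1) ker have "i \<in> {y \<in> carrier R. g y = \<zero>\<^bsub>S\<^esub>}"
        unfolding a_kernel_def' by (rule rev_subsetD)
      then have i0: "i \<in> carrier R" "g i = \<zero>\<^bsub>S\<^esub>"
        by (simp_all only: mem_Collect_eq)
      have "g (i \<oplus> x) = \<zero>\<^bsub>S\<^esub> \<oplus>\<^bsub>S\<^esub> g x"
        using ring_hom_add[OF g i0(1) x] i0(2) by (simp only:)
      also have "\<dots> = g x"
        using ring_hom_closed[OF g x] by (rule S.l_zero)
      finally show ?thesis by (simp only: i(2))
    qed
    moreover have "x \<in> I +> x"
      using x a_rcos_self by blast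
    ultimately have "g ` (I +> x) = {g x}" by blast
    then show ?thesis by (simp add: h_def)
  qed
  have coset: "\<exists>x\<in>carrier R. C = I +> x" if "C \<in> carrier (R Quot I)" for C
    using that by (auto simp: FactRing_def A_RCOSETS_def')
  note q = rcos_ring_hom
  have "h \<in> ring_hom (R Quot I) S"
  proof (rule ring_hom_memI)
    fix C assume "C \<in> carrier (R Quot I)"
    then show "h C \<in> carrier S" using coset h ring_hom_closed[OF g] by metis
  next
    fix C D assume "C \<in> carrier (R Quot I)" "D \<in> carrier (R Quot I)"
    then obtain x y where xy: "x \<in> carrier R" "C = I +> x" "y \<in> carrier R" "D = I +> y"
      using coset by metis
    show "h (C \<otimes>\<^bsub>R Quot I\<^esub> D) = h C \<otimes>\<^bsub>S\<^esub> h D"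
      using xy by (simp add: ring_hom_mult[OF q, symmetric] h ring_hom_mult[OF g])
    show "h (C \<oplus>\<^bsub>R Quot I\<^esub> D) = h C \<oplus>\<^bsub>S\<^esub> h D"
      using xy by (simp add: ring_hom_add[OF q, symmetric] h ring_hom_add[OF g])
  next
    show "h \<one>\<^bsub>R Quot I\<^esub> = \<one>\<^bsub>S\<^esub>"
      by (simp add: ring_hom_one[OF q, symmetric] h ring_hom_one[OF g])
  qed
  then show ?thesis using h by blast
qed

locale cring_pair = R: cring R + A: cring A
  for R :: "('r, 'm) ring_scheme" and A :: "('a, 'n) ring_scheme"
begin

abbreviation "P \<equiv> pair_ring R A"
abbreviation "J \<equiv> tensor_ideal R A"
abbreviation "T \<equiv> tensor_ring R A"

lemma comm_monoid_pairs: "Group.comm_monoid (R \<times>\<times> A)"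
  by (rule comm_monoidI)
    (auto simp: DirProd_def R.m_assoc A.m_assoc intro: R.m_comm A.m_comm)

sublocale P: cring "pair_ring R A"
  unfolding pair_ring_def by (rule cring_monoid_ring_Z[OF comm_monoid_pairs])

lemma single_closed: "r \<in> carrier R \<Longrightarrow> a \<in> carrier A \<Longrightarrow> mr_single \<Z> (r, a) k \<in> carrier P"
  unfolding pair_ring_def by (rule int.mr_single_closed) (auto simp: DirProd_def)

lemma rels_closed: "tensor_rels R A \<subseteq> carrier P"
  unfolding tensor_rels_def by (auto intro!: P.minus_closed P.a_closed single_closed)

sublocale J: ideal "tensor_ideal R A" "pair_ring R A"
  unfolding tensor_ideal_def by (rule P.genideal_ideal[OF rels_closed])

sublocale T: cring "tensor_ring R A"
  unfolding tensor_ring_def by (rule J.quotient_is_cring[OF P.is_cring])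

lemma proj_hom: "(+>\<^bsub>P\<^esub>) J \<in> ring_hom P T"
  unfolding tensor_ring_def by (rule J.rcos_ring_hom)

lemma pure_closed: "r \<in> carrier R \<Longrightarrow> a \<in> carrier A \<Longrightarrow> pure_tensor R A r a \<in> carrier T"
  unfolding pure_tensor_def by (rule ring_hom_closed[OF proj_hom single_closed])

lemma proj_eq:
  assumes "x \<ominus>\<^bsub>P\<^esub> y \<in> tensor_rels R A" "x \<in> carrier P" "y \<in> carrier P"
  shows "J +>\<^bsub>P\<^esub> x = J +>\<^bsub>P\<^esub> y"
proof -
  have "x \<ominus>\<^bsub>P\<^esub> y \<in> J"
    using assms(1) P.genideal_self[OF rels_closed] by (auto simp: tensor_ideal_def)
  then show ?thesis
    using P.quotient_eq_iff_same_a_r_cos[OF J.is_ideal assms(2,3)] by simp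
qed

lemma pure_add_left:
  assumes "r \<in> carrier R" "s \<in> carrier R" "a \<in> carrier A"
  shows "pure_tensor R A (r \<oplus>\<^bsub>R\<^esub> s) a = pure_tensor R A r a \<oplus>\<^bsub>T\<^esub> pure_tensor R A s a"
proof -
  have "J +>\<^bsub>P\<^esub> mr_single \<Z> (r \<oplus>\<^bsub>R\<^esub> s, a) 1
      = J +>\<^bsub>P\<^esub> (mr_single \<Z> (r, a) 1 \<oplus>\<^bsub>P\<^esub> mr_single \<Z> (s, a) 1)"
    using assms by (intro proj_eq P.a_closed single_closed R.a_closed) (auto simp: tensor_rels_def)
  then show ?thesis
    using assms by (simp add: pure_tensor_def ring_hom_add[OF proj_hom] single_closed)
qed

lemma pure_add_right:
  assumes "r \<in> carrier R" "a \<in> carrier A" "b \<in> carrier A"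
  shows "pure_tensor R A r (a \<oplus>\<^bsub>A\<^esub> b) = pure_tensor R A r a \<oplus>\<^bsub>T\<^esub> pure_tensor R A r b"
proof -
  have "J +>\<^bsub>P\<^esub> mr_single \<Z> (r, a \<oplus>\<^bsub>A\<^esub> b) 1
      = J +>\<^bsub>P\<^esub> (mr_single \<Z> (r, a) 1 \<oplus>\<^bsub>P\<^esub> mr_single \<Z> (r, b) 1)"
    using assms by (intro proj_eq P.a_closed single_closed A.a_closed) (auto simp: tensor_rels_def)
  then show ?thesis
    using assms by (simp add: pure_tensor_def ring_hom_add[OF proj_hom] single_closed)
qed

lemma pure_mult:
  assumes "r \<in> carrier R" "s \<in> carrier R" "a \<in> carrier A" "b \<in> carrier A"
  shows "pure_tensor R A r a \<otimes>\<^bsub>T\<^esub> pure_tensor R A s b = pure_tensor R A (r \<otimes>\<^bsub>R\<^esub> s) (a \<otimes>\<^bsub>A\<^esub> b)"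
proof -
  have "mr_single \<Z> (r, a) 1 \<otimes>\<^bsub>P\<^esub> mr_single \<Z> (s, b) 1
      = mr_single \<Z> (r \<otimes>\<^bsub>R\<^esub> s, a \<otimes>\<^bsub>A\<^esub> b) 1"
    unfolding pair_ring_def
    by (rule trans[OF cring.mr_single_mult[OF int_is_cring]]) (simp_all add: DirProd_def)
  then show ?thesis
    using assms by (simp add: pure_tensor_def ring_hom_mult[OF proj_hom, symmetric] single_closed)
qed

lemma pure_one: "pure_tensor R A \<one>\<^bsub>R\<^esub> \<one>\<^bsub>A\<^esub> = \<one>\<^bsub>T\<^esub>"
  using ring_hom_one[OF proj_hom]
  by (simp add: pure_tensor_def pair_ring_def monoid_ring_simps(3) DirProd_def)

lemma left_hom: "(\<lambda>r. pure_tensor R A r \<one>\<^bsub>A\<^esub>) \<in> ring_hom R T"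
  by (rule ring_hom_memI) (simp_all add: pure_closed pure_mult pure_add_left pure_one)

lemma right_hom: "pure_tensor R A \<one>\<^bsub>R\<^esub> \<in> ring_hom A T"
  by (rule ring_hom_memI) (simp_all add: pure_closed pure_mult pure_add_right pure_one)

lemma pure_split:
  "r \<in> carrier R \<Longrightarrow> a \<in> carrier A \<Longrightarrow>
    pure_tensor R A r a = pure_tensor R A r \<one>\<^bsub>A\<^esub> \<otimes>\<^bsub>T\<^esub> pure_tensor R A \<one>\<^bsub>R\<^esub> a"
  by (simp add: pure_mult)

lemma tensor_piece_subset:
  assumes "additive_subgroup H T"
    and "\<And>r a. r \<in> Rg n \<Longrightarrow> a \<in> carrier A \<Longrightarrow> pure_tensor R A r a \<in> H"
  shows "tensor_piece R Rg A n \<subseteq> H"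
  unfolding tensor_piece_def
  by (rule T.add.generate_subgroup_incl)
    (use assms(2) additive_subgroup.a_subgroup[OF assms(1)] in auto)

lemma tensor_piece_carrier:
  assumes "Rg n \<subseteq> carrier R"
  shows "tensor_piece R Rg A n \<subseteq> carrier T"
  by (rule tensor_piece_subset) (use assms pure_closed T.add.subgroup_self in \<open>auto intro: additive_subgroupI\<close>)

text \<open>The tensor product is the coproduct: homomorphisms out of the two factors combine. The
  combined map is defined on the monoid ring of pairs by its universal property and vanishes on the
  biadditivity relations.\<close>

lemma tensor_universal:
  assumes "cring S" and \<alpha>: "\<alpha> \<in> ring_hom R S" and \<beta>: "\<beta> \<in> ring_hom A S"
  shows "\<exists>h \<in> ring_hom T S. \<forall>r\<in>carrier R. \<forall>a\<in>carrier A. h (pure_tensor R A r a) = \<alpha> r \<otimes>\<^bsub>S\<^esub> \<beta> a"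
proof -
  interpret S: cring S by fact
  let ?\<mu> = "\<lambda>(r, a). \<alpha> r \<otimes>\<^bsub>S\<^esub> \<beta> a"
  let ?g = "zlin S ?\<mu>"
  have closed: "\<alpha> r \<in> carrier S" "\<beta> a \<in> carrier S" if "r \<in> carrier R" "a \<in> carrier A" for r a
    using that ring_hom_closed[OF \<alpha>] ring_hom_closed[OF \<beta>] by auto
  have "?\<mu> \<in> hom (R \<times>\<times> A) S"
  proof (rule homI)
    fix x y assume "x \<in> carrier (R \<times>\<times> A)" "y \<in> carrier (R \<times>\<times> A)"
    then show "?\<mu> (x \<otimes>\<^bsub>R \<times>\<times> A\<^esub> y) = ?\<mu> x \<otimes>\<^bsub>S\<^esub> ?\<mu> y"
      using closed by (auto simp: DirProd_def ring_hom_mult[OF \<alpha>] ring_hom_mult[OF \<beta>] S.m_ac)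
  qed (use closed in \<open>auto simp: DirProd_def\<close>)
  moreover have "?\<mu> \<one>\<^bsub>R \<times>\<times> A\<^esub> = \<one>\<^bsub>S\<^esub>"
    by (simp add: DirProd_def ring_hom_one[OF \<alpha>] ring_hom_one[OF \<beta>])
  ultimately have g: "?g \<in> ring_hom P S"
    unfolding pair_ring_def by (intro zlin_ring_hom comm_monoid_pairs assms(1))
  have single: "?g (mr_single \<Z> (r, a) 1) = \<alpha> r \<otimes>\<^bsub>S\<^esub> \<beta> a" if "r \<in> carrier R" "a \<in> carrier A" for r a
    using closed[OF that] by (subst S.zlin_single) auto
  interpret g: ring_hom_ring P S ?g
    by (rule ring_hom_ringI2[OF P.ring_axioms S.ring_axioms g])
  have "tensor_rels R A \<subseteq> a_kernel P S ?g"
  proof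
    fix x assume x: "x \<in> tensor_rels R A"
    have eq: "?g (u \<ominus>\<^bsub>P\<^esub> (v \<oplus>\<^bsub>P\<^esub> w)) = \<zero>\<^bsub>S\<^esub>"
      if "u \<in> carrier P" "v \<in> carrier P" "w \<in> carrier P" "?g u = ?g v \<oplus>\<^bsub>S\<^esub> ?g w" for u v w
      using that by (simp add: a_minus_def S.r_neg)
    have "?g x = \<zero>\<^bsub>S\<^esub>"
      using x unfolding tensor_rels_def
      by (auto intro!: eq single_closed simp: single closed ring_hom_add[OF \<alpha>] ring_hom_add[OF \<beta>]
          S.l_distr S.r_distr)
    then show "x \<in> a_kernel P S ?g"
      unfolding a_kernel_def' using subsetD[OF rels_closed x] by blast
  qed
  then have "J \<subseteq> a_kernel P S ?g"
    unfolding tensor_ideal_def by (rule P.genideal_minimal[OF g.kernel_is_ideal])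
  then obtain h where h: "h \<in> ring_hom (P Quot J) S" "\<forall>x\<in>carrier P. h (J +>\<^bsub>P\<^esub> x) = ?g x"
    using quotient_ring_hom_factor[OF J.is_ideal S.ring_axioms g] by blast
  show ?thesis
    using h by (intro bexI[of _ h]) (auto simp: tensor_ring_def pure_tensor_def single_closed single)
qed

end

section \<open>The \<open>p\<close>-adic integers\<close>

lemma padic_simps:
  "f \<in> carrier (padic_int_ring p) \<longleftrightarrow> (\<forall>n. f n \<in> {0..<int p ^ n} \<and> f (Suc n) mod int p ^ n = f n)"
  "f \<otimes>\<^bsub>padic_int_ring p\<^esub> g = (\<lambda>n. (f n * g n) mod int p ^ n)"
  "f \<oplus>\<^bsub>padic_int_ring p\<^esub> g = (\<lambda>n. (f n + g n) mod int p ^ n)"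
  "\<one>\<^bsub>padic_int_ring p\<^esub> = (\<lambda>n. 1 mod int p ^ n)"
  "\<zero>\<^bsub>padic_int_ring p\<^esub> = (\<lambda>n. 0)"
  by (simp_all add: padic_int_ring_def)

text \<open>Any sequence of integers that is compatible with the reductions becomes an element once each
  term is reduced; all closure properties follow from this.\<close>

lemma padic_reduce_closed:
  assumes "p > 0" "\<And>n. g (Suc n) mod int p ^ n = g n mod int p ^ n"
  shows "(\<lambda>n. g n mod int p ^ n) \<in> carrier (padic_int_ring p)"
  using assms by (auto simp: padic_simps mod_mod_cancel)

lemma padic_reduce:
  assumes "f \<in> carrier (padic_int_ring p)"
  shows "f n mod int p ^ n = f n" "f (Suc n) mod int p ^ n = f n"
  using assms by (auto simp: padic_simps)

lemma cring_padic:
  assumes "p > 0"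
  shows "cring (padic_int_ring p)"
proof -
  let ?Zp = "padic_int_ring p"
  have red: "f (Suc n) mod int p ^ n = f n mod int p ^ n" if "f \<in> carrier ?Zp" for f n
    using padic_reduce[OF that] by simp
  note op = padic_reduce_closed[OF assms]
  have closed: "f \<otimes>\<^bsub>?Zp\<^esub> g \<in> carrier ?Zp" "f \<oplus>\<^bsub>?Zp\<^esub> g \<in> carrier ?Zp"
    if "f \<in> carrier ?Zp" "g \<in> carrier ?Zp" for f g
    unfolding padic_simps(2,3)
    by (rule op, rule mod_mult_cong mod_add_cong; rule red[OF that(1)] red[OF that(2)])+
  have neg: "(\<lambda>n. (- f n) mod int p ^ n) \<in> carrier ?Zp" if "f \<in> carrier ?Zp" for f
    by (rule op, rule mod_minus_cong, rule red[OF that])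
  have one: "\<one>\<^bsub>?Zp\<^esub> \<in> carrier ?Zp" unfolding padic_simps(4) by (rule op) simp
  have zero: "\<zero>\<^bsub>?Zp\<^esub> \<in> carrier ?Zp" using assms by (simp add: padic_simps)
  show ?thesis
  proof (rule cringI)
    show "abelian_group ?Zp"
    proof (rule abelian_groupI)
      fix f assume "f \<in> carrier ?Zp"
      then show "\<exists>g\<in>carrier ?Zp. g \<oplus>\<^bsub>?Zp\<^esub> f = \<zero>\<^bsub>?Zp\<^esub>"
        by (intro bexI[of _ "\<lambda>n. (- f n) mod int p ^ n"] neg)
          (simp add: padic_simps(3,5) mod_add_left_eq)
    next
      fix f assume "f \<in> carrier ?Zp"
      then show "\<zero>\<^bsub>?Zp\<^esub> \<oplus>\<^bsub>?Zp\<^esub> f = f"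
        using padic_reduce(1)[of f p] by (simp add: padic_simps(3,5))
    qed (simp_all add: closed zero, simp_all add: padic_simps(3) mod_add_left_eq mod_add_right_eq add_ac)
    show "Group.comm_monoid ?Zp"
    proof (rule comm_monoidI)
      fix f assume "f \<in> carrier ?Zp"
      then show "\<one>\<^bsub>?Zp\<^esub> \<otimes>\<^bsub>?Zp\<^esub> f = f"
        using padic_reduce(1)[of f p] by (simp add: padic_simps(2,4) mod_mult_left_eq)
    qed (simp_all add: closed one, simp_all add: padic_simps(2) mod_mult_left_eq mod_mult_right_eq mult_ac)
  qed (simp add: padic_simps(2,3) mod_mult_left_eq mod_add_eq distrib_right)
qed

section \<open>Homogeneous components\<close>

lemma (in abelian_group) int_mult_finsum:
  assumes "finite A" "w \<in> A \<rightarrow> carrier G"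
  shows "k \<star> (\<Oplus>i\<in>A. w i) = (\<Oplus>i\<in>A. k \<star> w i)"
  using assms
proof (induction A rule: finite_induct)
  case (insert x F)
  then show ?case by (simp add: Pi_iff add.int_pow_distrib)
qed simp

lemma (in abelian_group) additive_subgroup_finsum:
  assumes "additive_subgroup H G" "finite A" "w \<in> A \<rightarrow> H"
  shows "(\<Oplus>i\<in>A. w i) \<in> H"
  using assms(2,3)
proof (induction A rule: finite_induct)
  case empty
  then show ?case by (simp add: additive_subgroup.zero_closed[OF assms(1)])
next
  case (insert x F)
  have "H \<subseteq> carrier G" by (rule additive_subgroup.a_subset[OF assms(1)])
  then have "(\<Oplus>i\<in>insert x F. w i) = w x \<oplus> (\<Oplus>i\<in>F. w i)"
    using insert by (intro finsum_insert) auto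
  then show ?case
    using insert additive_subgroup.a_closed[OF assms(1)] by simp
qed

context graded_cring
begin

lemma piece_closed: "x \<in> Rg n \<Longrightarrow> x \<in> carrier R"
  using additive_subgroup.a_subset[OF piece_subgroup] by blast

lemma piece_zero: "\<zero> \<in> Rg n"
  by (rule additive_subgroup.zero_closed[OF piece_subgroup])

lemma piece_add: "x \<in> Rg n \<Longrightarrow> y \<in> Rg n \<Longrightarrow> x \<oplus> y \<in> Rg n"
  by (rule additive_subgroup.a_closed[OF piece_subgroup])

lemma piece_int_mult: "x \<in> Rg n \<Longrightarrow> k \<star> x \<in> Rg n"
  by (rule additive_subgroup_int_mult[OF piece_subgroup])

lemma piece_minus: "x \<in> Rg n \<Longrightarrow> y \<in> Rg n \<Longrightarrow> x \<ominus> y \<in> Rg n"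
  unfolding a_minus_def
  by (intro piece_add additive_subgroup.a_inv_closed[OF piece_subgroup])

lemma homogeneous_unique:
  assumes "finite N" and c: "\<And>n. c n \<in> Rg n" "\<And>n. n \<notin> N \<Longrightarrow> c n = \<zero>"
    and d: "\<And>n. d n \<in> Rg n" "\<And>n. n \<notin> N \<Longrightarrow> d n = \<zero>"
    and eq: "(\<Oplus>n\<in>N. c n) = (\<Oplus>n\<in>N. d n)"
  shows "c = d"
proof -
  have supp: "finite {n. e n \<noteq> \<zero>} \<and> (\<Oplus>n\<in>{n. e n \<noteq> \<zero>}. e n) = (\<Oplus>n\<in>N. e n)"
    if e: "\<And>n. e n \<in> Rg n" "\<And>n. n \<notin> N \<Longrightarrow> e n = \<zero>" for e
  proof
    have sub: "{n. e n \<noteq> \<zero>} \<subseteq> N" using e(2) by blast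
    then show "finite {n. e n \<noteq> \<zero>}" using assms(1) by (rule finite_subset)
    show "(\<Oplus>n\<in>{n. e n \<noteq> \<zero>}. e n) = (\<Oplus>n\<in>N. e n)"
      using sub assms(1) e(1) piece_closed by (intro add.finprod_mono_neutral_cong_left) auto
  qed
  let ?x = "\<Oplus>n\<in>N. c n"
  have "?x \<in> carrier R" using c(1) piece_closed by (intro finsum_closed) auto
  then have "\<exists>!c. (\<forall>n. c n \<in> Rg n) \<and> finite {n. c n \<noteq> \<zero>} \<and> ?x = (\<Oplus>n\<in>{n. c n \<noteq> \<zero>}. c n)"
    by (rule direct_sum)
  then show ?thesis
    using supp[OF c] supp[OF d] c(1) d(1) eq by metis
qed

text \<open>Divisibility by an integer is inherited by homogeneous components: \<open>x\<close> is \<open>k\<close> times the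
  component of \<open>s\<close> in degree \<open>n\<close>.\<close>

lemma homogeneous_int_multiple:
  assumes "x \<in> Rg n" "s \<in> carrier R" "x = k \<star> s"
  shows "\<exists>t\<in>Rg n. x = k \<star> t"
proof -
  obtain c where c: "\<And>i. c i \<in> Rg i" "finite {i. c i \<noteq> \<zero>}" "s = (\<Oplus>i\<in>{i. c i \<noteq> \<zero>}. c i)"
    using direct_sum[OF assms(2)] by blast
  let ?N = "insert n {i. c i \<noteq> \<zero>}"
  have cc: "c i \<in> carrier R" for i using c(1) piece_closed by blast
  have "s = (\<Oplus>i\<in>?N. c i)"
    unfolding c(3) using c(2) cc by (intro add.finprod_mono_neutral_cong_left) auto
  then have x: "x = (\<Oplus>i\<in>?N. k \<star> c i)"
    using assms(3) c(2) cc by (simp only: int_mult_finsum finite_insert Pi_iff ball_simps simp_thms)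
  have "(\<lambda>i. if i = n then x else \<zero>) = (\<lambda>i. k \<star> c i)"
  proof (rule homogeneous_unique[of ?N])
    have "(\<Oplus>i\<in>?N. if i = n then x else \<zero>) = (\<Oplus>i\<in>{n}. if i = n then x else \<zero>)"
      using c(2) piece_closed[OF assms(1)]
      by (intro add.finprod_mono_neutral_cong_right) auto
    also have "\<dots> = x" using piece_closed[OF assms(1)] by simp
    finally show "(\<Oplus>i\<in>?N. if i = n then x else \<zero>) = (\<Oplus>i\<in>?N. k \<star> c i)"
      using x by simp
  qed (use c assms(1) piece_zero in \<open>auto intro: piece_int_mult\<close>)
  then have "x = k \<star> c n" by (metis (mono_tags))
  then show ?thesis using c(1) by blast
qed

lemma mval_in_piece:
  assumes "\<And>y. y \<in># m \<Longrightarrow> v y \<in> Rg (\<delta> y)"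
  shows "mval R v m \<in> Rg (\<Sum>y\<in>#m. \<delta> y)"
  using assms
proof (induction m)
  case empty
  then show ?case using one_in_piece by simp
next
  case (add y m)
  have "v y \<in> Rg (\<delta> y)" using add.prems by simp
  moreover have "mval R v m \<in> Rg (\<Sum>y\<in>#m. \<delta> y)" using add by simp
  moreover have "v \<in> set_mset m \<rightarrow> carrier R" using add.prems piece_closed by auto
  ultimately show ?case
    using piece_closed mult_in_piece by (simp add: mval_add_mset)
qed

lemma mval_degree_monomial:
  assumes "disjoint_family Y" "\<And>n y. y \<in> Y n \<Longrightarrow> v y \<in> Rg n" "m \<in> degree_monomials Y n"
  shows "mval R v m \<in> Rg n"
proof -
  have "v y \<in> Rg (gen_degree Y y)" if y: "y \<in># m" for y
  proof -
    obtain i where "y \<in> Y i" using assms(3) y unfolding degree_monomials_def by blast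
    then show ?thesis using assms(2) gen_degree_eq[OF assms(1)] by simp
  qed
  from mval_in_piece[of m v "gen_degree Y", OF this] show ?thesis
    using assms(3) by (simp add: degree_monomials_def)
qed

end

lemma graded_poly_alg_onE:
  assumes "graded_poly_alg_on k S Sg \<phi> Y" "cring k" "cring S" "(\<Union>i. Y i) \<subseteq> carrier S"
  obtains h where "h \<in> ring_iso (poly_alg k (\<Union>i. Y i)) S"
    "\<And>n. h ` poly_alg_piece k Y n = Sg n"
    "h (\<lambda>m. \<zero>\<^bsub>k\<^esub>) = \<zero>\<^bsub>S\<^esub>"
    "\<And>m c. set_mset m \<subseteq> (\<Union>i. Y i) \<Longrightarrow> c \<in> carrier k \<Longrightarrow>
      h (mr_single k m c) = \<phi> c \<otimes>\<^bsub>S\<^esub> mval S (\<lambda>y. y) m"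
proof -
  let ?U = "\<Union>i. Y i"
  interpret k: cring k by fact
  interpret S: cring S by fact
  obtain h where h: "h \<in> ring_iso (poly_alg k ?U) S"
    "\<forall>c\<in>carrier k. h (mr_single k {#} c) = \<phi> c"
    "\<forall>n. h ` poly_alg_piece k Y n = Sg n"
    "\<forall>y\<in>?U. h (mr_single k {#y#} \<one>\<^bsub>k\<^esub>) = y"
    using assms(1) unfolding graded_poly_alg_on_def by (elim bexE conjE)
  have hom: "h \<in> ring_hom (poly_alg k ?U) S"
    using h(1) by (simp add: ring_iso_def)
  have "h (mr_single k m c) = \<phi> c \<otimes>\<^bsub>S\<^esub> mval S (\<lambda>y. y) m"
    if m: "set_mset m \<subseteq> ?U" and c: "c \<in> carrier k" for m c
  proof -
    have "mval S (\<lambda>y. h (mr_single k {#y#} \<one>\<^bsub>k\<^esub>)) m = mval S (\<lambda>y. y) m"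
      using m assms(4) h(4) by (intro S.mval_cong) auto
    then show ?thesis
      using poly_alg_hom_single[OF assms(2,3) hom m c] bspec[OF h(2) c] by simp
  qed
  moreover have "h (\<lambda>m. \<zero>\<^bsub>k\<^esub>) = \<zero>\<^bsub>S\<^esub>"
  proof -
    let ?z = "\<lambda>m. \<zero>\<^bsub>k\<^esub>"
    have z: "?z \<in> carrier (poly_alg k ?U)" "?z \<oplus>\<^bsub>poly_alg k ?U\<^esub> ?z = ?z"
      by (simp_all add: poly_alg_def monoid_ring_simps)
    have "h ?z = h ?z \<oplus>\<^bsub>S\<^esub> h ?z"
      using ring_hom_add[OF hom z(1,1)] by (simp only: z(2))
    then show ?thesis
      using ring_hom_closed[OF hom z(1)] S.add.l_cancel_one by metis
  qed
  ultimately show ?thesis using h(1,3) by (intro that[of h]) auto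
qed

section \<open>Generation modulo a prime\<close>

text \<open>The ring homomorphism from the tensor product with the \<open>p\<close>-adic integers onto the quotient of
  \<open>R\<close> by \<open>p\<close> carries polynomial generators to elements whose monomials span each
  homogeneous piece modulo \<open>p\<close>.\<close>

lemma (in graded_cring) monomials_span_mod_prime:
  assumes p: "Factorial_Ring.prime p"
    and Y: "graded_subset (tensor_piece R Rg (padic_int_ring p)) Y"
    and poly: "graded_poly_alg_on (padic_int_ring p) (tensor_ring R (padic_int_ring p))
      (tensor_piece R Rg (padic_int_ring p)) (\<lambda>c. pure_tensor R (padic_int_ring p) \<one> c) Y"
  shows "\<exists>v. (\<forall>n. \<forall>y\<in>Y n. v y \<in> Rg n) \<and> (\<forall>n. \<forall>r\<in>Rg n.
    \<exists>c\<in>zcoeffs (degree_monomials Y n). \<exists>t\<in>Rg n. r = zlin R (mval R v) c \<oplus> int p \<star> t)"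
proof -
  let ?Zp = "padic_int_ring p"
  have p0: "p > 0" using prime_gt_0_nat[OF p] .
  interpret t: cring_pair R ?Zp
    by (intro cring_pair.intro is_cring cring_padic p0)
  have Ydis: "disjoint_family Y" and Ypiece: "\<And>n. Y n \<subseteq> tensor_piece R Rg ?Zp n"
    using Y by (auto simp: graded_subset_def)
  define I where "I = PIdl (int p \<star> \<one>)"
  interpret I: ideal I R
    unfolding I_def by (rule cgenideal_ideal) simp
  define S where "S = R Quot I"
  interpret S: cring S
    unfolding S_def by (rule I.quotient_is_cring[OF is_cring])
  define \<alpha> where "\<alpha> = (+>) I"
  have \<alpha>: "\<alpha> \<in> ring_hom R S"
    unfolding \<alpha>_def S_def by (rule I.rcos_ring_hom)
  note \<alpha>_simps = ring_hom_closed[OF \<alpha>] ring_hom_mult[OF \<alpha>] ring_hom_add[OF \<alpha>]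
    ring_hom_zero[OF \<alpha> ring_axioms S.ring_axioms] ring_hom_one[OF \<alpha>]
  have \<alpha>_eq: "\<exists>s\<in>carrier R. x \<ominus> y = int p \<star> s"
    if "x \<in> carrier R" "y \<in> carrier R" "\<alpha> x = \<alpha> y" for x y
  proof -
    have "x \<ominus> y \<in> I"
      using quotient_eq_iff_same_a_r_cos[OF I.is_ideal that(1,2)] that(3) by (simp add: \<alpha>_def)
    then obtain s where s: "s \<in> carrier R" "x \<ominus> y = s \<otimes> (int p \<star> \<one>)"
      unfolding I_def cgenideal_def by blast
    then show ?thesis by (intro bexI[of _ s]) (simp_all add: add_pow_rdistr_int)
  qed
  \<comment> \<open>The structure map from the integers to \<open>R / p\<close>.\<close>
  define \<gamma> where "\<gamma> j = \<alpha> (j \<star> \<one>)" for j :: int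
  have \<gamma>_closed: "\<gamma> j \<in> carrier S" for j by (simp add: \<gamma>_def \<alpha>_simps)
  have \<gamma>_add: "\<gamma> (i + j) = \<gamma> i \<oplus>\<^bsub>S\<^esub> \<gamma> j" for i j
    by (simp add: \<gamma>_def \<alpha>_simps add.int_pow_mult)
  have \<gamma>_mult: "\<gamma> (i * j) = \<gamma> i \<otimes>\<^bsub>S\<^esub> \<gamma> j" for i j
    by (simp add: \<gamma>_def ring_hom_mult[OF \<alpha>, symmetric] add_pow_ldistr_int add_pow_rdistr_int
        add.int_pow_pow mult.commute)
  have "int p \<star> \<one> \<in> I" unfolding I_def by (rule cgenideal_self) simp
  then have "\<gamma> (int p) = \<zero>\<^bsub>S\<^esub>"
    unfolding \<gamma>_def \<alpha>_def S_def FactRing_def by (simp add: I.a_rcos_const)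
  then have \<gamma>_mod: "\<gamma> (j mod int p) = \<gamma> j" for j
    using \<gamma>_add[of "int p * (j div int p)" "j mod int p"] \<gamma>_closed
    by (simp add: \<gamma>_mult)
  \<comment> \<open>A \<open>p\<close>-adic integer acts through its residue modulo \<open>p\<close>, which is its term at index \<open>1\<close>.\<close>
  define \<beta> where "\<beta> a = \<gamma> (a 1)" for a :: "nat \<Rightarrow> int"
  have \<beta>: "\<beta> \<in> ring_hom ?Zp S"
  proof (rule ring_hom_memI)
    show "\<beta> \<one>\<^bsub>?Zp\<^esub> = \<one>\<^bsub>S\<^esub>"
      using \<gamma>_mod[of 1] by (simp add: \<beta>_def padic_simps \<gamma>_def \<alpha>_simps)
  qed (simp_all add: \<beta>_def padic_simps(2,3) \<gamma>_closed \<gamma>_mod \<gamma>_add \<gamma>_mult)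
  obtain F where F: "F \<in> ring_hom t.T S"
    and F_pure: "\<And>r a. r \<in> carrier R \<Longrightarrow> a \<in> carrier ?Zp \<Longrightarrow> F (pure_tensor R ?Zp r a) = \<alpha> r \<otimes>\<^bsub>S\<^esub> \<beta> a"
    using t.tensor_universal[OF S.is_cring \<alpha> \<beta>] by blast
  note F_simps = ring_hom_closed[OF F] ring_hom_mult[OF F] ring_hom_add[OF F]
    ring_hom_zero[OF F t.T.ring_axioms S.ring_axioms]
  have \<gamma>_scale: "\<gamma> j \<otimes>\<^bsub>S\<^esub> \<alpha> r = \<alpha> (j \<star> r)" if "r \<in> carrier R" for j r
    using that by (simp add: \<gamma>_def ring_hom_mult[OF \<alpha>, symmetric] add_pow_ldistr_int)
  \<comment> \<open>Homogeneous elements of the tensor product have homogeneous representatives in \<open>R\<close>.\<close>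
  have lift: "\<exists>r\<in>Rg n. F x = \<alpha> r" if x: "x \<in> tensor_piece R Rg ?Zp n" for n x
  proof -
    let ?H = "{x \<in> carrier t.T. \<exists>r\<in>Rg n. F x = \<alpha> r}"
    have "additive_subgroup ?H t.T"
    proof (rule t.T.additive_subgroup_criterion)
      show "\<zero>\<^bsub>t.T\<^esub> \<in> ?H"
        using piece_zero[of n] \<alpha>_simps(4) F_simps(4) by auto
    next
      fix x y assume "x \<in> ?H" "y \<in> ?H"
      then obtain r s where "x \<in> carrier t.T" "y \<in> carrier t.T" "r \<in> Rg n" "s \<in> Rg n"
        "F x = \<alpha> r" "F y = \<alpha> s" by blast
      then show "x \<oplus>\<^bsub>t.T\<^esub> y \<in> ?H"
        using piece_add[of r n s] piece_closed by (auto simp: F_simps \<alpha>_simps intro!: bexI[of _ "r \<oplus> s"])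
    next
      fix x assume "x \<in> ?H"
      then obtain r where r: "x \<in> carrier t.T" "r \<in> Rg n" "F x = \<alpha> r" by blast
      have "F ((-1) \<star>\<^bsub>t.T\<^esub> x) = \<alpha> ((-1) \<star> r)"
        using r piece_closed
        by (simp add: ring_hom_int_mult[OF t.T.ring_axioms S.ring_axioms F]
            ring_hom_int_mult[OF ring_axioms S.ring_axioms \<alpha>])
      then show "(-1) \<star>\<^bsub>t.T\<^esub> x \<in> ?H"
        using r(1) piece_int_mult[OF r(2)] by auto
    qed auto
    moreover have "pure_tensor R ?Zp r a \<in> ?H" if r: "r \<in> Rg n" and a: "a \<in> carrier ?Zp" for r a
    proof -
      have "F (pure_tensor R ?Zp r a) = \<alpha> (a 1 \<star> r)"
        using r a piece_closed \<gamma>_closed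
        by (simp add: F_pure \<beta>_def \<gamma>_scale[symmetric] S.m_comm \<alpha>_simps)
      then show ?thesis
        using t.pure_closed[OF piece_closed[OF r] a] piece_int_mult[OF r] by blast
    qed
    ultimately have "tensor_piece R Rg ?Zp n \<subseteq> ?H"
      by (rule t.tensor_piece_subset)
    then show ?thesis using x by blast
  qed
  have "\<exists>r\<in>Rg (gen_degree Y y). F y = \<alpha> r" if "y \<in> (\<Union>i. Y i)" for y
    using that lift Ypiece gen_degree_eq[OF Ydis] by blast
  then obtain v where v0: "\<And>y. y \<in> (\<Union>i. Y i) \<Longrightarrow> v y \<in> Rg (gen_degree Y y) \<and> F y = \<alpha> (v y)"
    by metis
  have v: "v y \<in> Rg n" if "y \<in> Y n" for n y
    using v0[of y] that gen_degree_eq[OF Ydis that] by auto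
  have Ycarrier: "(\<Union>i. Y i) \<subseteq> carrier t.T"
    using Ypiece t.tensor_piece_carrier[of Rg] piece_closed by blast
  obtain h where h: "h \<in> ring_iso (poly_alg ?Zp (\<Union>i. Y i)) t.T"
    "\<And>n. h ` poly_alg_piece ?Zp Y n = tensor_piece R Rg ?Zp n"
    "h (\<lambda>m. \<zero>\<^bsub>?Zp\<^esub>) = \<zero>\<^bsub>t.T\<^esub>"
    "\<And>m c. set_mset m \<subseteq> (\<Union>i. Y i) \<Longrightarrow> c \<in> carrier ?Zp \<Longrightarrow>
      h (mr_single ?Zp m c) = pure_tensor R ?Zp \<one> c \<otimes>\<^bsub>t.T\<^esub> mval t.T (\<lambda>y. y) m"
    using graded_poly_alg_onE[OF poly t.A.is_cring t.T.is_cring Ycarrier] by metis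
  have hom: "h \<in> ring_hom (poly_alg ?Zp (\<Union>i. Y i)) t.T"
    using h(1) by (simp add: ring_iso_def)
  have mval_closed': "mval R v m \<in> carrier R" if "set_mset m \<subseteq> (\<Union>i. Y i)" for m
    using that v0 piece_closed by (intro mval_closed) blast
  have dm: "set_mset m \<subseteq> (\<Union>i. Y i)" if "m \<in> degree_monomials Y n" for m n
    using that by (simp add: degree_monomials_def)
  have F_single: "F (h (mr_single ?Zp m c)) = \<alpha> (c 1 \<star> mval R v m)"
    if m: "set_mset m \<subseteq> (\<Union>i. Y i)" and c: "c \<in> carrier ?Zp" for m c
  proof -
    have "mval t.T (\<lambda>y. y) m \<in> carrier t.T"
      using m Ycarrier by (intro t.T.mval_closed) auto
    moreover have "F (mval t.T (\<lambda>y. y) m) = mval S F m"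
      using m Ycarrier by (intro t.T.ring_hom_mval[OF S.is_cring F]) auto
    moreover have "mval S F m = mval S (\<lambda>y. \<alpha> (v y)) m"
      using m v0 piece_closed by (intro S.mval_cong) (auto intro!: \<alpha>_simps(1) dest!: subsetD)
    moreover have "mval S (\<lambda>y. \<alpha> (v y)) m = \<alpha> (mval R v m)"
      using m v0 piece_closed by (intro ring_hom_mval[OF S.is_cring \<alpha>, symmetric]) blast
    moreover have "F (pure_tensor R ?Zp \<one> c) = \<gamma> (c 1)"
      using c \<gamma>_closed by (simp add: F_pure \<alpha>_simps \<beta>_def)
    ultimately show ?thesis
      using m c by (simp add: h(4) F_simps t.pure_closed \<gamma>_scale mval_closed')
  qed
  have image: "\<exists>c\<in>zcoeffs (degree_monomials Y n). F (h f) = \<alpha> (zlin R (mval R v) c)"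
    if f: "f \<in> poly_alg_piece ?Zp Y n" for f n
  proof -
    have f': "f \<in> carrier (monoid_ring ?Zp (monomials (\<Union>i. Y i)))"
      "{m. f m \<noteq> \<zero>\<^bsub>?Zp\<^esub>} \<subseteq> degree_monomials Y n"
      using f unfolding poly_alg_piece_support poly_alg_def by blast+
    have w: "mval R v \<in> degree_monomials Y n \<rightarrow> carrier R"
      using mval_closed' dm by blast
    show ?thesis
      using f'
    proof (induction f rule: t.A.monoid_ring_induct)
      case zero
      show ?case
        by (rule bexI[OF _ zcoeffs_zero]) (simp add: h(3) F_simps zlin_zero \<alpha>_simps)
    next
      case (add m c g)
      then obtain e where e: "e \<in> zcoeffs (degree_monomials Y n)" "F (h g) = \<alpha> (zlin R (mval R v) e)"
        by blast
      have sc: "mr_single ?Zp m c \<in> carrier (poly_alg ?Zp (\<Union>i. Y i))"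
        using add(2,3) unfolding poly_alg_def by (intro t.A.mr_single_closed)
      have gc: "g \<in> carrier (poly_alg ?Zp (\<Union>i. Y i))"
        using add(4) by (simp add: poly_alg_def)
      have s: "mr_single \<Z> m (c 1) \<in> zcoeffs (degree_monomials Y n)"
        by (rule zcoeffs_single) fact
      have mU: "set_mset m \<subseteq> (\<Union>i. Y i)" using add(1) dm by blast
      have "F (h (mr_single ?Zp m c \<oplus>\<^bsub>monoid_ring ?Zp (monomials (\<Union>i. Y i))\<^esub> g))
          = F (h (mr_single ?Zp m c)) \<oplus>\<^bsub>S\<^esub> F (h g)"
        using ring_hom_add[OF hom sc gc] ring_hom_closed[OF hom sc] ring_hom_closed[OF hom gc]
        by (simp add: poly_alg_def F_simps)
      also have "\<dots> = \<alpha> (zlin R (mval R v) (mr_single \<Z> m (c 1)) \<oplus> zlin R (mval R v) e)"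
        using F_single[OF mU add(3)] e(2) zlin_closed[OF e(1) w] mval_closed'[OF mU]
        by (simp add: zlin_single \<alpha>_simps)
      also have "\<dots> = \<alpha> (zlin R (mval R v) (\<lambda>i. mr_single \<Z> m (c 1) i + e i))"
        by (simp only: zlin_add[OF s e(1) w])
      finally show ?case using zcoeffs_add[OF s e(1)] by blast
    qed
  qed
  have "\<exists>c\<in>zcoeffs (degree_monomials Y n). \<exists>t\<in>Rg n. r = zlin R (mval R v) c \<oplus> int p \<star> t"
    if r: "r \<in> Rg n" for n r
  proof -
    have "pure_tensor R ?Zp r \<one>\<^bsub>?Zp\<^esub> \<in> tensor_piece R Rg ?Zp n"
      unfolding tensor_piece_def by (rule generate.incl) (use r in blast)
    then obtain f where f: "f \<in> poly_alg_piece ?Zp Y n" "h f = pure_tensor R ?Zp r \<one>\<^bsub>?Zp\<^esub>"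
      using h(2) by (metis imageE)
    have rR: "r \<in> carrier R" using r by (rule piece_closed)
    obtain c where c: "c \<in> zcoeffs (degree_monomials Y n)" "F (h f) = \<alpha> (zlin R (mval R v) c)"
      using image[OF f(1)] by blast
    have "F (h f) = \<alpha> r"
      using rR by (simp add: f(2) F_pure ring_hom_one[OF \<beta>] \<alpha>_simps)
    moreover have z: "zlin R (mval R v) c \<in> Rg n"
      using v by (intro zlin_in_subgroup[OF piece_subgroup c(1)]) (auto intro: mval_degree_monomial[OF Ydis])
    ultimately obtain s where s: "s \<in> carrier R" "r \<ominus> zlin R (mval R v) c = int p \<star> s"
      using \<alpha>_eq[OF rR piece_closed[OF z]] c(2) by auto
    \<comment> \<open>The difference is homogeneous, so \<open>s\<close> may be taken in \<open>Rg n\<close>.\<close>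
    obtain t where t: "t \<in> Rg n" "r \<ominus> zlin R (mval R v) c = int p \<star> t"
      using homogeneous_int_multiple[OF piece_minus[OF r z] s] by blast
    have "r = zlin R (mval R v) c \<oplus> (r \<ominus> zlin R (mval R v) c)"
      using rR piece_closed[OF z] by (simp add: a_minus_def a_lcomm r_neg)
    then show ?thesis using t c(1) by metis
  qed
  then show ?thesis using v by blast
qed

section \<open>Rational independence\<close>

lemma rat_ring_simps [simp]:
  "carrier rat_ring = UNIV" "x \<otimes>\<^bsub>rat_ring\<^esub> y = x * y" "x \<oplus>\<^bsub>rat_ring\<^esub> y = x + y"
  "\<one>\<^bsub>rat_ring\<^esub> = 1" "\<zero>\<^bsub>rat_ring\<^esub> = 0"
  by (simp_all add: ring_of_type_algebra_def)

lemma rat_ring_int_mult: "k \<star>\<^bsub>rat_ring\<^esub> a = of_int k * a"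
proof -
  interpret Q: cring rat_ring by (rule cring_from_type_algebra)
  have step: "(k + 1) \<star>\<^bsub>rat_ring\<^esub> a = k \<star>\<^bsub>rat_ring\<^esub> a + a" for k
    using Q.add.int_pow_mult[of a k 1] by simp
  show ?thesis
  proof (induction k rule: int_induct[where k = 0])
    case base
    then show ?case using Q.int_mult_0[of a] by simp
  next
    case (step1 i)
    then show ?case by (simp only: step of_int_add of_int_1 distrib_right mult_1)
  next
    case (step2 i)
    then show ?case using step[of "i - 1"] by (simp add: algebra_simps)
  qed
qed

lemma (in cring) mval_int_mult:
  assumes "v \<in> set_mset m \<rightarrow> carrier R"
  shows "mval R (\<lambda>y. d y \<star> v y) m = (\<Prod>y\<in>#m. d y) \<star> mval R v m"
  using assms
proof (induction m)
  case (add y m)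
  then have v: "v y \<in> carrier R" "v \<in> set_mset m \<rightarrow> carrier R" by auto
  have "mval R (\<lambda>y. d y \<star> v y) (add_mset y m) = d y \<star> v y \<otimes> (\<Prod>y\<in>#m. d y) \<star> mval R v m"
    using v add.IH by (subst mval_add_mset) auto
  also have "\<dots> = (d y * (\<Prod>y\<in>#m. d y)) \<star> (v y \<otimes> mval R v m)"
    using v(1) mval_closed[OF v(2)]
    by (simp add: add_pow_ldistr_int add_pow_rdistr_int add.int_pow_pow mult.commute)
  finally show ?case using v by (simp add: mval_add_mset)
qed simp

text \<open>After clearing denominators, polynomial generators of the rationalised ring come from elements
  of \<open>R\<close>, whose monomials are then independent over the integers.\<close>

lemma (in graded_cring) monomials_independent_rational:
  assumes Y: "graded_subset (tensor_piece R Rg rat_ring) Y"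
    and poly: "graded_poly_alg_on rat_ring (tensor_ring R rat_ring)
      (tensor_piece R Rg rat_ring) (\<lambda>c. pure_tensor R rat_ring \<one> c) Y"
  shows "\<exists>v. (\<forall>n. \<forall>y\<in>Y n. v y \<in> Rg n) \<and> (\<forall>n. zindep R (mval R v) (degree_monomials Y n))"
proof -
  interpret t: cring_pair R rat_ring
    by (intro cring_pair.intro is_cring cring_from_type_algebra)
  let ?U = "\<Union>i. Y i"
  have Ydis: "disjoint_family Y" and Ypiece: "\<And>n. Y n \<subseteq> tensor_piece R Rg rat_ring n"
    using Y by (auto simp: graded_subset_def)
  have Ycarrier: "?U \<subseteq> carrier t.T"
    using Ypiece t.tensor_piece_carrier[of Rg] piece_closed by blast
  define \<iota> where "\<iota> r = pure_tensor R rat_ring r \<one>\<^bsub>rat_ring\<^esub>" for r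
  have \<iota>: "\<iota> \<in> ring_hom R t.T"
    unfolding \<iota>_def by (rule t.left_hom)
  define \<phi> where "\<phi> = pure_tensor R rat_ring \<one>"
  have \<phi>: "\<phi> \<in> ring_hom rat_ring t.T"
    unfolding \<phi>_def by (rule t.right_hom)
  note \<iota>_simps = ring_hom_closed[OF \<iota>] ring_hom_mult[OF \<iota>] ring_hom_add[OF \<iota>]
    ring_hom_zero[OF \<iota> ring_axioms t.T.ring_axioms]
    ring_hom_int_mult[OF ring_axioms t.T.ring_axioms \<iota>]
  have \<phi>_closed: "\<phi> a \<in> carrier t.T" for a
    by (rule ring_hom_closed[OF \<phi>]) simp
  have \<phi>_int: "\<phi> (of_int k * a) = k \<star>\<^bsub>t.T\<^esub> \<phi> a" for k a
    using ring_hom_int_mult[OF t.A.ring_axioms t.T.ring_axioms \<phi>, of a k]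
    by (simp add: rat_ring_int_mult)
  have \<phi>_one: "\<phi> 1 = \<one>\<^bsub>t.T\<^esub>"
    using ring_hom_one[OF \<phi>] by simp
  \<comment> \<open>A positive multiple of each homogeneous element is the image of a homogeneous element of \<open>R\<close>.\<close>
  have lift: "\<exists>d>0. \<exists>r\<in>Rg n. d \<star>\<^bsub>t.T\<^esub> x = \<iota> r" if x: "x \<in> tensor_piece R Rg rat_ring n" for n x
  proof -
    let ?H = "{x \<in> carrier t.T. \<exists>d>0. \<exists>r\<in>Rg n. d \<star>\<^bsub>t.T\<^esub> x = \<iota> r}"
    have "additive_subgroup ?H t.T"
    proof (rule t.T.additive_subgroup_criterion)
      have "(1::int) \<star>\<^bsub>t.T\<^esub> \<zero>\<^bsub>t.T\<^esub> = \<iota> \<zero>"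
        by (simp add: \<iota>_simps)
      then show "\<zero>\<^bsub>t.T\<^esub> \<in> ?H"
        using piece_zero[of n] zero_less_one by blast
    next
      fix x y assume "x \<in> ?H" "y \<in> ?H"
      then obtain d r e s where dr: "x \<in> carrier t.T" "d > 0" "r \<in> Rg n" "d \<star>\<^bsub>t.T\<^esub> x = \<iota> r"
        and es: "y \<in> carrier t.T" "e > 0" "s \<in> Rg n" "e \<star>\<^bsub>t.T\<^esub> y = \<iota> s" by blast
      have "(d * e) \<star>\<^bsub>t.T\<^esub> (x \<oplus>\<^bsub>t.T\<^esub> y) = e \<star>\<^bsub>t.T\<^esub> (d \<star>\<^bsub>t.T\<^esub> x) \<oplus>\<^bsub>t.T\<^esub> d \<star>\<^bsub>t.T\<^esub> (e \<star>\<^bsub>t.T\<^esub> y)"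
        using dr(1) es(1) by (simp add: t.T.add.int_pow_distrib t.T.add.int_pow_pow mult.commute)
      also have "\<dots> = \<iota> (e \<star> r \<oplus> d \<star> s)"
        using dr(3) es(3) piece_closed by (simp add: dr(4) es(4) \<iota>_simps)
      finally show "x \<oplus>\<^bsub>t.T\<^esub> y \<in> ?H"
        using dr es piece_add[OF piece_int_mult[OF dr(3)] piece_int_mult[OF es(3)]]
          mult_pos_pos[of d e] t.T.a_closed by blast
    next
      fix x assume "x \<in> ?H"
      then obtain d r where dr: "x \<in> carrier t.T" "d > 0" "r \<in> Rg n" "d \<star>\<^bsub>t.T\<^esub> x = \<iota> r" by blast
      have "d \<star>\<^bsub>t.T\<^esub> ((-1) \<star>\<^bsub>t.T\<^esub> x) = (-1) \<star>\<^bsub>t.T\<^esub> (d \<star>\<^bsub>t.T\<^esub> x)"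
        using dr(1) by (simp add: t.T.add.int_pow_pow)
      also have "\<dots> = \<iota> ((-1) \<star> r)"
        using dr(3) piece_closed by (simp add: dr(4) \<iota>_simps)
      finally show "(-1) \<star>\<^bsub>t.T\<^esub> x \<in> ?H"
        using dr(1,2) piece_int_mult[OF dr(3)] by auto
    qed auto
    moreover have "pure_tensor R rat_ring r a \<in> ?H" if r: "r \<in> Rg n" for r a
    proof -
      obtain j d where jd: "quotient_of a = (j, d)" by (cases "quotient_of a")
      have d: "d > 0" "of_int d * a = of_int j * 1"
        using quotient_of_denom_pos[OF jd] quotient_of_div[OF jd] by auto
      have rR: "r \<in> carrier R" using r by (rule piece_closed)
      have "d \<star>\<^bsub>t.T\<^esub> pure_tensor R rat_ring r a = d \<star>\<^bsub>t.T\<^esub> (\<iota> r \<otimes>\<^bsub>t.T\<^esub> \<phi> a)"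
        using t.pure_split[OF rR, of a] by (simp add: \<iota>_def \<phi>_def)
      also have "\<dots> = \<iota> r \<otimes>\<^bsub>t.T\<^esub> \<phi> (of_int d * a)"
        using rR \<phi>_closed by (simp add: \<phi>_int t.T.add_pow_rdistr_int \<iota>_simps)
      also have "\<dots> = \<iota> r \<otimes>\<^bsub>t.T\<^esub> j \<star>\<^bsub>t.T\<^esub> \<one>\<^bsub>t.T\<^esub>"
        by (simp only: d(2) \<phi>_int \<phi>_one)
      also have "\<dots> = \<iota> (j \<star> r)"
        using rR by (simp add: t.T.add_pow_rdistr_int \<iota>_simps)
      finally show ?thesis
        using d(1) piece_int_mult[OF r] t.pure_closed[OF rR, of a] by auto
    qed
    ultimately have "tensor_piece R Rg rat_ring n \<subseteq> ?H"
      by (intro t.tensor_piece_subset) auto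
    then show ?thesis using x by blast
  qed
  have "\<exists>d r. d > 0 \<and> r \<in> Rg (gen_degree Y y) \<and> d \<star>\<^bsub>t.T\<^esub> y = \<iota> r" if "y \<in> ?U" for y
    using that lift Ypiece gen_degree_eq[OF Ydis] by blast
  then obtain d v where dv: "\<And>y. y \<in> ?U \<Longrightarrow> d y > 0"
      "\<And>y. y \<in> ?U \<Longrightarrow> v y \<in> Rg (gen_degree Y y)" "\<And>y. y \<in> ?U \<Longrightarrow> \<iota> (v y) = d y \<star>\<^bsub>t.T\<^esub> y"
    by metis
  have v: "v y \<in> Rg n" if "y \<in> Y n" for n y
    using dv(2)[of y] that gen_degree_eq[OF Ydis that] by auto
  have vU: "v \<in> ?U \<rightarrow> carrier R"
    using dv(2) piece_closed by blast
  \<comment> \<open>The denominator cleared from a monomial is the product of those of its factors.\<close>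
  define D where "D m = (\<Prod>y\<in>#m. d y)" for m
  have D_pos: "D m > 0" if "set_mset m \<subseteq> ?U" for m
    using that unfolding D_def by (induction m) (auto simp: dv(1))
  have mval_v: "mval R v m \<in> carrier R" if "set_mset m \<subseteq> ?U" for m
    using that vU by (intro mval_closed) auto
  have mval_T: "mval t.T (\<lambda>y. y) m \<in> carrier t.T" if "set_mset m \<subseteq> ?U" for m
    using that Ycarrier by (intro t.T.mval_closed) auto
  have \<iota>_mval: "\<iota> (mval R v m) = D m \<star>\<^bsub>t.T\<^esub> mval t.T (\<lambda>y. y) m" if m: "set_mset m \<subseteq> ?U" for m
  proof -
    have "\<iota> (mval R v m) = mval t.T (\<lambda>y. \<iota> (v y)) m"
      using m vU by (intro ring_hom_mval[OF t.T.is_cring \<iota>]) auto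
    also have "\<dots> = mval t.T (\<lambda>y. d y \<star>\<^bsub>t.T\<^esub> y) m"
      using m Ycarrier by (intro t.T.mval_cong) (auto simp: dv(3) subset_iff)
    also have "\<dots> = D m \<star>\<^bsub>t.T\<^esub> mval t.T (\<lambda>y. y) m"
      unfolding D_def using m Ycarrier by (intro t.T.mval_int_mult) auto
    finally show ?thesis .
  qed
  obtain h where h: "h \<in> ring_iso (poly_alg rat_ring ?U) t.T"
    "h (\<lambda>m. \<zero>\<^bsub>rat_ring\<^esub>) = \<zero>\<^bsub>t.T\<^esub>"
    "\<And>m c. set_mset m \<subseteq> ?U \<Longrightarrow> c \<in> carrier rat_ring \<Longrightarrow>
      h (mr_single rat_ring m c) = pure_tensor R rat_ring \<one> c \<otimes>\<^bsub>t.T\<^esub> mval t.T (\<lambda>y. y) m"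
    using graded_poly_alg_onE[OF poly t.A.is_cring t.T.is_cring Ycarrier] by metis
  have hom: "h \<in> ring_hom (poly_alg rat_ring ?U) t.T"
    and inj: "inj_on h (carrier (poly_alg rat_ring ?U))"
    using h(1) by (simp_all add: ring_iso_def bij_betw_def)
  let ?M = "monomials ?U"
  define q where "q c m = (of_int (c m * D m) :: rat)" for c m
  have q_closed: "q c \<in> carrier (poly_alg rat_ring ?U)" if c: "c \<in> carrier (monoid_ring \<Z> ?M)" for c
  proof -
    have "finite {m. q c m \<noteq> 0}"
      by (rule finite_subset[of _ "{m. c m \<noteq> 0}"]) (use c in \<open>auto simp: q_def monoid_ring_simps\<close>)
    then show ?thesis
      using c by (simp add: poly_alg_def monoid_ring_simps q_def)
  qed
  have w: "mval R v \<in> carrier ?M \<rightarrow> carrier R"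
    using mval_v by auto
  \<comment> \<open>An integral relation between the values of monomials becomes a rational polynomial, with
    each coefficient multiplied by the cleared denominator.\<close>
  have transfer: "\<iota> (zlin R (mval R v) c) = h (q c)" if c: "c \<in> carrier (monoid_ring \<Z> ?M)" for c
    using c subset_UNIV
  proof (induction c rule: int.monoid_ring_induct)
    case zero
    have "q (\<lambda>m. 0) = (\<lambda>m. \<zero>\<^bsub>rat_ring\<^esub>)" by (simp add: q_def fun_eq_iff)
    then show ?case using h(2) by (simp only: zlin_zero \<iota>_simps(4))
  next
    case (add m k g)
    let ?s = "mr_single rat_ring m (of_int (k * D m))"
    have m: "set_mset m \<subseteq> ?U" using add(2) by simp
    have sZ: "mr_single \<Z> m k \<in> zcoeffs (carrier ?M)" by (rule zcoeffs_single) fact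
    have gZ: "g \<in> zcoeffs (carrier ?M)" using add(4) by (simp only: carrier_monoid_ring_Z)
    have s: "?s \<in> carrier (poly_alg rat_ring ?U)"
      unfolding poly_alg_def by (rule t.A.mr_single_closed) (use add(2) in simp_all)
    have "\<iota> (zlin R (mval R v) (mr_single \<Z> m k \<oplus>\<^bsub>monoid_ring \<Z> ?M\<^esub> g))
        = \<iota> (zlin R (mval R v) (mr_single \<Z> m k) \<oplus> zlin R (mval R v) g)"
      by (simp add: monoid_ring_simps(5) zlin_add[OF sZ gZ w])
    also have "\<dots> = k \<star>\<^bsub>t.T\<^esub> (D m \<star>\<^bsub>t.T\<^esub> mval t.T (\<lambda>y. y) m) \<oplus>\<^bsub>t.T\<^esub> h (q g)"
      using zlin_closed[OF gZ w] mval_v[OF m]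
      by (simp add: zlin_single \<iota>_simps \<iota>_mval[OF m] add.IH)
    also have "k \<star>\<^bsub>t.T\<^esub> (D m \<star>\<^bsub>t.T\<^esub> mval t.T (\<lambda>y. y) m) = h ?s"
    proof -
      have "h ?s = \<phi> (of_int (k * D m) * 1) \<otimes>\<^bsub>t.T\<^esub> mval t.T (\<lambda>y. y) m"
        using h(3)[OF m] by (simp add: \<phi>_def)
      also have "\<dots> = (k * D m) \<star>\<^bsub>t.T\<^esub> mval t.T (\<lambda>y. y) m"
        using mval_T[OF m] by (simp only: \<phi>_int \<phi>_one t.T.add_pow_ldistr_int t.T.one_closed t.T.l_one)
      finally show ?thesis
        using mval_T[OF m] by (simp add: t.T.add.int_pow_pow mult.commute)
    qed
    also have "h ?s \<oplus>\<^bsub>t.T\<^esub> h (q g) = h (?s \<oplus>\<^bsub>poly_alg rat_ring ?U\<^esub> q g)"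
      by (rule ring_hom_add[OF hom s q_closed[OF add(4)], symmetric])
    also have "?s \<oplus>\<^bsub>poly_alg rat_ring ?U\<^esub> q g = q (mr_single \<Z> m k \<oplus>\<^bsub>monoid_ring \<Z> ?M\<^esub> g)"
      by (auto simp: poly_alg_def monoid_ring_simps q_def mr_single_def fun_eq_iff distrib_right)
    finally show ?case .
  qed
  have "zindep R (mval R v) (degree_monomials Y n)" for n
    unfolding zindep_def
  proof (intro ballI impI)
    fix c m assume c: "c \<in> zcoeffs (degree_monomials Y n)" "zlin R (mval R v) c = \<zero>"
      and m: "m \<in> degree_monomials Y n"
    have "c \<in> zcoeffs (carrier ?M)"
      using c(1) unfolding zcoeffs_def degree_monomials_def by auto
    then have cM: "c \<in> carrier (monoid_ring \<Z> ?M)" by (simp only: carrier_monoid_ring_Z)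
    have "h (q c) = h (\<lambda>m. \<zero>\<^bsub>rat_ring\<^esub>)"
      using transfer[OF cM] c(2) h(2) \<iota>_simps(4) by simp
    moreover have "(\<lambda>m. \<zero>\<^bsub>rat_ring\<^esub>) \<in> carrier (poly_alg rat_ring ?U)"
      by (simp add: poly_alg_def monoid_ring_simps)
    ultimately have "q c = (\<lambda>m. \<zero>\<^bsub>rat_ring\<^esub>)"
      using inj q_closed[OF cM] by (simp only: inj_on_eq_iff)
    then have "q c m = 0" by simp
    moreover have "D m > 0" using m by (intro D_pos) (simp add: degree_monomials_def)
    ultimately show "c m = 0" by (simp add: q_def)
  qed
  then show ?thesis using v by blast
qed

section \<open>Generators of a free subgroup\<close>

text \<open>The bound on generators, carried over to a free subgroup \<open>H\<close> of an abelian group through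
  coordinates. Finiteness modulo \<open>2\<close> forces the basis of \<open>H\<close> to be finite. The conclusion
  expresses that the chosen elements generate \<open>H\<close> modulo \<open>D\<close>.\<close>

lemma (in abelian_group) generators_of_free_subgroup:
  fixes H D :: "'a set" and B :: "'c set"
  assumes H: "additive_subgroup H G" and D: "additive_subgroup D G" "D \<subseteq> H"
    and free: "(add_monoid G)\<lparr>carrier := H\<rparr> \<cong> free_Abelian_group B"
    and fin2: "\<exists>T. finite T \<and> T \<subseteq> H \<and> (\<forall>r\<in>H. \<exists>t\<in>T. \<exists>z\<in>H. r = t \<oplus> 2 \<star> z)"
    and primes: "\<And>p::nat. Factorial_Ring.prime p \<Longrightarrow> \<exists>T. finite T \<and> card T \<le> p ^ N \<and> T \<subseteq> H \<and>
      (\<forall>r\<in>H. \<exists>t\<in>T. \<exists>d\<in>D. \<exists>z\<in>H. r = t \<oplus> d \<oplus> int p \<star> z)"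
  shows "\<exists>C. C \<subseteq> H \<and> finite C \<and> card C \<le> N \<and> \<zero> \<notin> C \<and>
    (\<forall>E. additive_subgroup E G \<longrightarrow> C \<subseteq> E \<longrightarrow> D \<subseteq> E \<longrightarrow> H \<subseteq> E)"
proof -
  have HG: "x \<in> carrier G" if "x \<in> H" for x
    using additive_subgroup.a_subset[OF H] that by blast
  have H_add: "x \<oplus> y \<in> H" if "x \<in> H" "y \<in> H" for x y
    by (rule additive_subgroup.a_closed[OF H that])
  have H_mult: "k \<star> x \<in> H" if "x \<in> H" for k x
    by (rule additive_subgroup_int_mult[OF H that])
  obtain \<psi> where \<psi>: "\<psi> \<in> iso ((add_monoid G)\<lparr>carrier := H\<rparr>) (free_Abelian_group B)"
    using free by (auto simp: is_iso_def)
  define V where "V = {f :: 'c \<Rightarrow>\<^sub>0 int. Poly_Mapping.keys f \<subseteq> B}"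
  have bij: "bij_betw \<psi> H V" and \<psi>_add: "\<And>x y. x \<in> H \<Longrightarrow> y \<in> H \<Longrightarrow> \<psi> (x \<oplus> y) = \<psi> x + \<psi> y"
    using \<psi> by (auto simp: iso_def hom_def V_def free_Abelian_group_def)
  have \<psi>_V: "\<psi> ` H = V" and \<psi>_inj: "inj_on \<psi> H"
    using bij by (auto simp: bij_betw_def)
  have \<psi>_mult: "\<psi> (k \<star> x) = frag_cmul k (\<psi> x)" if x: "x \<in> H" for k x
  proof -
    have step: "\<psi> ((k + 1) \<star> x) = \<psi> (k \<star> x) + \<psi> x" for k
      using \<psi>_add[OF H_mult[OF x, of k] x] HG[OF x] by (simp add: add.int_pow_mult)
    show ?thesis
    proof (induction k rule: int_induct[where k = 0])
      case base
      have "\<psi> \<zero> + \<psi> \<zero> = \<psi> \<zero>"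
        using \<psi>_add[of \<zero> \<zero>] additive_subgroup.zero_closed[OF H] by simp
      then show ?case by simp
    next
      case (step1 i)
      then show ?case by (simp add: step frag_cmul_distrib)
    next
      case (step2 i)
      then show ?case
        using step[of "i - 1"] frag_cmul_distrib[of "i - 1" 1 "\<psi> x"] by simp
    qed
  qed
  interpret F: Modules.module "frag_cmul :: int \<Rightarrow> ('c \<Rightarrow>\<^sub>0 int) \<Rightarrow> _"
    by unfold_locales (simp_all add: frag_cmul_distrib frag_cmul_distrib2)
  have subspace: "F.subspace (\<psi> ` E)" if E: "additive_subgroup E G" "E \<subseteq> H" for E
  proof (rule F.subspaceI)
    show "0 \<in> \<psi> ` E"
      using \<psi>_mult[of \<zero> 0] additive_subgroup.zero_closed[OF E(1)] E(2)
      by (intro image_eqI[of _ _ \<zero>]) auto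
  next
    fix x y assume "x \<in> \<psi> ` E" "y \<in> \<psi> ` E"
    then obtain a b where ab: "a \<in> E" "b \<in> E" "x = \<psi> a" "y = \<psi> b" by blast
    then have "x + y = \<psi> (a \<oplus> b)"
      using E(2) by (simp add: \<psi>_add subset_iff)
    then show "x + y \<in> \<psi> ` E"
      using additive_subgroup.a_closed[OF E(1) ab(1,2)] by blast
  next
    fix c x assume "x \<in> \<psi> ` E"
    then obtain a where a: "a \<in> E" "x = \<psi> a" by blast
    then have "frag_cmul c x = \<psi> (c \<star> a)"
      using E(2) by (simp add: \<psi>_mult subset_iff)
    then show "frag_cmul c x \<in> \<psi> ` E"
      using additive_subgroup_int_mult[OF E(1) a(1)] by blast
  qed
  have "finite B"
  proof -
    obtain T where T: "finite T" "T \<subseteq> H" "\<And>r. r \<in> H \<Longrightarrow> \<exists>t\<in>T. \<exists>z\<in>H. r = t \<oplus> 2 \<star> z"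
      using fin2 by blast
    have "\<exists>t\<in>T. \<exists>f. frag_of b = \<psi> t + frag_cmul 2 f" if "b \<in> B" for b
    proof -
      have "frag_of b \<in> V" using that by (simp add: V_def)
      then obtain r where r: "r \<in> H" "\<psi> r = frag_of b" using \<psi>_V by (metis imageE)
      then obtain t z where tz: "t \<in> T" "z \<in> H" "r = t \<oplus> 2 \<star> z" using T(3) by blast
      then have "frag_of b = \<psi> t + frag_cmul 2 (\<psi> z)"
        using r(2) T(2) \<psi>_add[of t "2 \<star> z"] H_mult[OF tz(2)] \<psi>_mult[OF tz(2)] by auto
      then show ?thesis using tz(1) by blast
    qed
    then obtain t f where tf: "\<And>b. b \<in> B \<Longrightarrow> t b \<in> T \<and> frag_of b = \<psi> (t b) + frag_cmul 2 (f b)"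
      by metis
    \<comment> \<open>Distinct basis elements are not congruent modulo \<open>2\<close>.\<close>
    have "inj_on t B"
    proof (rule inj_onI, rule ccontr)
      fix b b' assume b: "b \<in> B" "b' \<in> B" "t b = t b'" "b \<noteq> b'"
      have "frag_of b - frag_of b' = frag_cmul 2 (f b) - frag_cmul 2 (f b')"
        using tf[OF b(1)] tf[OF b(2)] b(3) by (metis add_diff_cancel_left)
      then have "Poly_Mapping.lookup (frag_of b - frag_of b') b
          = Poly_Mapping.lookup (frag_cmul 2 (f b) - frag_cmul 2 (f b')) b" by (rule arg_cong)
      then have "1 = 2 * (Poly_Mapping.lookup (f b) b - Poly_Mapping.lookup (f b') b)"
        using b(4) by (simp add: lookup_minus)
      then show False by presburger
    qed
    moreover have "t ` B \<subseteq> T" using tf by blast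
    ultimately show ?thesis using T(1) by (meson finite_imageD finite_subset)
  qed
  let ?D = "\<psi> ` D"
  have spanV: "F.span (frag_of ` B \<union> ?D) = V"
  proof
    have "F.subspace V"
      using subspace[OF H order_refl] by (simp add: \<psi>_V)
    moreover have "frag_of ` B \<union> ?D \<subseteq> V"
      using D(2) \<psi>_V by (auto simp: V_def)
    ultimately show "F.span (frag_of ` B \<union> ?D) \<subseteq> V" by (intro F.span_minimal)
    show "V \<subseteq> F.span (frag_of ` B \<union> ?D)"
    proof
      fix f assume "f \<in> V"
      then have "frag_extend frag_of f \<in> F.span (frag_of ` B \<union> ?D)"
        unfolding frag_extend_def V_def
        by (intro F.span_sum F.span_scale F.span_base) auto
      then show "f \<in> F.span (frag_of ` B \<union> ?D)"
        by (simp only: frag_expansion[symmetric])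
    qed
  qed
  have "\<exists>T. finite T \<and> card T \<le> p ^ N \<and> (\<forall>x\<in>F.span (frag_of ` B \<union> ?D).
      \<exists>t\<in>T. \<exists>d\<in>?D. \<exists>z\<in>F.span (frag_of ` B \<union> ?D). x = t + d + frag_cmul (int p) z)"
    if p: "Factorial_Ring.prime p" for p :: nat
  proof -
    obtain T where T: "finite T" "card T \<le> p ^ N" "T \<subseteq> H"
      "\<And>r. r \<in> H \<Longrightarrow> \<exists>t\<in>T. \<exists>d\<in>D. \<exists>z\<in>H. r = t \<oplus> d \<oplus> int p \<star> z"
      using primes[OF p] by blast
    have "\<exists>t\<in>\<psi> ` T. \<exists>d\<in>?D. \<exists>z\<in>V. x = t + d + frag_cmul (int p) z" if "x \<in> V" for x
    proof -
      obtain r where r: "r \<in> H" "x = \<psi> r" using \<open>x \<in> V\<close> \<psi>_V by (metis imageE)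
      obtain t d z where tdz: "t \<in> T" "d \<in> D" "z \<in> H" "r = t \<oplus> d \<oplus> int p \<star> z"
        using T(4)[OF r(1)] by blast
      have td: "t \<in> H" "d \<in> H" using tdz T(3) D(2) by auto
      have "x = \<psi> t + \<psi> d + frag_cmul (int p) (\<psi> z)"
        by (simp only: r(2) tdz(4) \<psi>_add H_add td H_mult tdz(3) \<psi>_mult)
      then show ?thesis using tdz \<psi>_V by blast
    qed
    then show ?thesis
      using T(1,2) card_image_le[OF T(1), of \<psi>] unfolding spanV
      by (intro exI[of _ "\<psi> ` T"]) auto
  qed
  then obtain C' where C': "finite C'" "card C' \<le> N" "F.span (C' \<union> ?D) = V"
    using generators_from_prime_counts[OF F.module_axioms subspace[OF D] finite_imageI[OF \<open>finite B\<close>],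
        of N frag_of] unfolding spanV by blast
  \<comment> \<open>Zero is removed because the sets chosen in different degrees have to be disjoint.\<close>
  define C where "C = {x \<in> H. \<psi> x \<in> C' \<and> x \<noteq> \<zero>}"
  have inj: "inj_on \<psi> C" and maps: "\<psi> ` C \<subseteq> C'"
    using \<psi>_inj by (auto simp: C_def inj_on_def)
  have "finite C" using inj maps C'(1) by (meson finite_imageD finite_subset)
  moreover have "card C \<le> N"
    using card_inj_on_le[OF inj maps C'(1)] C'(2) by simp
  moreover have "H \<subseteq> E" if E: "additive_subgroup E G" "C \<subseteq> E" "D \<subseteq> E" for E
  proof -
    have EH: "additive_subgroup (E \<inter> H) G"
      using E(1) H by (intro additive_subgroup_criterion)
        (auto intro: HG additive_subgroup.zero_closed additive_subgroup.a_closed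
          additive_subgroup_int_mult)
    have "C' \<union> ?D \<subseteq> \<psi> ` (E \<inter> H)"
    proof
      fix f assume f: "f \<in> C' \<union> ?D"
      then have "f \<in> F.span (C' \<union> ?D)" by (rule F.span_base)
      then have "f \<in> V" by (simp only: C'(3))
      then obtain x where x: "x \<in> H" "f = \<psi> x" using \<psi>_V by (metis imageE)
      have "x \<in> E"
      proof (cases "f \<in> ?D")
        case True
        then obtain d where "d \<in> D" "\<psi> d = \<psi> x" using x(2) by auto
        then have "x = d" using \<psi>_inj x(1) D(2) by (auto dest: inj_onD)
        then show ?thesis using \<open>d \<in> D\<close> E(3) by blast
      next
        case False
        then have "\<psi> x \<in> C'" using f x by blast
        then show ?thesis
          using x(1) E(2) additive_subgroup.zero_closed[OF E(1)] by (cases "x = \<zero>") (auto simp: C_def)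
      qed
      then show "f \<in> \<psi> ` (E \<inter> H)" using x by blast
    qed
    then have "F.span (C' \<union> ?D) \<subseteq> \<psi> ` (E \<inter> H)"
      by (rule F.span_minimal[OF _ subspace[OF EH]]) simp
    then have "V \<subseteq> \<psi> ` (E \<inter> H)" by (simp only: C'(3))
    show ?thesis
    proof
      fix x assume "x \<in> H"
      then obtain e where "e \<in> E \<inter> H" "\<psi> x = \<psi> e"
        using \<open>V \<subseteq> \<psi> ` (E \<inter> H)\<close> \<psi>_V by blast
      then show "x \<in> E" using \<psi>_inj \<open>x \<in> H\<close> by (auto dest: inj_onD)
    qed
  qed
  ultimately show ?thesis
    by (intro exI[of _ C]) (auto simp: C_def)
qed

section \<open>Integral polynomial generators\<close>

lemma zcoeffs_mono: "c \<in> zcoeffs I \<Longrightarrow> I \<subseteq> J \<Longrightarrow> c \<in> zcoeffs J"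
  by (auto simp: zcoeffs_def)

lemma zcoeffs_restrict:
  assumes "c \<in> zcoeffs I"
  shows "(\<lambda>i. if Q i then c i else 0) \<in> zcoeffs {i \<in> I. Q i}"
proof -
  have "finite {i. (if Q i then c i else 0) \<noteq> 0}"
    by (rule finite_subset[of _ "{i. c i \<noteq> 0}"]) (use assms in \<open>auto simp: zcoeffs_def\<close>)
  then show ?thesis
    using assms by (auto simp: zcoeffs_def)
qed

lemma degree_monomials_add:
  "a \<in> degree_monomials Y i \<Longrightarrow> b \<in> degree_monomials Y j \<Longrightarrow> a + b \<in> degree_monomials Y (i + j)"
  by (auto simp: degree_monomials_def)

text \<open>Modulo \<open>p\<close>, the coefficients of a combination may be reduced to residues, of which there are
  finitely many choices.\<close>

lemma (in abelian_group) zlin_residues: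
  assumes "finite M" "p > 0" "w \<in> M \<rightarrow> carrier G"
  shows "\<exists>T. finite T \<and> card T \<le> p ^ card M \<and> T \<subseteq> zlin G w ` zcoeffs M \<and>
    (\<forall>c\<in>zcoeffs M. \<exists>t\<in>T. \<exists>e\<in>zcoeffs M. zlin G w c = t \<oplus> int p \<star> zlin G w e)"
proof -
  let ?F = "PiE M (\<lambda>_. {0..<int p})"
  define pad where "pad f i = (if i \<in> M then f i else (0::int))" for f i
  have pad: "pad f \<in> zcoeffs M" for f
    using assms(1) by (auto simp: zcoeffs_def pad_def)
  let ?T = "(\<lambda>f. zlin G w (pad f)) ` ?F"
  have fin: "finite ?F" by (rule finite_PiE) (simp_all add: assms(1))
  have "card ?T \<le> card ?F" by (rule card_image_le[OF fin])
  also have "card ?F = p ^ card M" using assms(1) by (simp add: card_PiE)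
  finally have "card ?T \<le> p ^ card M" .
  moreover have "\<exists>t\<in>?T. \<exists>e\<in>zcoeffs M. zlin G w c = t \<oplus> int p \<star> zlin G w e"
    if c: "c \<in> zcoeffs M" for c
  proof -
    define f where "f = (\<lambda>i\<in>M. c i mod int p)"
    define e where "e = pad (\<lambda>i. c i div int p)"
    have "f \<in> ?F" using assms(2) by (auto simp: f_def)
    moreover have e: "e \<in> zcoeffs M" unfolding e_def by (rule pad)
    moreover have "c i = pad f i + int p * e i" for i
      using c by (auto simp: pad_def f_def e_def zcoeffs_def)
    then have "zlin G w c = zlin G w (\<lambda>i. pad f i + int p * e i)" by presburger
    then have "zlin G w c = zlin G w (pad f) \<oplus> int p \<star> zlin G w e"
      by (simp only: zlin_add[OF pad zcoeffs_scale[OF e] assms(3)] zlin_scale[OF e assms(3)])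
    ultimately show ?thesis by blast
  qed
  moreover have "finite ?T" using fin by simp
  moreover have "?T \<subseteq> zlin G w ` zcoeffs M" using pad by blast
  ultimately show ?thesis by blast
qed

context graded_cring
begin

text \<open>The decomposable elements of degree \<open>n\<close>. The unit is included in degree \<open>0\<close>, so that there,
  as in every positive degree, generators are needed only modulo elements that monomials of smaller
  generators already produce.\<close>

definition decomposables :: "nat \<Rightarrow> 'a set" where
  "decomposables n = generate (add_monoid R)
    ({x \<otimes> y | x y i j. x \<in> Rg i \<and> y \<in> Rg j \<and> 1 \<le> i \<and> 1 \<le> j \<and> i + j = n} \<union> (if n = 0 then {\<one>} else {}))"

lemma decomposables_minimal:
  assumes "additive_subgroup E R"
    and "\<And>x y i j. x \<in> Rg i \<Longrightarrow> y \<in> Rg j \<Longrightarrow> 1 \<le> i \<Longrightarrow> 1 \<le> j \<Longrightarrow> i + j = n \<Longrightarrow> x \<otimes> y \<in> E"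
    and "n = 0 \<Longrightarrow> \<one> \<in> E"
  shows "decomposables n \<subseteq> E"
  unfolding decomposables_def
  by (rule add.generate_subgroup_incl)
    (use assms(2,3) additive_subgroup.a_subgroup[OF assms(1)] in auto)

lemma decomposables_subset: "decomposables n \<subseteq> Rg n"
  by (rule decomposables_minimal[OF piece_subgroup]) (use mult_in_piece one_in_piece in auto)

lemma decomposables_subgroup: "additive_subgroup (decomposables n) R"
  unfolding decomposables_def
proof (rule additive_subgroupI, rule add.generate_is_subgroup)
  show "{x \<otimes> y | x y i j. x \<in> Rg i \<and> y \<in> Rg j \<and> 1 \<le> i \<and> 1 \<le> j \<and> i + j = n}
    \<union> (if n = 0 then {\<one>} else {}) \<subseteq> carrier R"
    using piece_closed by auto
qed

text \<open>Such a monomial is either empty, in degree \<open>0\<close>, or has at least two factors of positive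
  degree.\<close>

lemma mval_decomposable:
  assumes Y: "disjoint_family Y" "Y 0 = {}" and v: "\<And>n y. y \<in> Y n \<Longrightarrow> v y \<in> Rg n"
    and m: "m \<in> degree_monomials Y n" "\<not> (\<exists>y\<in>Y n. m = {#y#})"
  shows "mval R v m \<in> decomposables n"
proof (cases m)
  case empty
  then have "n = 0" using m(1) by (simp add: degree_monomials_def)
  then show ?thesis
    using empty unfolding decomposables_def by (auto intro: generate.incl)
next
  case (add y m')
  have U: "set_mset m \<subseteq> (\<Union>i. Y i)" and n: "(\<Sum>y\<in>#m. gen_degree Y y) = n"
    using m(1) by (auto simp: degree_monomials_def)
  have pos: "1 \<le> gen_degree Y z" "v z \<in> Rg (gen_degree Y z)" if "z \<in># m" for z
  proof -
    have "z \<in> (\<Union>i. Y i)" using U that by (rule subsetD)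
    then obtain i where i: "z \<in> Y i" by (rule UN_E)
    then show "v z \<in> Rg (gen_degree Y z)" using v gen_degree_eq[OF Y(1) i] by simp
    show "1 \<le> gen_degree Y z" using i gen_degree_eq[OF Y(1) i] Y(2) by (cases i) auto
  qed
  have y: "y \<in># m" and m'm: "\<And>z. z \<in># m' \<Longrightarrow> z \<in># m" using add by auto
  have "m' \<noteq> {#}"
  proof
    assume "m' = {#}"
    then have sy: "m = {#y#}" using add by simp
    have "y \<in> (\<Union>i. Y i)" using U y by (rule subsetD)
    then obtain i where i: "y \<in> Y i" by (rule UN_E)
    then have "i = n" using n gen_degree_eq[OF Y(1) i] by (simp add: sy)
    then show False using m(2) sy i by blast
  qed
  then obtain z m'' where z: "m' = add_mset z m''" by (cases m') auto
  have deg': "1 \<le> (\<Sum>y\<in>#m'. gen_degree Y y)"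
    using pos(1)[OF m'm, of z] by (simp add: z)
  have "mval R v m' \<in> Rg (\<Sum>y\<in>#m'. gen_degree Y y)"
    by (rule mval_in_piece) (rule pos(2)[OF m'm])
  moreover have "gen_degree Y y + (\<Sum>y\<in>#m'. gen_degree Y y) = n"
    using n by (simp add: add)
  moreover have "mval R v m = v y \<otimes> mval R v m'"
    unfolding add by (rule mval_add_mset) (use pos(2) y m'm piece_closed in blast)+
  ultimately show ?thesis
    using pos[OF y] deg' unfolding decomposables_def by (intro generate.incl) blast
qed

text \<open>The two finiteness conditions under which a homogeneous piece is generated, modulo
  decomposables, by few elements: both are read off from the spanning monomials modulo a prime. In
  the second, monomials other than single generators are decomposable.\<close>

lemma piece_counts_mod_prime:
  assumes p: "p > 0" and Y: "disjoint_family Y" "\<And>n. finite (Y n)" "Y 0 = {}"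
    and v: "\<And>n y. y \<in> Y n \<Longrightarrow> v y \<in> Rg n"
    and span: "\<And>r. r \<in> Rg n \<Longrightarrow>
      \<exists>c\<in>zcoeffs (degree_monomials Y n). \<exists>t\<in>Rg n. r = zlin R (mval R v) c \<oplus> int p \<star> t"
  shows "\<exists>T. finite T \<and> T \<subseteq> Rg n \<and> (\<forall>r\<in>Rg n. \<exists>t\<in>T. \<exists>z\<in>Rg n. r = t \<oplus> int p \<star> z)"
    and "\<exists>T. finite T \<and> card T \<le> p ^ card (Y n) \<and> T \<subseteq> Rg n \<and>
      (\<forall>r\<in>Rg n. \<exists>t\<in>T. \<exists>d\<in>decomposables n. \<exists>z\<in>Rg n. r = t \<oplus> d \<oplus> int p \<star> z)"
proof -
  let ?M = "degree_monomials Y n" and ?w = "mval R v"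
  let ?S = "(\<lambda>y. {#y#}) ` Y n"
  have finM: "finite ?M" by (rule finite_degree_monomials[OF Y])
  have w: "?w \<in> ?M \<rightarrow> Rg n"
    by (rule Pi_I, rule mval_degree_monomial[OF Y(1)], rule v, assumption+)
  then have wR: "?w \<in> ?M \<rightarrow> carrier R" using piece_closed by blast
  have SM: "?S \<subseteq> ?M"
    using gen_degree_eq[OF Y(1)] by (auto simp: degree_monomials_def)
  have wS: "?w \<in> ?S \<rightarrow> Rg n" "?w \<in> ?S \<rightarrow> carrier R" using w wR SM by blast+
  have in_piece: "zlin R ?w c \<in> Rg n" if "c \<in> zcoeffs ?M" for c
    by (rule zlin_in_subgroup[OF piece_subgroup that w])
  have in_piece_S: "zlin R ?w c \<in> Rg n" if "c \<in> zcoeffs ?S" for c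
    by (rule zlin_in_subgroup[OF piece_subgroup that wS(1)])
  show "\<exists>T. finite T \<and> T \<subseteq> Rg n \<and> (\<forall>r\<in>Rg n. \<exists>t\<in>T. \<exists>z\<in>Rg n. r = t \<oplus> int p \<star> z)"
  proof -
    obtain T where T: "finite T" "T \<subseteq> zlin R ?w ` zcoeffs ?M"
      "\<And>c. c \<in> zcoeffs ?M \<Longrightarrow> \<exists>t\<in>T. \<exists>e\<in>zcoeffs ?M. zlin R ?w c = t \<oplus> int p \<star> zlin R ?w e"
      using zlin_residues[OF finM p wR] by blast
    have TR: "T \<subseteq> Rg n" using T(2) in_piece by blast
    have "\<exists>t\<in>T. \<exists>z\<in>Rg n. r = t \<oplus> int p \<star> z" if r: "r \<in> Rg n" for r
    proof -
      obtain c s where c: "c \<in> zcoeffs ?M" "s \<in> Rg n" "r = zlin R ?w c \<oplus> int p \<star> s"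
        using span[OF r] by blast
      obtain t e where te: "t \<in> T" "e \<in> zcoeffs ?M" "zlin R ?w c = t \<oplus> int p \<star> zlin R ?w e"
        using T(3)[OF c(1)] by blast
      have cl: "t \<in> carrier R" "s \<in> carrier R" "zlin R ?w e \<in> carrier R"
        using te(1,2) TR c(2) in_piece piece_closed by blast+
      have "r = t \<oplus> int p \<star> (zlin R ?w e \<oplus> s)"
        using cl by (simp add: c(3) te(3) add.int_pow_distrib a_assoc)
      then show ?thesis using te(1) piece_add[OF in_piece[OF te(2)] c(2)] by blast
    qed
    then show ?thesis using T(1) TR by blast
  qed
  show "\<exists>T. finite T \<and> card T \<le> p ^ card (Y n) \<and> T \<subseteq> Rg n \<and>
      (\<forall>r\<in>Rg n. \<exists>t\<in>T. \<exists>d\<in>decomposables n. \<exists>z\<in>Rg n. r = t \<oplus> d \<oplus> int p \<star> z)"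
  proof -
    have "finite ?S" using Y(2) by simp
    moreover have "card ?S = card (Y n)" by (rule card_image) (simp add: inj_on_def)
    ultimately obtain T where T: "finite T" "card T \<le> p ^ card (Y n)" "T \<subseteq> zlin R ?w ` zcoeffs ?S"
      "\<And>c. c \<in> zcoeffs ?S \<Longrightarrow> \<exists>t\<in>T. \<exists>e\<in>zcoeffs ?S. zlin R ?w c = t \<oplus> int p \<star> zlin R ?w e"
      using zlin_residues[OF _ p wS(2)] by metis
    have TR: "T \<subseteq> Rg n" using T(3) in_piece_S by blast
    have "\<exists>t\<in>T. \<exists>d\<in>decomposables n. \<exists>z\<in>Rg n. r = t \<oplus> d \<oplus> int p \<star> z" if r: "r \<in> Rg n" for r
    proof -
      obtain c s where c: "c \<in> zcoeffs ?M" "s \<in> Rg n" "r = zlin R ?w c \<oplus> int p \<star> s"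
        using span[OF r] by blast
      \<comment> \<open>The part of the combination on single generators is reduced modulo \<open>p\<close>; the rest is
        decomposable.\<close>
      define c1 where "c1 m = (if m \<in> ?S then c m else 0)" for m
      define c2 where "c2 m = (if m \<notin> ?S then c m else 0)" for m
      have c1: "c1 \<in> zcoeffs ?S"
        using zcoeffs_mono[OF zcoeffs_restrict[OF c(1), of "\<lambda>m. m \<in> ?S"], of ?S]
        unfolding c1_def[abs_def] by blast
      have c2: "c2 \<in> zcoeffs (?M - ?S)"
        using zcoeffs_mono[OF zcoeffs_restrict[OF c(1), of "\<lambda>m. m \<notin> ?S"], of "?M - ?S"]
        unfolding c2_def[abs_def] by blast
      have c1M: "c1 \<in> zcoeffs ?M" and c2M: "c2 \<in> zcoeffs ?M"
        using zcoeffs_mono[OF c1 SM] zcoeffs_mono[OF c2] by blast+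
      have "c = (\<lambda>m. c1 m + c2 m)" by (auto simp: c1_def c2_def)
      then have split: "zlin R ?w c = zlin R ?w c1 \<oplus> zlin R ?w c2"
        using zlin_add[OF c1M c2M wR] by simp
      have "?w \<in> ?M - ?S \<rightarrow> decomposables n"
      proof (rule Pi_I)
        fix m assume "m \<in> ?M - ?S"
        then show "?w m \<in> decomposables n"
          by (intro mval_decomposable[OF Y(1,3) v]) auto
      qed
      then have d: "zlin R ?w c2 \<in> decomposables n"
        by (rule zlin_in_subgroup[OF decomposables_subgroup c2])
      obtain t e where te: "t \<in> T" "e \<in> zcoeffs ?S" "zlin R ?w c1 = t \<oplus> int p \<star> zlin R ?w e"
        using T(4)[OF c1] by blast
      have cl: "t \<in> carrier R" "s \<in> carrier R" "zlin R ?w e \<in> carrier R" "zlin R ?w c2 \<in> carrier R"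
        using te(1,2) TR c(2) in_piece_S in_piece[OF c2M] piece_closed by blast+
      have "r = t \<oplus> zlin R ?w c2 \<oplus> int p \<star> (zlin R ?w e \<oplus> s)"
        using cl by (simp add: c(3) split te(3) add.int_pow_distrib a_ac)
      then show ?thesis using te(1) d piece_add[OF in_piece_S[OF te(2)] c(2)] by blast
    qed
    then show ?thesis using T(1,2) TR by blast
  qed
qed

lemma pieces_disjoint:
  assumes "x \<in> Rg i" "x \<in> Rg j" "i \<noteq> j"
  shows "x = \<zero>"
proof -
  have xR: "x \<in> carrier R" using assms(1) by (rule piece_closed)
  have "(\<lambda>n. if n = i then x else \<zero>) = (\<lambda>n. if n = j then x else \<zero>)"
    by (rule homogeneous_unique[of "{i, j}"]) (use assms piece_zero xR in \<open>auto\<close>)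
  then have "x = (if i = j then x else \<zero>)"
    by (metis (mono_tags, lifting))
  then show ?thesis using assms(3) by simp
qed

text \<open>Generators modulo decomposables generate the ring, by induction on the degree.\<close>

lemma monomials_span:
  assumes Y: "disjoint_family Y" "\<And>n. Y n \<subseteq> Rg n"
    and gen: "\<And>n E. additive_subgroup E R \<Longrightarrow> Y n \<subseteq> E \<Longrightarrow> decomposables n \<subseteq> E \<Longrightarrow> Rg n \<subseteq> E"
  shows "zlin R (mval R (\<lambda>y. y)) ` zcoeffs (degree_monomials Y n) = Rg n"
proof -
  let ?w = "mval R (\<lambda>y. y)"
  let ?U = "\<Union>i. Y i"
  let ?E = "\<lambda>n. zlin R ?w ` zcoeffs (degree_monomials Y n)"
  have id: "y \<in> Rg n" if "y \<in> Y n" for n y using that Y(2) by blast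
  have w: "?w \<in> degree_monomials Y n \<rightarrow> Rg n" for n
    by (rule Pi_I, rule mval_degree_monomial[OF Y(1)], rule id, assumption+)
  then have wR: "?w \<in> degree_monomials Y n \<rightarrow> carrier R" for n using piece_closed by blast
  have UR: "(\<lambda>y. y) \<in> ?U \<rightarrow> carrier R" using id piece_closed by blast
  have hom: "zlin R ?w \<in> ring_hom (monoid_ring \<Z> (monomials ?U)) R"
    by (rule zlin_ring_hom[OF comm_monoid_monomials is_cring mval_hom[OF UR]]) simp
  have single: "?w m \<in> ?E n" if "m \<in> degree_monomials Y n" for m n
  proof (rule image_eqI)
    show "mr_single \<Z> m 1 \<in> zcoeffs (degree_monomials Y n)" by (rule zcoeffs_single) fact
    have "?w m \<in> carrier R" using wR that by (rule funcset_mem)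
    then show "?w m = zlin R ?w (mr_single \<Z> m 1)"
      by (simp add: zlin_single)
  qed
  have mult: "x \<otimes> y \<in> ?E (i + j)" if x: "x \<in> ?E i" and y: "y \<in> ?E j" for x y i j
  proof -
    obtain f g where f: "f \<in> zcoeffs (degree_monomials Y i)" "x = zlin R ?w f"
      and g: "g \<in> zcoeffs (degree_monomials Y j)" "y = zlin R ?w g"
      using x y by blast
    have U: "zcoeffs (degree_monomials Y n) \<subseteq> carrier (monoid_ring \<Z> (monomials ?U))" for n
      unfolding carrier_monoid_ring_Z zcoeffs_def degree_monomials_def by auto
    interpret Q: cring "monoid_ring \<Z> (monomials ?U)"
      by (rule cring_monoid_ring_Z[OF comm_monoid_monomials])
    let ?fg = "f \<otimes>\<^bsub>monoid_ring \<Z> (monomials ?U)\<^esub> g"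
    have fg: "f \<in> carrier (monoid_ring \<Z> (monomials ?U))" "g \<in> carrier (monoid_ring \<Z> (monomials ?U))"
      using U f(1) g(1) by blast+
    have "{m. ?fg m \<noteq> 0} \<subseteq> (\<lambda>(a, b). a \<otimes>\<^bsub>monomials ?U\<^esub> b) ` ({a. f a \<noteq> 0} \<times> {b. g b \<noteq> 0})"
      using f(1) g(1) by (intro monoid_ring_Z_mult_support) (auto simp: zcoeffs_def)
    also have "\<dots> \<subseteq> degree_monomials Y (i + j)"
    proof -
      have "a \<in> degree_monomials Y i" if "f a \<noteq> 0" for a using f(1) that by (auto simp: zcoeffs_def)
      moreover have "b \<in> degree_monomials Y j" if "g b \<noteq> 0" for b
        using g(1) that by (auto simp: zcoeffs_def)
      ultimately show ?thesis by (auto intro!: degree_monomials_add)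
    qed
    finally have "?fg \<in> zcoeffs (degree_monomials Y (i + j))"
      using Q.m_closed[OF fg] by (auto simp: zcoeffs_def carrier_monoid_ring_Z)
    moreover have "x \<otimes> y = zlin R ?w ?fg"
      by (simp only: f(2) g(2) ring_hom_mult[OF hom fg])
    ultimately show ?thesis by blast
  qed
  have "Rg n \<subseteq> ?E n" for n
  proof (induction n rule: less_induct)
    case (less n)
    show ?case
    proof (rule gen)
      show E: "additive_subgroup (?E n) R" by (rule zlin_subgroup[OF wR])
      show "Y n \<subseteq> ?E n"
      proof
        fix y assume y: "y \<in> Y n"
        then have "{#y#} \<in> degree_monomials Y n"
          using gen_degree_eq[OF Y(1) y] by (auto simp: degree_monomials_def)
        then show "y \<in> ?E n"
          using single[of "{#y#}" n] id[OF y] piece_closed by (simp add: mval_single)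
      qed
      show "decomposables n \<subseteq> ?E n"
      proof (rule decomposables_minimal[OF E])
        fix x y i j assume xy: "x \<in> Rg i" "y \<in> Rg j" "1 \<le> i" "1 \<le> j" "i + j = n"
        then have "x \<in> ?E i" "y \<in> ?E j" using less[of i] less[of j] by auto
        then show "x \<otimes> y \<in> ?E n" using mult xy(5) by blast
      next
        assume "n = 0"
        then show "\<one> \<in> ?E n"
          using single[of "{#}" n] by (simp add: degree_monomials_def)
      qed
    qed
  qed
  moreover have "?E n \<subseteq> Rg n"
    using zlin_in_subgroup[OF piece_subgroup _ w] by blast
  ultimately show ?thesis by blast
qed

text \<open>Evaluation of polynomials is bijective as soon as it is so in each degree: by directness of the
  grading, a polynomial that evaluates to zero has homogeneous components that do.\<close>

lemma graded_poly_alg_on_of_basis: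
  assumes Y: "disjoint_family Y" "\<And>n. Y n \<subseteq> Rg n"
    and span: "\<And>n. zlin R (mval R (\<lambda>y. y)) ` zcoeffs (degree_monomials Y n) = Rg n"
    and indep: "\<And>n. zindep R (mval R (\<lambda>y. y)) (degree_monomials Y n)"
  shows "graded_poly_alg_on \<Z> R Rg (\<lambda>k. k \<star> \<one>) Y"
proof -
  let ?U = "\<Union>i. Y i"
  let ?w = "mval R (\<lambda>y. y)"
  let ?h = "zlin R ?w"
  let ?Q = "poly_alg \<Z> ?U"
  have UR: "(\<lambda>y. y) \<in> ?U \<rightarrow> carrier R" using Y(2) piece_closed by blast
  have hom: "?h \<in> ring_hom ?Q R"
    unfolding poly_alg_def
    by (rule zlin_ring_hom[OF comm_monoid_monomials is_cring mval_hom[OF UR]]) simp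
  have Q: "carrier ?Q = zcoeffs (carrier (monomials ?U))"
    by (simp only: poly_alg_def carrier_monoid_ring_Z)
  have wU: "?w \<in> carrier (monomials ?U) \<rightarrow> carrier R"
    using mval_hom[OF UR] by (auto simp: hom_def)
  have dU: "degree_monomials Y n \<subseteq> carrier (monomials ?U)" for n
    by (auto simp: degree_monomials_def)
  have kernel: "f = (\<lambda>m. 0)" if f: "f \<in> carrier ?Q" "?h f = \<zero>" for f
  proof -
    let ?deg = "\<lambda>m. \<Sum>y\<in>#m. gen_degree Y y"
    define c where "c n m = (if ?deg m = n then f m else 0)" for n m
    have fU: "finite {m. f m \<noteq> 0}" "{m. f m \<noteq> 0} \<subseteq> carrier (monomials ?U)"
      using f(1) by (auto simp: Q zcoeffs_def)
    then have fU': "m \<in> degree_monomials Y (?deg m)" if "f m \<noteq> 0" for m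
      using that unfolding degree_monomials_def by (simp add: subset_iff)
    have c: "c n \<in> zcoeffs (degree_monomials Y n)" for n
    proof -
      have "f \<in> zcoeffs {m. f m \<noteq> 0}" using fU(1) by (simp add: zcoeffs_def)
      then have "c n \<in> zcoeffs {m \<in> {m. f m \<noteq> 0}. ?deg m = n}"
        unfolding c_def[abs_def] by (rule zcoeffs_restrict)
      moreover have "{m \<in> {m. f m \<noteq> 0}. ?deg m = n} \<subseteq> degree_monomials Y n"
        using fU' by blast
      ultimately show ?thesis by (rule zcoeffs_mono)
    qed
    then have cU: "c n \<in> zcoeffs (carrier (monomials ?U))" for n
      using dU unfolding zcoeffs_def by blast
    let ?N = "?deg ` {m. f m \<noteq> 0}"
    have finN: "finite ?N" using fU(1) by simp
    have "f m = (\<Sum>n\<in>?N. 1 * c n m)" for m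
    proof (cases "f m = 0")
      case False
      then have "(\<Sum>n\<in>?N. 1 * c n m) = (\<Sum>n\<in>{?deg m}. 1 * c n m)"
        using finN by (intro sum.mono_neutral_right) (auto simp: c_def)
      then show ?thesis by (simp add: c_def)
    next
      case True
      then have "c n m = 0" for n by (simp add: c_def)
      then show ?thesis using True by simp
    qed
    then have "f = (\<lambda>m. \<Sum>n\<in>?N. 1 * c n m)" by (rule ext)
    then have hf: "?h f = (\<Oplus>n\<in>?N. 1 \<star> ?h (c n))"
      using zlin_sum[OF finN, of c "carrier (monomials ?U)" ?w "\<lambda>_. 1"] cU wU by simp
    have hc: "?h (c n) \<in> Rg n" for n using c span by blast
    have "1 \<star> ?h (c n) = ?h (c n)" for n
      by (rule add.int_pow_1[OF piece_closed[OF hc]])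
    then have "(\<Oplus>n\<in>?N. ?h (c n)) = \<zero>"
      using hf f(2) by (simp only:)
    then have sum0: "(\<Oplus>n\<in>?N. ?h (c n)) = (\<Oplus>n\<in>?N. \<zero>)"
      by (simp only: finsum_zero)
    have "c n = (\<lambda>m. 0)" if n: "n \<notin> ?N" for n
    proof (rule ext)
      fix m show "c n m = 0" using n by (cases "f m = 0") (auto simp: c_def)
    qed
    then have "?h (c n) = \<zero>" if "n \<notin> ?N" for n
      using that zlin_zero by simp
    then have "(\<lambda>n. ?h (c n)) = (\<lambda>n. \<zero>)"
      by (intro homogeneous_unique[OF finN]) (use hc piece_zero sum0 in auto)
    then have "\<forall>m\<in>degree_monomials Y n. c n m = 0" for n
      using indep[of n] c[of n] unfolding zindep_def by (metis (mono_tags))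
    then have c0: "c n m = 0" if "m \<in> degree_monomials Y n" for n m
      using that by blast
    have "f m = 0" for m
    proof (rule ccontr)
      assume "f m \<noteq> 0"
      then show False using c0[OF fU'[of m]] by (simp add: c_def)
    qed
    then show ?thesis by (rule ext)
  qed
  have inj: "inj_on ?h (carrier ?Q)"
  proof (rule inj_onI)
    fix f g assume fg: "f \<in> carrier ?Q" "g \<in> carrier ?Q" "?h f = ?h g"
    have g': "(\<lambda>m. -1 * g m) \<in> carrier ?Q"
      using fg(2) unfolding Q by (rule zcoeffs_scale)
    have d: "(\<lambda>m. f m + -1 * g m) \<in> carrier ?Q"
      using fg(1) g' unfolding Q by (rule zcoeffs_add)
    have "?h (\<lambda>m. f m + -1 * g m) = ?h f \<oplus> (-1) \<star> ?h g"
      using fg(1,2) g' unfolding Q by (simp only: zlin_add[OF _ _ wU] zlin_scale[OF _ wU])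
    also have "\<dots> = \<zero>"
    proof -
      have "?h g \<in> carrier R" using fg(2) unfolding Q by (rule zlin_closed[OF _ wU])
      then show ?thesis
        using add.int_pow_neg[of "?h g" 1] by (simp add: fg(3) r_neg)
    qed
    finally have "(\<lambda>m. f m + -1 * g m) = (\<lambda>m. 0)" by (rule kernel[OF d])
    then have "f m + -1 * g m = 0" for m by (rule fun_cong)
    then show "f = g" by (intro ext) simp
  qed
  have "?h ` carrier ?Q = carrier R"
  proof
    show "?h ` carrier ?Q \<subseteq> carrier R" using ring_hom_closed[OF hom] by blast
    show "carrier R \<subseteq> ?h ` carrier ?Q"
    proof
      fix x assume "x \<in> carrier R"
      then obtain c where c: "\<And>n. c n \<in> Rg n" "finite {n. c n \<noteq> \<zero>}" "x = (\<Oplus>n\<in>{n. c n \<noteq> \<zero>}. c n)"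
        using direct_sum by blast
      have "zcoeffs (degree_monomials Y n) \<subseteq> carrier ?Q" for n
        using dU unfolding Q zcoeffs_def by blast
      then have "Rg n \<subseteq> ?h ` carrier ?Q" for n
        using span[of n] by blast
      then have "c \<in> {n. c n \<noteq> \<zero>} \<rightarrow> ?h ` carrier ?Q" using c(1) by blast
      then show "x \<in> ?h ` carrier ?Q"
        unfolding c(3) Q using c(2) by (intro additive_subgroup_finsum[OF zlin_subgroup[OF wU]])
    qed
  qed
  then have iso: "?h \<in> ring_iso ?Q R"
    using hom inj by (simp add: ring_iso_def bij_betw_def)
  show ?thesis
    unfolding graded_poly_alg_on_def
  proof (intro bexI[OF _ iso] conjI ballI allI)
    fix k show "?h (mr_single \<Z> {#} k) = k \<star> \<one>"
      by (subst zlin_single) simp_all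
  next
    fix n show "?h ` poly_alg_piece \<Z> Y n = Rg n"
      by (simp only: poly_alg_piece_Z span)
  next
    fix y assume "y \<in> ?U"
    then have "y \<in> carrier R" using UR by blast
    then show "?h (mr_single \<Z> {#y#} \<one>\<^bsub>\<Z>\<^esub>) = y"
      by (subst zlin_single) (simp_all add: mval_single)
  qed
qed

end

section \<open>Comparison of ranks\<close>

theorem theorem5p2:
  fixes R :: "('r, 'm) ring_scheme"
    and Rg :: "nat \<Rightarrow> 'r set"
    and Y0 :: "nat \<Rightarrow> ('r \<times> rat \<Rightarrow> int) set set"
    and Yp :: "nat \<Rightarrow> nat \<Rightarrow> ('r \<times> (nat \<Rightarrow> int) \<Rightarrow> int) set set"
  assumes graded: "graded_cring R Rg"
    and free: "\<And>n. \<exists>B :: 'r set. (add_monoid R)\<lparr>carrier := Rg n\<rparr> \<cong> free_Abelian_group B"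
    and Y0_graded: "graded_subset (tensor_piece R Rg rat_ring) Y0" "Y0 0 = {}"
    and Yp_graded: "\<And>p. Factorial_Ring.prime p \<Longrightarrow>
      graded_subset (tensor_piece R Rg (padic_int_ring p)) (Yp p) \<and> Yp p 0 = {}"
    and a: "\<And>n. finite (Y0 n)"
      "\<And>p n. Factorial_Ring.prime p \<Longrightarrow> finite (Yp p n) \<and> card (Yp p n) = card (Y0 n)"
    and b0: "graded_poly_alg_on rat_ring (tensor_ring R rat_ring) (tensor_piece R Rg rat_ring)
      (\<lambda>c. pure_tensor R rat_ring \<one>\<^bsub>R\<^esub> c) Y0"
    and bp: "\<And>p. Factorial_Ring.prime p \<Longrightarrow>
      graded_poly_alg_on (padic_int_ring p) (tensor_ring R (padic_int_ring p))
        (tensor_piece R Rg (padic_int_ring p))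
        (\<lambda>c. pure_tensor R (padic_int_ring p) \<one>\<^bsub>R\<^esub> c) (Yp p)"
  shows "\<exists>Y :: nat \<Rightarrow> 'r set. graded_subset Rg Y \<and>
    (\<forall>n. finite (Y n) \<and> card (Y n) = card (Y0 n)) \<and>
    graded_poly_alg_on \<Z> R Rg (\<lambda>k. [k] \<cdot>\<^bsub>R\<^esub> \<one>\<^bsub>R\<^esub>) Y"
proof -
  interpret graded_cring R Rg by (rule graded)
  have Y0_dis: "disjoint_family Y0" using Y0_graded(1) by (simp add: graded_subset_def)
  obtain v0 where v0: "\<forall>n. \<forall>y\<in>Y0 n. v0 y \<in> Rg n"
    and indep0: "\<And>n. zindep R (mval R v0) (degree_monomials Y0 n)"
    using monomials_independent_rational[OF Y0_graded(1) b0] by blast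
  have "\<exists>C. C \<subseteq> Rg n \<and> finite C \<and> card C \<le> card (Y0 n) \<and> \<zero>\<^bsub>R\<^esub> \<notin> C \<and>
    (\<forall>E. additive_subgroup E R \<longrightarrow> C \<subseteq> E \<longrightarrow> decomposables n \<subseteq> E \<longrightarrow> Rg n \<subseteq> E)" for n
  proof -
    obtain B :: "'r set" where B: "(add_monoid R)\<lparr>carrier := Rg n\<rparr> \<cong> free_Abelian_group B"
      using free by blast
    have counts: "(\<exists>T. finite T \<and> T \<subseteq> Rg n \<and> (\<forall>r\<in>Rg n. \<exists>t\<in>T. \<exists>z\<in>Rg n. r = t \<oplus>\<^bsub>R\<^esub> int p \<star>\<^bsub>R\<^esub> z))
      \<and> (\<exists>T. finite T \<and> card T \<le> p ^ card (Y0 n) \<and> T \<subseteq> Rg n \<and> (\<forall>r\<in>Rg n. \<exists>t\<in>T.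
          \<exists>d\<in>decomposables n. \<exists>z\<in>Rg n. r = t \<oplus>\<^bsub>R\<^esub> d \<oplus>\<^bsub>R\<^esub> int p \<star>\<^bsub>R\<^esub> z))"
      if p: "Factorial_Ring.prime p" for p
    proof -
      have Yp: "disjoint_family (Yp p)" "\<And>n. finite (Yp p n)" "Yp p 0 = {}"
        using Yp_graded[OF p] a(2)[OF p] by (simp_all add: graded_subset_def)
      obtain v where v: "\<forall>n. \<forall>y\<in>Yp p n. v y \<in> Rg n"
        and span: "\<forall>n. \<forall>r\<in>Rg n. \<exists>c\<in>zcoeffs (degree_monomials (Yp p) n). \<exists>t\<in>Rg n.
          r = zlin R (mval R v) c \<oplus>\<^bsub>R\<^esub> int p \<star>\<^bsub>R\<^esub> t"
        using monomials_span_mod_prime[OF p conjunct1[OF Yp_graded[OF p]] bp[OF p]] by blast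
      have card: "card (Yp p n) = card (Y0 n)" using a(2)[OF p] by blast
      show ?thesis
        unfolding card[symmetric]
        by (intro conjI piece_counts_mod_prime[where v = v, OF prime_gt_0_nat[OF p] Yp])
          (use v span in blast)+
    qed
    show ?thesis
    proof (rule generators_of_free_subgroup[OF piece_subgroup decomposables_subgroup
          decomposables_subset B])
      show "\<exists>T. finite T \<and> T \<subseteq> Rg n \<and> (\<forall>r\<in>Rg n. \<exists>t\<in>T. \<exists>z\<in>Rg n. r = t \<oplus>\<^bsub>R\<^esub> 2 \<star>\<^bsub>R\<^esub> z)"
        using conjunct1[OF counts[OF two_is_prime_nat]] by simp
    qed (rule conjunct2[OF counts])
  qed
  then obtain Y where Y: "\<And>n. Y n \<subseteq> Rg n" "\<And>n. finite (Y n)" "\<And>n. card (Y n) \<le> card (Y0 n)"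
    "\<And>n. \<zero>\<^bsub>R\<^esub> \<notin> Y n"
    and gen: "\<And>n E. additive_subgroup E R \<Longrightarrow> Y n \<subseteq> E \<Longrightarrow> decomposables n \<subseteq> E \<Longrightarrow> Rg n \<subseteq> E"
    by metis
  have Y_dis: "disjoint_family Y"
    unfolding disjoint_family_on_def using Y(1,4) pieces_disjoint by blast
  have span: "zlin R (mval R (\<lambda>y. y)) ` zcoeffs (degree_monomials Y n) = Rg n" for n
    by (rule monomials_span[OF Y_dis Y(1) gen])
  \<comment> \<open>Independent monomials in the rational generators bound the number of monomials from below,
    the number of generators bounds it from above; so both bounds are attained.\<close>
  have card_indep: "card (Y n) = card (Y0 n) \<and> zindep R (mval R (\<lambda>y. y)) (degree_monomials Y n)" for n
  proof -
    have Y_0: "Y 0 = {}" using Y(2,3)[of 0] Y0_graded(2) by simp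
    have fin0: "finite (degree_monomials Y0 n)"
      by (rule finite_degree_monomials[OF Y0_dis a(1) Y0_graded(2)])
    have fin: "finite (degree_monomials Y n)"
      by (rule finite_degree_monomials[OF Y_dis Y(2) Y_0])
    have w: "mval R (\<lambda>y. y) \<in> degree_monomials Y n \<rightarrow> carrier R"
    proof (rule Pi_I)
      fix m assume "m \<in> degree_monomials Y n"
      then have "mval R (\<lambda>y. y) m \<in> Rg n"
        by (intro mval_degree_monomial[OF Y_dis]) (use Y(1) in blast)+
      then show "mval R (\<lambda>y. y) m \<in> carrier R" by (rule piece_closed)
    qed
    have v_span: "mval R v0 ` degree_monomials Y0 n
        \<subseteq> zlin R (mval R (\<lambda>y. y)) ` zcoeffs (degree_monomials Y n)"
      unfolding span
    proof (rule image_subsetI)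
      fix m assume "m \<in> degree_monomials Y0 n"
      then show "mval R v0 m \<in> Rg n"
        by (intro mval_degree_monomial[OF Y0_dis]) (use v0 in blast)+
    qed
    have le: "card (degree_monomials Y0 n) \<le> card (degree_monomials Y n)"
      by (rule zindep_card_le[OF fin0 fin w v_span indep0])
    have ge: "card (degree_monomials Y n) \<le> card (degree_monomials Y0 n)"
      by (rule card_degree_monomials_mono(1)[OF Y_dis Y(2) Y0_dis a(1) Y0_graded(2) Y(3)])
    have "card (Y n) = card (Y0 n)"
      by (rule card_degree_monomials_mono(2)[OF Y_dis Y(2) Y0_dis a(1) Y0_graded(2) Y(3)])
        (use le ge in simp)
    moreover have "zindep R (mval R (\<lambda>y. y)) (degree_monomials Y n)"
      by (rule zindep_of_span[OF fin0 fin w v_span indep0 ge])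
    ultimately show ?thesis by blast
  qed
  show ?thesis
  proof (intro exI[of _ Y] conjI allI)
    show "graded_subset Rg Y" using Y(1) Y_dis by (simp add: graded_subset_def)
    show "graded_poly_alg_on \<Z> R Rg (\<lambda>k. [k] \<cdot>\<^bsub>R\<^esub> \<one>\<^bsub>R\<^esub>) Y"
      using card_indep by (intro graded_poly_alg_on_of_basis[OF Y_dis Y(1) span]) blast
  qed (use Y(2) card_indep in blast)+
qed

end
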